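(* Let the category $\mathsf{B}$ be additive, $P\colon \mathsf{X}\to\mathsf{B}$ a cartesian monoidal opfibration, and $F\colon \mathsf{B}\to\mathbb{C}\mathsf{at}$ its associated pseudofunctor. Then $F$ factors through $\mathbb{S}\mathsf{ym}2\mathbb{G}\mathsf{p}$ if and only if $P$ has groupoidal fibres (i.e. every fibre of $P$ is a groupoid).
   Context: A cartesian monoidal opfibration is a (cloven) opfibration $P\colon\mathsf X\to\mathsf B$ such that $\mathsf X$ and $\mathsf B$ have finite products, $P$ strictly preserves them (as a strict monoidal functor), and products of cocartesian arrows are cocartesian. The associated pseudofunctor $F$ sends $A$ to the fibre $F(A)$ of $P$ over $A$ and $f$ to the change-of-base functor $f_*$ determined by cocartesian liftings. $F$ is lax symmetric monoidal $(\mathsf B,\times,I_{\mathsf B})\to(\mathbb{C}\mathsf{at},\times,\mathsf I)$ via $R^{A,B}(X,Y)=X\times Y$ (product in $\mathsf X$) and $R^1(\star)=I_{\mathsf X}$ (terminal object of $\mathsf X$), where $\mathsf I$ is the terminal category with object $\star$. Hence, for a commutative monoid $(M,m,e)$ in $\mathsf B$ (in particular for the unique internal abelian group structure on any object of the additive category $\mathsf B$), $F(M)$ is a symmetric monoidal category with tensor $\otimes=F(m)\circ R^{M,M}$ and unit $(F(e)\circ R^1)(\star)$. A symmetric 2-group is a symmetric monoidal groupoid in which every object is weakly invertible with respect to the tensor product; $\mathbb{S}\mathsf{ym}2\mathbb{G}\mathsf p$ is the 2-category of symmetric 2-groups. "$F$ factors through $\mathbb{S}\mathsf{ym}2\mathbb{G}\mathsf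 p$" means that, when each fibre $F(A)$ is given the symmetric monoidal structure with tensor $\otimes=F(m)\circ R^{A,A}$ and unit $(F(e)\circ R^1)(\star)$, where $m\colon A\times A\to A$ and $e\colon I_{\mathsf B}\to A$ are the multiplication and identity of the unique internal abelian group structure on $A$, $F$ is the composite of a pseudofunctor $\mathsf B\to\mathbb{S}\mathsf{ym}2\mathbb{G}\mathsf p$ with the forgetful 2-functor $\mathbb{S}\mathsf{ym}2\mathbb{G}\mathsf p\to\mathbb{C}\mathsf{at}$. *)

theory Defs
  imports "HOL-Algebra.Group" "HOL-Library.FuncSet"
begin

section \<open>Categories, functors, natural transformations\<close>

record ('o, 'a) category =
  Obj :: "'o set"
  Arr :: "'a set"
  Dom :: "'a \<Rightarrow> 'o"
  Cod :: "'a \<Rightarrow> 'o"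
  Idn :: "'o \<Rightarrow> 'a"
  Cmp :: "'a \<Rightarrow> 'a \<Rightarrow> 'a"  (infixr "\<cdot>\<index>" 70)

definition Hom :: "('o, 'a, 'm) category_scheme \<Rightarrow> 'o \<Rightarrow> 'o \<Rightarrow> 'a set" where
  "Hom C A B = {f \<in> Arr C. Dom C f = A \<and> Cod C f = B}"

locale category =
  fixes C (structure)
  assumes dom_closed: "f \<in> Arr C \<Longrightarrow> Dom C f \<in> Obj C"
    and cod_closed: "f \<in> Arr C \<Longrightarrow> Cod C f \<in> Obj C"
    and id_closed: "A \<in> Obj C \<Longrightarrow> Idn C A \<in> Hom C A A"
    and comp_closed: "f \<in> Hom C A B \<Longrightarrow> g \<in> Hom C B D \<Longrightarrow> g \<cdot> f \<in> Hom C A D"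
    and id_left: "f \<in> Hom C A B \<Longrightarrow> Idn C B \<cdot> f = f"
    and id_right: "f \<in> Hom C A B \<Longrightarrow> f \<cdot> Idn C A = f"
    and comp_assoc: "f \<in> Hom C A B \<Longrightarrow> g \<in> Hom C B D \<Longrightarrow> h \<in> Hom C D E
      \<Longrightarrow> (h \<cdot> g) \<cdot> f = h \<cdot> (g \<cdot> f)"

definition inverse_arrows :: "('o, 'a, 'm) category_scheme \<Rightarrow> 'a \<Rightarrow> 'a \<Rightarrow> bool" where
  "inverse_arrows C f g \<longleftrightarrow> f \<in> Arr C \<and> g \<in> Hom C (Cod C f) (Dom C f)
     \<and> g \<cdot>\<^bsub>C\<^esub> f = Idn C (Dom C f) \<and> f \<cdot>\<^bsub>C\<^esub> g = Idn C (Cod C f)"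

definition isomorphism :: "('o, 'a, 'm) category_scheme \<Rightarrow> 'a \<Rightarrow> bool" where
  "isomorphism C f \<longleftrightarrow> (\<exists>g. inverse_arrows C f g)"

definition isomorphic :: "('o, 'a, 'm) category_scheme \<Rightarrow> 'o \<Rightarrow> 'o \<Rightarrow> bool" where
  "isomorphic C A B \<longleftrightarrow> (\<exists>f \<in> Hom C A B. isomorphism C f)"

definition groupoid :: "('o, 'a, 'm) category_scheme \<Rightarrow> bool" where
  "groupoid C \<longleftrightarrow> category C \<and> (\<forall>f \<in> Arr C. isomorphism C f)"

definition terminal_category :: "(unit, unit) category" where
  "terminal_category = \<lparr>Obj = UNIV, Arr = UNIV, Dom = (\<lambda>_. ()), Cod = (\<lambda>_. ()),
     Idn = (\<lambda>_. ()), Cmp = (\<lambda>_ _. ())\<rparr>"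

definition product_category ::
  "('o, 'a, 'm) category_scheme \<Rightarrow> ('p, 'b, 'n) category_scheme \<Rightarrow> ('o \<times> 'p, 'a \<times> 'b) category" where
  "product_category C D = \<lparr>Obj = Obj C \<times> Obj D, Arr = Arr C \<times> Arr D,
     Dom = map_prod (Dom C) (Dom D), Cod = map_prod (Cod C) (Cod D),
     Idn = map_prod (Idn C) (Idn D),
     Cmp = (\<lambda>(g, g') (f, f'). (g \<cdot>\<^bsub>C\<^esub> f, g' \<cdot>\<^bsub>D\<^esub> f'))\<rparr>"

record ('o, 'a, 'p, 'b) cat_functor =
  Src :: "('o, 'a) category"
  Tgt :: "('p, 'b) category"
  ObF :: "'o \<Rightarrow> 'p"
  ArF :: "'a \<Rightarrow> 'b"

locale is_functor =
  source: category "Src F" + target: category "Tgt F"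
  for F :: "('o, 'a, 'p, 'b) cat_functor" +
  assumes map_hom: "f \<in> Hom (Src F) A A' \<Longrightarrow> ArF F f \<in> Hom (Tgt F) (ObF F A) (ObF F A')"
    and map_obj: "A \<in> Obj (Src F) \<Longrightarrow> ObF F A \<in> Obj (Tgt F)"
    and map_id: "A \<in> Obj (Src F) \<Longrightarrow> ArF F (Idn (Src F) A) = Idn (Tgt F) (ObF F A)"
    and map_comp: "f \<in> Hom (Src F) A A' \<Longrightarrow> g \<in> Hom (Src F) A' A''
      \<Longrightarrow> ArF F (g \<cdot>\<^bsub>Src F\<^esub> f) = ArF F g \<cdot>\<^bsub>Tgt F\<^esub> ArF F f"

text \<open>A functor record carries total functions.  Requiring them to be undefined outside the source
  category makes equality of records the mathematical equality of functors; the same convention is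
  used below for the components of natural transformations and of monoidal structures.\<close>

definition functor_ext :: "('o, 'a, 'p, 'b) cat_functor \<Rightarrow> bool" where
  "functor_ext F \<longleftrightarrow> ObF F \<in> extensional (Obj (Src F)) \<and> ArF F \<in> extensional (Arr (Src F))"

definition id_functor :: "('o, 'a) category \<Rightarrow> ('o, 'a, 'o, 'a) cat_functor" where
  "id_functor C = \<lparr>Src = C, Tgt = C, ObF = (\<lambda>A \<in> Obj C. A), ArF = (\<lambda>f \<in> Arr C. f)\<rparr>"

definition comp_functor ::
  "('p, 'b, 'q, 'c) cat_functor \<Rightarrow> ('o, 'a, 'p, 'b) cat_functor \<Rightarrow> ('o, 'a, 'q, 'c) cat_functor" where
  "comp_functor G F = \<lparr>Src = Src F, Tgt = Tgt G,
     ObF = (\<lambda>A \<in> Obj (Src F). ObF G (ObF F A)),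
     ArF = (\<lambda>f \<in> Arr (Src F). ArF G (ArF F f))\<rparr>"

record ('o, 'a, 'p, 'b) nat_trans =
  NSrc :: "('o, 'a, 'p, 'b) cat_functor"
  NTgt :: "('o, 'a, 'p, 'b) cat_functor"
  NCmp :: "'o \<Rightarrow> 'b"

locale is_nat_trans =
  F: is_functor "NSrc \<tau>" + G: is_functor "NTgt \<tau>"
  for \<tau> :: "('o, 'a, 'p, 'b) nat_trans" +
  assumes same_src: "Src (NTgt \<tau>) = Src (NSrc \<tau>)"
    and same_tgt: "Tgt (NTgt \<tau>) = Tgt (NSrc \<tau>)"
    and component: "A \<in> Obj (Src (NSrc \<tau>)) \<Longrightarrow>
      NCmp \<tau> A \<in> Hom (Tgt (NSrc \<tau>)) (ObF (NSrc \<tau>) A) (ObF (NTgt \<tau>) A)"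
    and naturality: "f \<in> Hom (Src (NSrc \<tau>)) A A' \<Longrightarrow>
      NCmp \<tau> A' \<cdot>\<^bsub>Tgt (NSrc \<tau>)\<^esub> ArF (NSrc \<tau>) f
        = ArF (NTgt \<tau>) f \<cdot>\<^bsub>Tgt (NSrc \<tau>)\<^esub> NCmp \<tau> A"

definition id_trans :: "('o, 'a, 'p, 'b) cat_functor \<Rightarrow> ('o, 'a, 'p, 'b) nat_trans" where
  "id_trans F = \<lparr>NSrc = F, NTgt = F, NCmp = (\<lambda>A \<in> Obj (Src F). Idn (Tgt F) (ObF F A))\<rparr>"

definition vcomp_trans ::
  "('o, 'a, 'p, 'b) nat_trans \<Rightarrow> ('o, 'a, 'p, 'b) nat_trans \<Rightarrow> ('o, 'a, 'p, 'b) nat_trans" where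
  "vcomp_trans \<tau> \<sigma> = \<lparr>NSrc = NSrc \<sigma>, NTgt = NTgt \<tau>,
     NCmp = (\<lambda>A \<in> Obj (Src (NSrc \<sigma>)). NCmp \<tau> A \<cdot>\<^bsub>Tgt (NSrc \<sigma>)\<^esub> NCmp \<sigma> A)\<rparr>"

definition hcomp_trans ::
  "('p, 'b, 'q, 'c) nat_trans \<Rightarrow> ('o, 'a, 'p, 'b) nat_trans \<Rightarrow> ('o, 'a, 'q, 'c) nat_trans" where
  "hcomp_trans \<tau> \<sigma> = \<lparr>NSrc = comp_functor (NSrc \<tau>) (NSrc \<sigma>), NTgt = comp_functor (NTgt \<tau>) (NTgt \<sigma>),
     NCmp = (\<lambda>A \<in> Obj (Src (NSrc \<sigma>)).
       NCmp \<tau> (ObF (NTgt \<sigma>) A) \<cdot>\<^bsub>Tgt (NSrc \<tau>)\<^esub> ArF (NSrc \<tau>) (NCmp \<sigma> A))\<rparr>"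


section \<open>2-categories and pseudofunctors\<close>

record ('z, 's, 't) two_cat =
  Cell0 :: "'z set"
  Cell1 :: "'z \<Rightarrow> 'z \<Rightarrow> 's set"
  Cell2 :: "'s \<Rightarrow> 's \<Rightarrow> 't set"
  Id1 :: "'z \<Rightarrow> 's"
  Comp1 :: "'s \<Rightarrow> 's \<Rightarrow> 's"
  Id2 :: "'s \<Rightarrow> 't"
  VComp :: "'t \<Rightarrow> 't \<Rightarrow> 't"
  HComp :: "'t \<Rightarrow> 't \<Rightarrow> 't"

locale two_category =
  fixes K :: "('z, 's, 't) two_cat"
  assumes id1: "a \<in> Cell0 K \<Longrightarrow> Id1 K a \<in> Cell1 K a a"
    and comp1: "\<lbrakk>a \<in> Cell0 K; b \<in> Cell0 K; c \<in> Cell0 K; f \<in> Cell1 K a b; g \<in> Cell1 K b c\<rbrakk>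
      \<Longrightarrow> Comp1 K g f \<in> Cell1 K a c"
    and id1_left: "\<lbrakk>a \<in> Cell0 K; b \<in> Cell0 K; f \<in> Cell1 K a b\<rbrakk> \<Longrightarrow> Comp1 K (Id1 K b) f = f"
    and id1_right: "\<lbrakk>a \<in> Cell0 K; b \<in> Cell0 K; f \<in> Cell1 K a b\<rbrakk> \<Longrightarrow> Comp1 K f (Id1 K a) = f"
    and assoc1: "\<lbrakk>a \<in> Cell0 K; b \<in> Cell0 K; c \<in> Cell0 K; d \<in> Cell0 K;
        f \<in> Cell1 K a b; g \<in> Cell1 K b c; h \<in> Cell1 K c d\<rbrakk>
      \<Longrightarrow> Comp1 K (Comp1 K h g) f = Comp1 K h (Comp1 K g f)"
    and id2: "\<lbrakk>a \<in> Cell0 K; b \<in> Cell0 K; f \<in> Cell1 K a b\<rbrakk> \<Longrightarrow> Id2 K f \<in> Cell2 K f f"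
    and vcomp: "\<lbrakk>a \<in> Cell0 K; b \<in> Cell0 K; f \<in> Cell1 K a b; g \<in> Cell1 K a b; h \<in> Cell1 K a b;
        \<sigma> \<in> Cell2 K f g; \<tau> \<in> Cell2 K g h\<rbrakk> \<Longrightarrow> VComp K \<tau> \<sigma> \<in> Cell2 K f h"
    and id2_left: "\<lbrakk>a \<in> Cell0 K; b \<in> Cell0 K; f \<in> Cell1 K a b; g \<in> Cell1 K a b; \<sigma> \<in> Cell2 K f g\<rbrakk>
      \<Longrightarrow> VComp K (Id2 K g) \<sigma> = \<sigma>"
    and id2_right: "\<lbrakk>a \<in> Cell0 K; b \<in> Cell0 K; f \<in> Cell1 K a b; g \<in> Cell1 K a b; \<sigma> \<in> Cell2 K f g\<rbrakk>
      \<Longrightarrow> VComp K \<sigma> (Id2 K f) = \<sigma>"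
    and assoc2: "\<lbrakk>a \<in> Cell0 K; b \<in> Cell0 K;
        f \<in> Cell1 K a b; g \<in> Cell1 K a b; h \<in> Cell1 K a b; k \<in> Cell1 K a b;
        \<rho> \<in> Cell2 K f g; \<sigma> \<in> Cell2 K g h; \<tau> \<in> Cell2 K h k\<rbrakk>
      \<Longrightarrow> VComp K (VComp K \<tau> \<sigma>) \<rho> = VComp K \<tau> (VComp K \<sigma> \<rho>)"
    and hcomp: "\<lbrakk>a \<in> Cell0 K; b \<in> Cell0 K; c \<in> Cell0 K;
        f \<in> Cell1 K a b; f' \<in> Cell1 K a b; g \<in> Cell1 K b c; g' \<in> Cell1 K b c;
        \<sigma> \<in> Cell2 K f f'; \<tau> \<in> Cell2 K g g'\<rbrakk>
      \<Longrightarrow> HComp K \<tau> \<sigma> \<in> Cell2 K (Comp1 K g f) (Comp1 K g' f')"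
    and hcomp_id: "\<lbrakk>a \<in> Cell0 K; b \<in> Cell0 K; c \<in> Cell0 K; f \<in> Cell1 K a b; g \<in> Cell1 K b c\<rbrakk>
      \<Longrightarrow> HComp K (Id2 K g) (Id2 K f) = Id2 K (Comp1 K g f)"
    and interchange: "\<lbrakk>a \<in> Cell0 K; b \<in> Cell0 K; c \<in> Cell0 K;
        f \<in> Cell1 K a b; f' \<in> Cell1 K a b; f'' \<in> Cell1 K a b;
        g \<in> Cell1 K b c; g' \<in> Cell1 K b c; g'' \<in> Cell1 K b c;
        \<sigma> \<in> Cell2 K f f'; \<sigma>' \<in> Cell2 K f' f''; \<tau> \<in> Cell2 K g g'; \<tau>' \<in> Cell2 K g' g''\<rbrakk>
      \<Longrightarrow> HComp K (VComp K \<tau>' \<tau>) (VComp K \<sigma>' \<sigma>) = VComp K (HComp K \<tau>' \<sigma>') (HComp K \<tau> \<sigma>)"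
    and hcomp_id1_left: "\<lbrakk>a \<in> Cell0 K; b \<in> Cell0 K; f \<in> Cell1 K a b; g \<in> Cell1 K a b; \<sigma> \<in> Cell2 K f g\<rbrakk>
      \<Longrightarrow> HComp K (Id2 K (Id1 K b)) \<sigma> = \<sigma>"
    and hcomp_id1_right: "\<lbrakk>a \<in> Cell0 K; b \<in> Cell0 K; f \<in> Cell1 K a b; g \<in> Cell1 K a b; \<sigma> \<in> Cell2 K f g\<rbrakk>
      \<Longrightarrow> HComp K \<sigma> (Id2 K (Id1 K a)) = \<sigma>"
    and hcomp_assoc: "\<lbrakk>a \<in> Cell0 K; b \<in> Cell0 K; c \<in> Cell0 K; d \<in> Cell0 K;
        f \<in> Cell1 K a b; f' \<in> Cell1 K a b; g \<in> Cell1 K b c; g' \<in> Cell1 K b c;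
        h \<in> Cell1 K c d; h' \<in> Cell1 K c d;
        \<rho> \<in> Cell2 K f f'; \<sigma> \<in> Cell2 K g g'; \<tau> \<in> Cell2 K h h'\<rbrakk>
      \<Longrightarrow> HComp K (HComp K \<tau> \<sigma>) \<rho> = HComp K \<tau> (HComp K \<sigma> \<rho>)"

definition invertible2 :: "('z, 's, 't) two_cat \<Rightarrow> 's \<Rightarrow> 's \<Rightarrow> 't \<Rightarrow> bool" where
  "invertible2 K f g \<tau> \<longleftrightarrow> \<tau> \<in> Cell2 K f g
     \<and> (\<exists>\<sigma> \<in> Cell2 K g f. VComp K \<sigma> \<tau> = Id2 K f \<and> VComp K \<tau> \<sigma> = Id2 K g)"

text \<open>A pseudofunctor out of an ordinary category: \<open>PComp F g f\<close> is the comparison cell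
  \<open>F g \<circ> F f \<Rightarrow> F (g \<circ> f)\<close> and \<open>PUnit F A\<close> is \<open>1 \<Rightarrow> F (1\<^sub>A)\<close>.  There are no conditions involving
  2-cells of the domain since these are all identities.\<close>

record ('b, 'f, 'z, 's, 't) pseudo =
  PObj :: "'b \<Rightarrow> 'z"
  PArr :: "'f \<Rightarrow> 's"
  PComp :: "'f \<Rightarrow> 'f \<Rightarrow> 't"
  PUnit :: "'b \<Rightarrow> 't"

locale pseudofunctor =
  category B + two_category K
  for B :: "('b, 'f, 'm) category_scheme" and K :: "('z, 's, 't) two_cat"
    and F :: "('b, 'f, 'z, 's, 't) pseudo" +
  assumes obj: "A \<in> Obj B \<Longrightarrow> PObj F A \<in> Cell0 K"
    and arr: "f \<in> Hom B A A' \<Longrightarrow> PArr F f \<in> Cell1 K (PObj F A) (PObj F A')"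
    and comp_cell: "f \<in> Hom B A A' \<Longrightarrow> g \<in> Hom B A' A'' \<Longrightarrow>
      invertible2 K (Comp1 K (PArr F g) (PArr F f)) (PArr F (g \<cdot>\<^bsub>B\<^esub> f)) (PComp F g f)"
    and unit_cell: "A \<in> Obj B \<Longrightarrow> invertible2 K (Id1 K (PObj F A)) (PArr F (Idn B A)) (PUnit F A)"
    and assoc_coherence: "f \<in> Hom B A A' \<Longrightarrow> g \<in> Hom B A' A'' \<Longrightarrow> h \<in> Hom B A'' A''' \<Longrightarrow>
      VComp K (PComp F h (g \<cdot>\<^bsub>B\<^esub> f)) (HComp K (Id2 K (PArr F h)) (PComp F g f))
        = VComp K (PComp F (h \<cdot>\<^bsub>B\<^esub> g) f) (HComp K (PComp F h g) (Id2 K (PArr F f)))"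
    and unit_right: "f \<in> Hom B A A' \<Longrightarrow>
      VComp K (PComp F f (Idn B A)) (HComp K (Id2 K (PArr F f)) (PUnit F A)) = Id2 K (PArr F f)"
    and unit_left: "f \<in> Hom B A A' \<Longrightarrow>
      VComp K (PComp F (Idn B A') f) (HComp K (PUnit F A') (Id2 K (PArr F f))) = Id2 K (PArr F f)"

definition same_pseudofunctor :: "('b, 'f, 'm) category_scheme \<Rightarrow>
    ('b, 'f, 'z, 's, 't) pseudo \<Rightarrow> ('b, 'f, 'z, 's, 't) pseudo \<Rightarrow> bool" where
  "same_pseudofunctor B F G \<longleftrightarrow>
     (\<forall>A \<in> Obj B. PObj F A = PObj G A \<and> PUnit F A = PUnit G A) \<and>
     (\<forall>f \<in> Arr B. PArr F f = PArr G f) \<and>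
     (\<forall>f \<in> Arr B. \<forall>g \<in> Arr B. Cod B f = Dom B g \<longrightarrow> PComp F g f = PComp G g f)"

record ('z, 's, 't, 'y, 'r, 'u) two_fun =
  Map0 :: "'z \<Rightarrow> 'y"
  Map1 :: "'s \<Rightarrow> 'r"
  Map2 :: "'t \<Rightarrow> 'u"

text \<open>Composition with a strict 2-functor, given by its action on cells.\<close>

definition comp_pseudo :: "('z, 's, 't, 'y, 'r, 'u) two_fun \<Rightarrow>
    ('b, 'f, 'z, 's, 't) pseudo \<Rightarrow> ('b, 'f, 'y, 'r, 'u) pseudo" where
  "comp_pseudo U G = \<lparr>PObj = (\<lambda>A. Map0 U (PObj G A)), PArr = (\<lambda>f. Map1 U (PArr G f)),
     PComp = (\<lambda>g f. Map2 U (PComp G g f)), PUnit = (\<lambda>A. Map2 U (PUnit G A))\<rparr>"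

definition Cat :: "(('o, 'a) category, ('o, 'a, 'o, 'a) cat_functor, ('o, 'a, 'o, 'a) nat_trans) two_cat" where
  "Cat = \<lparr>Cell0 = {C. category C},
     Cell1 = (\<lambda>C D. {F. is_functor F \<and> functor_ext F \<and> Src F = C \<and> Tgt F = D}),
     Cell2 = (\<lambda>F G. {\<tau>. is_nat_trans \<tau> \<and> NCmp \<tau> \<in> extensional (Obj (Src F)) \<and> NSrc \<tau> = F \<and> NTgt \<tau> = G}),
     Id1 = id_functor, Comp1 = comp_functor, Id2 = id_trans,
     VComp = vcomp_trans, HComp = hcomp_trans\<rparr>"


section \<open>Symmetric 2-groups\<close>

record ('o, 'a) monoidal_cat = "('o, 'a) category" +
  Ten :: "('o \<times> 'o, 'a \<times> 'a, 'o, 'a) cat_functor"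
  Unt :: "'o"
  Asc :: "'o \<Rightarrow> 'o \<Rightarrow> 'o \<Rightarrow> 'a"
  LUn :: "'o \<Rightarrow> 'a"
  RUn :: "'o \<Rightarrow> 'a"
  Brd :: "'o \<Rightarrow> 'o \<Rightarrow> 'a"

abbreviation ten_obj :: "('o, 'a, 'm) monoidal_cat_scheme \<Rightarrow> 'o \<Rightarrow> 'o \<Rightarrow> 'o" where
  "ten_obj M X Y \<equiv> ObF (Ten M) (X, Y)"

abbreviation ten_arr :: "('o, 'a, 'm) monoidal_cat_scheme \<Rightarrow> 'a \<Rightarrow> 'a \<Rightarrow> 'a" where
  "ten_arr M u v \<equiv> ArF (Ten M) (u, v)"

abbreviation underlying :: "('o, 'a, 'm) category_scheme \<Rightarrow> ('o, 'a) category" where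
  "underlying C \<equiv> category.truncate C"

locale symmetric_monoidal_category =
  category M + tensor: is_functor "Ten M"
  for M :: "('o, 'a) monoidal_cat" (structure) +
  assumes ten_src: "Src (Ten M) = product_category (underlying M) (underlying M)"
    and ten_tgt: "Tgt (Ten M) = underlying M"
    and unit_obj: "Unt M \<in> Obj M"
    and asc_hom: "\<lbrakk>X \<in> Obj M; Y \<in> Obj M; Z \<in> Obj M\<rbrakk> \<Longrightarrow>
      Asc M X Y Z \<in> Hom M (ten_obj M (ten_obj M X Y) Z) (ten_obj M X (ten_obj M Y Z))"
    and lun_hom: "X \<in> Obj M \<Longrightarrow> LUn M X \<in> Hom M (ten_obj M (Unt M) X) X"
    and run_hom: "X \<in> Obj M \<Longrightarrow> RUn M X \<in> Hom M (ten_obj M X (Unt M)) X"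
    and brd_hom: "\<lbrakk>X \<in> Obj M; Y \<in> Obj M\<rbrakk> \<Longrightarrow> Brd M X Y \<in> Hom M (ten_obj M X Y) (ten_obj M Y X)"
    and asc_iso: "\<lbrakk>X \<in> Obj M; Y \<in> Obj M; Z \<in> Obj M\<rbrakk> \<Longrightarrow> isomorphism M (Asc M X Y Z)"
    and lun_iso: "X \<in> Obj M \<Longrightarrow> isomorphism M (LUn M X)"
    and run_iso: "X \<in> Obj M \<Longrightarrow> isomorphism M (RUn M X)"
    and asc_nat: "\<lbrakk>u \<in> Hom M X X'; v \<in> Hom M Y Y'; w \<in> Hom M Z Z'\<rbrakk> \<Longrightarrow>
      Asc M X' Y' Z' \<cdot> ten_arr M (ten_arr M u v) w = ten_arr M u (ten_arr M v w) \<cdot> Asc M X Y Z"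
    and lun_nat: "u \<in> Hom M X X' \<Longrightarrow> LUn M X' \<cdot> ten_arr M (Idn M (Unt M)) u = u \<cdot> LUn M X"
    and run_nat: "u \<in> Hom M X X' \<Longrightarrow> RUn M X' \<cdot> ten_arr M u (Idn M (Unt M)) = u \<cdot> RUn M X"
    and brd_nat: "\<lbrakk>u \<in> Hom M X X'; v \<in> Hom M Y Y'\<rbrakk> \<Longrightarrow>
      Brd M X' Y' \<cdot> ten_arr M u v = ten_arr M v u \<cdot> Brd M X Y"
    and pentagon: "\<lbrakk>W \<in> Obj M; X \<in> Obj M; Y \<in> Obj M; Z \<in> Obj M\<rbrakk> \<Longrightarrow>
      Asc M W X (ten_obj M Y Z) \<cdot> Asc M (ten_obj M W X) Y Z
        = ten_arr M (Idn M W) (Asc M X Y Z) \<cdot> Asc M W (ten_obj M X Y) Z \<cdot> ten_arr M (Asc M W X Y) (Idn M Z)"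
    and triangle: "\<lbrakk>X \<in> Obj M; Y \<in> Obj M\<rbrakk> \<Longrightarrow>
      ten_arr M (Idn M X) (LUn M Y) \<cdot> Asc M X (Unt M) Y = ten_arr M (RUn M X) (Idn M Y)"
    and hexagon: "\<lbrakk>X \<in> Obj M; Y \<in> Obj M; Z \<in> Obj M\<rbrakk> \<Longrightarrow>
      Asc M Y Z X \<cdot> Brd M X (ten_obj M Y Z) \<cdot> Asc M X Y Z
        = ten_arr M (Idn M Y) (Brd M X Z) \<cdot> Asc M Y X Z \<cdot> ten_arr M (Brd M X Y) (Idn M Z)"
    and symmetry: "\<lbrakk>X \<in> Obj M; Y \<in> Obj M\<rbrakk> \<Longrightarrow> Brd M Y X \<cdot> Brd M X Y = Idn M (ten_obj M X Y)"

definition weakly_invertible :: "('o, 'a) monoidal_cat \<Rightarrow> 'o \<Rightarrow> bool" where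
  "weakly_invertible M X \<longleftrightarrow> (\<exists>Y \<in> Obj M.
     isomorphic M (ten_obj M X Y) (Unt M) \<and> isomorphic M (ten_obj M Y X) (Unt M))"

definition symmetric_2_group :: "('o, 'a) monoidal_cat \<Rightarrow> bool" where
  "symmetric_2_group M \<longleftrightarrow>
     symmetric_monoidal_category M \<and> groupoid M \<and> (\<forall>X \<in> Obj M. weakly_invertible M X)"

record ('o, 'a) monoidal_fun =
  MSrc :: "('o, 'a) monoidal_cat"
  MTgt :: "('o, 'a) monoidal_cat"
  MFun :: "('o, 'a, 'o, 'a) cat_functor"
  Mul :: "'o \<times> 'o \<Rightarrow> 'a"
  Uni :: "'a"

locale symmetric_monoidal_functor =
  M: symmetric_monoidal_category "MSrc \<Phi>" + N: symmetric_monoidal_category "MTgt \<Phi>" +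
  F: is_functor "MFun \<Phi>"
  for \<Phi> :: "('o, 'a) monoidal_fun" +
  assumes fun_src: "Src (MFun \<Phi>) = underlying (MSrc \<Phi>)"
    and fun_tgt: "Tgt (MFun \<Phi>) = underlying (MTgt \<Phi>)"
    and mul_hom: "\<lbrakk>X \<in> Obj (MSrc \<Phi>); Y \<in> Obj (MSrc \<Phi>)\<rbrakk> \<Longrightarrow>
      Mul \<Phi> (X, Y) \<in> Hom (MTgt \<Phi>) (ten_obj (MTgt \<Phi>) (ObF (MFun \<Phi>) X) (ObF (MFun \<Phi>) Y))
                                   (ObF (MFun \<Phi>) (ten_obj (MSrc \<Phi>) X Y))"
    and mul_iso: "\<lbrakk>X \<in> Obj (MSrc \<Phi>); Y \<in> Obj (MSrc \<Phi>)\<rbrakk> \<Longrightarrow> isomorphism (MTgt \<Phi>) (Mul \<Phi> (X, Y))"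
    and uni_hom: "Uni \<Phi> \<in> Hom (MTgt \<Phi>) (Unt (MTgt \<Phi>)) (ObF (MFun \<Phi>) (Unt (MSrc \<Phi>)))"
    and uni_iso: "isomorphism (MTgt \<Phi>) (Uni \<Phi>)"
    and mul_nat: "\<lbrakk>u \<in> Hom (MSrc \<Phi>) X X'; v \<in> Hom (MSrc \<Phi>) Y Y'\<rbrakk> \<Longrightarrow>
      Mul \<Phi> (X', Y') \<cdot>\<^bsub>MTgt \<Phi>\<^esub> ten_arr (MTgt \<Phi>) (ArF (MFun \<Phi>) u) (ArF (MFun \<Phi>) v)
        = ArF (MFun \<Phi>) (ten_arr (MSrc \<Phi>) u v) \<cdot>\<^bsub>MTgt \<Phi>\<^esub> Mul \<Phi> (X, Y)"
    and mul_assoc: "\<lbrakk>X \<in> Obj (MSrc \<Phi>); Y \<in> Obj (MSrc \<Phi>); Z \<in> Obj (MSrc \<Phi>)\<rbrakk> \<Longrightarrow>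
      ArF (MFun \<Phi>) (Asc (MSrc \<Phi>) X Y Z) \<cdot>\<^bsub>MTgt \<Phi>\<^esub> Mul \<Phi> (ten_obj (MSrc \<Phi>) X Y, Z)
          \<cdot>\<^bsub>MTgt \<Phi>\<^esub> ten_arr (MTgt \<Phi>) (Mul \<Phi> (X, Y)) (Idn (MTgt \<Phi>) (ObF (MFun \<Phi>) Z))
        = Mul \<Phi> (X, ten_obj (MSrc \<Phi>) Y Z)
          \<cdot>\<^bsub>MTgt \<Phi>\<^esub> ten_arr (MTgt \<Phi>) (Idn (MTgt \<Phi>) (ObF (MFun \<Phi>) X)) (Mul \<Phi> (Y, Z))
          \<cdot>\<^bsub>MTgt \<Phi>\<^esub> Asc (MTgt \<Phi>) (ObF (MFun \<Phi>) X) (ObF (MFun \<Phi>) Y) (ObF (MFun \<Phi>) Z)"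
    and mul_lunit: "X \<in> Obj (MSrc \<Phi>) \<Longrightarrow>
      ArF (MFun \<Phi>) (LUn (MSrc \<Phi>) X) \<cdot>\<^bsub>MTgt \<Phi>\<^esub> Mul \<Phi> (Unt (MSrc \<Phi>), X)
          \<cdot>\<^bsub>MTgt \<Phi>\<^esub> ten_arr (MTgt \<Phi>) (Uni \<Phi>) (Idn (MTgt \<Phi>) (ObF (MFun \<Phi>) X))
        = LUn (MTgt \<Phi>) (ObF (MFun \<Phi>) X)"
    and mul_runit: "X \<in> Obj (MSrc \<Phi>) \<Longrightarrow>
      ArF (MFun \<Phi>) (RUn (MSrc \<Phi>) X) \<cdot>\<^bsub>MTgt \<Phi>\<^esub> Mul \<Phi> (X, Unt (MSrc \<Phi>))
          \<cdot>\<^bsub>MTgt \<Phi>\<^esub> ten_arr (MTgt \<Phi>) (Idn (MTgt \<Phi>) (ObF (MFun \<Phi>) X)) (Uni \<Phi>)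
        = RUn (MTgt \<Phi>) (ObF (MFun \<Phi>) X)"
    and mul_braid: "\<lbrakk>X \<in> Obj (MSrc \<Phi>); Y \<in> Obj (MSrc \<Phi>)\<rbrakk> \<Longrightarrow>
      ArF (MFun \<Phi>) (Brd (MSrc \<Phi>) X Y) \<cdot>\<^bsub>MTgt \<Phi>\<^esub> Mul \<Phi> (X, Y)
        = Mul \<Phi> (Y, X) \<cdot>\<^bsub>MTgt \<Phi>\<^esub> Brd (MTgt \<Phi>) (ObF (MFun \<Phi>) X) (ObF (MFun \<Phi>) Y)"

definition monoidal_fun_ext :: "('o, 'a) monoidal_fun \<Rightarrow> bool" where
  "monoidal_fun_ext \<Phi> \<longleftrightarrow> functor_ext (MFun \<Phi>) \<and> Mul \<Phi> \<in> extensional (Obj (MSrc \<Phi>) \<times> Obj (MSrc \<Phi>))"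

definition id_monoidal_fun :: "('o, 'a) monoidal_cat \<Rightarrow> ('o, 'a) monoidal_fun" where
  "id_monoidal_fun M = \<lparr>MSrc = M, MTgt = M, MFun = id_functor (underlying M),
     Mul = (\<lambda>(X, Y) \<in> Obj M \<times> Obj M. Idn M (ten_obj M X Y)), Uni = Idn M (Unt M)\<rparr>"

definition comp_monoidal_fun ::
  "('o, 'a) monoidal_fun \<Rightarrow> ('o, 'a) monoidal_fun \<Rightarrow> ('o, 'a) monoidal_fun" where
  "comp_monoidal_fun \<Psi> \<Phi> = \<lparr>MSrc = MSrc \<Phi>, MTgt = MTgt \<Psi>, MFun = comp_functor (MFun \<Psi>) (MFun \<Phi>),
     Mul = (\<lambda>(X, Y) \<in> Obj (MSrc \<Phi>) \<times> Obj (MSrc \<Phi>).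
       ArF (MFun \<Psi>) (Mul \<Phi> (X, Y)) \<cdot>\<^bsub>MTgt \<Psi>\<^esub> Mul \<Psi> (ObF (MFun \<Phi>) X, ObF (MFun \<Phi>) Y)),
     Uni = ArF (MFun \<Psi>) (Uni \<Phi>) \<cdot>\<^bsub>MTgt \<Psi>\<^esub> Uni \<Psi>\<rparr>"

record ('o, 'a) monoidal_trans =
  TSrc :: "('o, 'a) monoidal_fun"
  TTgt :: "('o, 'a) monoidal_fun"
  TNat :: "('o, 'a, 'o, 'a) nat_trans"

locale is_monoidal_trans =
  \<Phi>: symmetric_monoidal_functor "TSrc \<theta>" + \<Psi>: symmetric_monoidal_functor "TTgt \<theta>" +
  nat: is_nat_trans "TNat \<theta>"
  for \<theta> :: "('o, 'a) monoidal_trans" +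
  assumes same_msrc: "MSrc (TTgt \<theta>) = MSrc (TSrc \<theta>)"
    and same_mtgt: "MTgt (TTgt \<theta>) = MTgt (TSrc \<theta>)"
    and nat_src: "NSrc (TNat \<theta>) = MFun (TSrc \<theta>)"
    and nat_tgt: "NTgt (TNat \<theta>) = MFun (TTgt \<theta>)"
    and mul_compat: "\<lbrakk>X \<in> Obj (MSrc (TSrc \<theta>)); Y \<in> Obj (MSrc (TSrc \<theta>))\<rbrakk> \<Longrightarrow>
      NCmp (TNat \<theta>) (ten_obj (MSrc (TSrc \<theta>)) X Y) \<cdot>\<^bsub>MTgt (TSrc \<theta>)\<^esub> Mul (TSrc \<theta>) (X, Y)
        = Mul (TTgt \<theta>) (X, Y)
          \<cdot>\<^bsub>MTgt (TSrc \<theta>)\<^esub> ten_arr (MTgt (TSrc \<theta>)) (NCmp (TNat \<theta>) X) (NCmp (TNat \<theta>) Y)"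
    and uni_compat:
      "NCmp (TNat \<theta>) (Unt (MSrc (TSrc \<theta>))) \<cdot>\<^bsub>MTgt (TSrc \<theta>)\<^esub> Uni (TSrc \<theta>) = Uni (TTgt \<theta>)"

definition Sym2Gp ::
  "(('o, 'a) monoidal_cat, ('o, 'a) monoidal_fun, ('o, 'a) monoidal_trans) two_cat" where
  "Sym2Gp = \<lparr>Cell0 = {M. symmetric_2_group M},
     Cell1 = (\<lambda>M N. {\<Phi>. symmetric_monoidal_functor \<Phi> \<and> monoidal_fun_ext \<Phi> \<and> MSrc \<Phi> = M \<and> MTgt \<Phi> = N}),
     Cell2 = (\<lambda>\<Phi> \<Psi>. {\<theta>. is_monoidal_trans \<theta> \<and> NCmp (TNat \<theta>) \<in> extensional (Obj (MSrc \<Phi>))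
                \<and> TSrc \<theta> = \<Phi> \<and> TTgt \<theta> = \<Psi>}),
     Id1 = id_monoidal_fun, Comp1 = comp_monoidal_fun,
     Id2 = (\<lambda>\<Phi>. \<lparr>TSrc = \<Phi>, TTgt = \<Phi>, TNat = id_trans (MFun \<Phi>)\<rparr>),
     VComp = (\<lambda>\<theta> \<eta>. \<lparr>TSrc = TSrc \<eta>, TTgt = TTgt \<theta>, TNat = vcomp_trans (TNat \<theta>) (TNat \<eta>)\<rparr>),
     HComp = (\<lambda>\<theta> \<eta>. \<lparr>TSrc = comp_monoidal_fun (TSrc \<theta>) (TSrc \<eta>),
                TTgt = comp_monoidal_fun (TTgt \<theta>) (TTgt \<eta>), TNat = hcomp_trans (TNat \<theta>) (TNat \<eta>)\<rparr>)\<rparr>"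

definition forget_Sym2Gp :: "(('o, 'a) monoidal_cat, ('o, 'a) monoidal_fun, ('o, 'a) monoidal_trans,
    ('o, 'a) category, ('o, 'a, 'o, 'a) cat_functor, ('o, 'a, 'o, 'a) nat_trans) two_fun" where
  "forget_Sym2Gp = \<lparr>Map0 = category.truncate, Map1 = MFun, Map2 = TNat\<rparr>"


section \<open>Finite products, abelian group objects, additive categories\<close>

record ('o, 'a) cart_cat = "('o, 'a) category" +
  One :: "'o"
  Times :: "'o \<Rightarrow> 'o \<Rightarrow> 'o"
  Fst :: "'o \<Rightarrow> 'o \<Rightarrow> 'a"
  Snd :: "'o \<Rightarrow> 'o \<Rightarrow> 'a"

locale cartesian_category =
  category C for C :: "('o, 'a, 'm) cart_cat_scheme" (structure) +
  assumes one_obj: "One C \<in> Obj C"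
    and one_terminal: "A \<in> Obj C \<Longrightarrow> \<exists>!h. h \<in> Hom C A (One C)"
    and times_obj: "A \<in> Obj C \<Longrightarrow> A' \<in> Obj C \<Longrightarrow> Times C A A' \<in> Obj C"
    and fst_hom: "A \<in> Obj C \<Longrightarrow> A' \<in> Obj C \<Longrightarrow> Fst C A A' \<in> Hom C (Times C A A') A"
    and snd_hom: "A \<in> Obj C \<Longrightarrow> A' \<in> Obj C \<Longrightarrow> Snd C A A' \<in> Hom C (Times C A A') A'"
    and times_universal: "f \<in> Hom C D A \<Longrightarrow> f' \<in> Hom C D A' \<Longrightarrow>
      \<exists>!h. h \<in> Hom C D (Times C A A') \<and> Fst C A A' \<cdot> h = f \<and> Snd C A A' \<cdot> h = f'"

definition bang :: "('o, 'a, 'm) cart_cat_scheme \<Rightarrow> 'o \<Rightarrow> 'a" where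
  "bang C A = (THE h. h \<in> Hom C A (One C))"

definition tuple :: "('o, 'a, 'm) cart_cat_scheme \<Rightarrow> 'a \<Rightarrow> 'a \<Rightarrow> 'a" where
  "tuple C f g = (THE h. h \<in> Hom C (Dom C f) (Times C (Cod C f) (Cod C g))
     \<and> Fst C (Cod C f) (Cod C g) \<cdot>\<^bsub>C\<^esub> h = f \<and> Snd C (Cod C f) (Cod C g) \<cdot>\<^bsub>C\<^esub> h = g)"

definition cross :: "('o, 'a, 'm) cart_cat_scheme \<Rightarrow> 'a \<Rightarrow> 'a \<Rightarrow> 'a" where
  "cross C f g = tuple C (f \<cdot>\<^bsub>C\<^esub> Fst C (Dom C f) (Dom C g)) (g \<cdot>\<^bsub>C\<^esub> Snd C (Dom C f) (Dom C g))"

definition prod_assoc :: "('o, 'a, 'm) cart_cat_scheme \<Rightarrow> 'o \<Rightarrow> 'o \<Rightarrow> 'o \<Rightarrow> 'a" where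
  "prod_assoc C A B D = tuple C (Fst C A B \<cdot>\<^bsub>C\<^esub> Fst C (Times C A B) D)
     (tuple C (Snd C A B \<cdot>\<^bsub>C\<^esub> Fst C (Times C A B) D) (Snd C (Times C A B) D))"

definition prod_swap :: "('o, 'a, 'm) cart_cat_scheme \<Rightarrow> 'o \<Rightarrow> 'o \<Rightarrow> 'a" where
  "prod_swap C A B = tuple C (Snd C A B) (Fst C A B)"

definition abelian_group_object ::
  "('o, 'a, 'm) cart_cat_scheme \<Rightarrow> 'o \<Rightarrow> 'a \<Rightarrow> 'a \<Rightarrow> 'a \<Rightarrow> bool" where
  "abelian_group_object C A m e i \<longleftrightarrow>
     m \<in> Hom C (Times C A A) A \<and> e \<in> Hom C (One C) A \<and> i \<in> Hom C A A \<and>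
     m \<cdot>\<^bsub>C\<^esub> cross C m (Idn C A) = m \<cdot>\<^bsub>C\<^esub> cross C (Idn C A) m \<cdot>\<^bsub>C\<^esub> prod_assoc C A A A \<and>
     m \<cdot>\<^bsub>C\<^esub> cross C e (Idn C A) = Snd C (One C) A \<and>
     m \<cdot>\<^bsub>C\<^esub> cross C (Idn C A) e = Fst C A (One C) \<and>
     m \<cdot>\<^bsub>C\<^esub> tuple C i (Idn C A) = e \<cdot>\<^bsub>C\<^esub> bang C A \<and>
     m \<cdot>\<^bsub>C\<^esub> tuple C (Idn C A) i = e \<cdot>\<^bsub>C\<^esub> bang C A \<and>
     m \<cdot>\<^bsub>C\<^esub> prod_swap C A A = m"

text \<open>In an additive category every object carries exactly one abelian group structure, so there the
  following descriptions are proper.\<close>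

definition group_mult :: "('o, 'a, 'm) cart_cat_scheme \<Rightarrow> 'o \<Rightarrow> 'a" where
  "group_mult C A = (THE m. \<exists>e i. abelian_group_object C A m e i)"

definition group_unit :: "('o, 'a, 'm) cart_cat_scheme \<Rightarrow> 'o \<Rightarrow> 'a" where
  "group_unit C A = (THE e. \<exists>m i. abelian_group_object C A m e i)"

locale preadditive_category =
  category C for C (structure) +
  fixes add :: "'a \<Rightarrow> 'a \<Rightarrow> 'a" and zero :: "'o \<Rightarrow> 'o \<Rightarrow> 'a"
  assumes hom_group: "A \<in> Obj C \<Longrightarrow> A' \<in> Obj C \<Longrightarrow>
      comm_group \<lparr>carrier = Hom C A A', monoid.mult = add, one = zero A A'\<rparr>"
    and comp_add_left: "\<lbrakk>f \<in> Hom C A A'; g \<in> Hom C A' A''; g' \<in> Hom C A' A''\<rbrakk>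
      \<Longrightarrow> add g g' \<cdot> f = add (g \<cdot> f) (g' \<cdot> f)"
    and comp_add_right: "\<lbrakk>f \<in> Hom C A A'; f' \<in> Hom C A A'; g \<in> Hom C A' A''\<rbrakk>
      \<Longrightarrow> g \<cdot> add f f' = add (g \<cdot> f) (g \<cdot> f')"

definition zero_object :: "('o, 'a, 'm) category_scheme \<Rightarrow> 'o \<Rightarrow> bool" where
  "zero_object C Z \<longleftrightarrow> Z \<in> Obj C \<and>
     (\<forall>A \<in> Obj C. (\<exists>!h. h \<in> Hom C A Z) \<and> (\<exists>!h. h \<in> Hom C Z A))"

definition has_biproduct :: "('o, 'a, 'm) category_scheme \<Rightarrow> ('a \<Rightarrow> 'a \<Rightarrow> 'a) \<Rightarrow> ('o \<Rightarrow> 'o \<Rightarrow> 'a)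
    \<Rightarrow> 'o \<Rightarrow> 'o \<Rightarrow> bool" where
  "has_biproduct C add zero A A' \<longleftrightarrow>
     (\<exists>S \<in> Obj C. \<exists>p \<in> Hom C S A. \<exists>p' \<in> Hom C S A'. \<exists>j \<in> Hom C A S. \<exists>j' \<in> Hom C A' S.
        p \<cdot>\<^bsub>C\<^esub> j = Idn C A \<and> p' \<cdot>\<^bsub>C\<^esub> j' = Idn C A' \<and>
        p' \<cdot>\<^bsub>C\<^esub> j = zero A A' \<and> p \<cdot>\<^bsub>C\<^esub> j' = zero A' A \<and>
        add (j \<cdot>\<^bsub>C\<^esub> p) (j' \<cdot>\<^bsub>C\<^esub> p') = Idn C S)"

definition additive_category :: "('o, 'a, 'm) category_scheme \<Rightarrow> bool" where
  "additive_category C \<longleftrightarrow> (\<exists>add zero. preadditive_category C add zero \<and>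
     (\<exists>Z. zero_object C Z) \<and> (\<forall>A \<in> Obj C. \<forall>A' \<in> Obj C. has_biproduct C add zero A A'))"


section \<open>Cartesian monoidal opfibrations\<close>

text \<open>\<open>Cleav Q f X : X \<rightarrow> f\<^sub>* X\<close> is the chosen cocartesian lifting of \<open>f : A \<rightarrow> B\<close> at \<open>X\<close> over \<open>A\<close>.\<close>

record ('x, 'g, 'b, 'f) opfib =
  Total :: "('x, 'g) cart_cat"
  Base :: "('b, 'f) cart_cat"
  Proj :: "('x, 'g, 'b, 'f) cat_functor"
  Cleav :: "'f \<Rightarrow> 'x \<Rightarrow> 'g"

abbreviation pobj :: "('x, 'g, 'b, 'f) opfib \<Rightarrow> 'x \<Rightarrow> 'b" where
  "pobj Q X \<equiv> ObF (Proj Q) X"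

abbreviation parr :: "('x, 'g, 'b, 'f) opfib \<Rightarrow> 'g \<Rightarrow> 'f" where
  "parr Q u \<equiv> ArF (Proj Q) u"

definition cocartesian :: "('x, 'g, 'b, 'f) opfib \<Rightarrow> 'g \<Rightarrow> bool" where
  "cocartesian Q k \<longleftrightarrow> k \<in> Arr (Total Q) \<and>
     (\<forall>h \<in> Arr (Total Q). \<forall>w \<in> Hom (Base Q) (pobj Q (Cod (Total Q) k)) (pobj Q (Cod (Total Q) h)).
        Dom (Total Q) h = Dom (Total Q) k \<and> w \<cdot>\<^bsub>Base Q\<^esub> parr Q k = parr Q h \<longrightarrow>
        (\<exists>!u. u \<in> Hom (Total Q) (Cod (Total Q) k) (Cod (Total Q) h)
              \<and> parr Q u = w \<and> u \<cdot>\<^bsub>Total Q\<^esub> k = h))"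

locale cloven_opfibration =
  proj: is_functor "Proj Q" for Q :: "('x, 'g, 'b, 'f) opfib" +
  assumes proj_src: "Src (Proj Q) = underlying (Total Q)"
    and proj_tgt: "Tgt (Proj Q) = underlying (Base Q)"
    and cleav_dom: "\<lbrakk>f \<in> Arr (Base Q); X \<in> Obj (Total Q); pobj Q X = Dom (Base Q) f\<rbrakk>
      \<Longrightarrow> Cleav Q f X \<in> Arr (Total Q) \<and> Dom (Total Q) (Cleav Q f X) = X"
    and cleav_over: "\<lbrakk>f \<in> Arr (Base Q); X \<in> Obj (Total Q); pobj Q X = Dom (Base Q) f\<rbrakk>
      \<Longrightarrow> parr Q (Cleav Q f X) = f"
    and cleav_cocartesian: "\<lbrakk>f \<in> Arr (Base Q); X \<in> Obj (Total Q); pobj Q X = Dom (Base Q) f\<rbrakk>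
      \<Longrightarrow> cocartesian Q (Cleav Q f X)"

locale cartesian_monoidal_opfibration =
  cloven_opfibration Q + total: cartesian_category "Total Q" + base: cartesian_category "Base Q"
  for Q :: "('x, 'g, 'b, 'f) opfib" +
  assumes pres_one: "pobj Q (One (Total Q)) = One (Base Q)"
    and pres_times: "\<lbrakk>X \<in> Obj (Total Q); Y \<in> Obj (Total Q)\<rbrakk> \<Longrightarrow>
      pobj Q (Times (Total Q) X Y) = Times (Base Q) (pobj Q X) (pobj Q Y)"
    and pres_fst: "\<lbrakk>X \<in> Obj (Total Q); Y \<in> Obj (Total Q)\<rbrakk> \<Longrightarrow>
      parr Q (Fst (Total Q) X Y) = Fst (Base Q) (pobj Q X) (pobj Q Y)"
    and pres_snd: "\<lbrakk>X \<in> Obj (Total Q); Y \<in> Obj (Total Q)\<rbrakk> \<Longrightarrow>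
      parr Q (Snd (Total Q) X Y) = Snd (Base Q) (pobj Q X) (pobj Q Y)"
    and cross_cocartesian: "\<lbrakk>cocartesian Q k; cocartesian Q l\<rbrakk> \<Longrightarrow> cocartesian Q (cross (Total Q) k l)"

definition fibre :: "('x, 'g, 'b, 'f) opfib \<Rightarrow> 'b \<Rightarrow> ('x, 'g) category" where
  "fibre Q A = \<lparr>Obj = {X \<in> Obj (Total Q). pobj Q X = A},
     Arr = {u \<in> Arr (Total Q). pobj Q (Dom (Total Q) u) = A \<and> parr Q u = Idn (Base Q) A},
     Dom = Dom (Total Q), Cod = Cod (Total Q), Idn = Idn (Total Q), Cmp = Cmp (Total Q)\<rparr>"

text \<open>The vertical arrow \<open>u\<close> with \<open>u \<circ> k = h\<close>, for \<open>k\<close> cocartesian and \<open>h\<close> over the same base arrow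
  with the same domain.\<close>

definition vfactor :: "('x, 'g, 'b, 'f) opfib \<Rightarrow> 'g \<Rightarrow> 'g \<Rightarrow> 'g" where
  "vfactor Q k h = (THE u. u \<in> Hom (fibre Q (pobj Q (Cod (Total Q) k))) (Cod (Total Q) k) (Cod (Total Q) h)
     \<and> u \<cdot>\<^bsub>Total Q\<^esub> k = h)"

definition push :: "('x, 'g, 'b, 'f) opfib \<Rightarrow> 'f \<Rightarrow> ('x, 'g, 'x, 'g) cat_functor" where
  "push Q f = \<lparr>Src = fibre Q (Dom (Base Q) f), Tgt = fibre Q (Cod (Base Q) f),
     ObF = (\<lambda>X \<in> Obj (fibre Q (Dom (Base Q) f)). Cod (Total Q) (Cleav Q f X)),
     ArF = (\<lambda>u \<in> Arr (fibre Q (Dom (Base Q) f)).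
       vfactor Q (Cleav Q f (Dom (Total Q) u)) (Cleav Q f (Cod (Total Q) u) \<cdot>\<^bsub>Total Q\<^esub> u))\<rparr>"

definition associated_pseudofunctor :: "('x, 'g, 'b, 'f) opfib \<Rightarrow>
    ('b, 'f, ('x, 'g) category, ('x, 'g, 'x, 'g) cat_functor, ('x, 'g, 'x, 'g) nat_trans) pseudo" where
  "associated_pseudofunctor Q = \<lparr>PObj = fibre Q, PArr = push Q,
     PComp = (\<lambda>g f. \<lparr>NSrc = comp_functor (push Q g) (push Q f), NTgt = push Q (g \<cdot>\<^bsub>Base Q\<^esub> f),
       NCmp = (\<lambda>X \<in> Obj (fibre Q (Dom (Base Q) f)).
         vfactor Q (Cleav Q g (ObF (push Q f) X) \<cdot>\<^bsub>Total Q\<^esub> Cleav Q f X) (Cleav Q (g \<cdot>\<^bsub>Base Q\<^esub> f) X))\<rparr>),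
     PUnit = (\<lambda>A. \<lparr>NSrc = id_functor (fibre Q A), NTgt = push Q (Idn (Base Q) A),
       NCmp = (\<lambda>X \<in> Obj (fibre Q A). Cleav Q (Idn (Base Q) A) X)\<rparr>)\<rparr>"

definition lax_mult :: "('x, 'g, 'b, 'f) opfib \<Rightarrow> 'b \<Rightarrow> 'b \<Rightarrow> ('x \<times> 'x, 'g \<times> 'g, 'x, 'g) cat_functor" where
  "lax_mult Q A A' = \<lparr>Src = product_category (fibre Q A) (fibre Q A'), Tgt = fibre Q (Times (Base Q) A A'),
     ObF = (\<lambda>(X, Y) \<in> Obj (fibre Q A) \<times> Obj (fibre Q A'). Times (Total Q) X Y),
     ArF = (\<lambda>(u, v) \<in> Arr (fibre Q A) \<times> Arr (fibre Q A'). cross (Total Q) u v)\<rparr>"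

definition lax_unit :: "('x, 'g, 'b, 'f) opfib \<Rightarrow> (unit, unit, 'x, 'g) cat_functor" where
  "lax_unit Q = \<lparr>Src = terminal_category, Tgt = fibre Q (One (Base Q)),
     ObF = (\<lambda>_. One (Total Q)), ArF = (\<lambda>_. Idn (Total Q) (One (Total Q)))\<rparr>"

definition fibre_tensor :: "('x, 'g, 'b, 'f) opfib \<Rightarrow> 'b \<Rightarrow> ('x \<times> 'x, 'g \<times> 'g, 'x, 'g) cat_functor" where
  "fibre_tensor Q A = comp_functor (push Q (group_mult (Base Q) A)) (lax_mult Q A A)"

definition fibre_unit :: "('x, 'g, 'b, 'f) opfib \<Rightarrow> 'b \<Rightarrow> 'x" where
  "fibre_unit Q A = ObF (comp_functor (push Q (group_unit (Base Q) A)) (lax_unit Q)) ()"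

text \<open>The cocartesian arrows \<open>X \<times> Y \<rightarrow> X \<otimes> Y\<close> and \<open>I \<rightarrow> E\<close> (\<open>E\<close> the unit of the fibre) exhibiting
  the tensor product and the unit of the fibre over \<open>A\<close>.\<close>

definition ten_arrow :: "('x, 'g, 'b, 'f) opfib \<Rightarrow> 'b \<Rightarrow> 'x \<Rightarrow> 'x \<Rightarrow> 'g" where
  "ten_arrow Q A X Y = Cleav Q (group_mult (Base Q) A) (Times (Total Q) X Y)"

definition unit_arrow :: "('x, 'g, 'b, 'f) opfib \<Rightarrow> 'b \<Rightarrow> 'g" where
  "unit_arrow Q A = Cleav Q (group_unit (Base Q) A) (One (Total Q))"

text \<open>The symmetric monoidal structure that the lax symmetric monoidal pseudofunctor induces on the
  fibre over the commutative monoid \<open>A\<close>.  The constraint cells of the pseudofunctor are all induced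
  from the associativity, unit and symmetry isomorphisms of the products in the total category by the
  universal property of cocartesian arrows.  Hence so are the resulting constraints on the fibre: for
  example the associator is the vertical arrow under which
  \<open>(X \<times> Y) \<times> Z \<rightarrow> (X \<otimes> Y) \<times> Z \<rightarrow> (X \<otimes> Y) \<otimes> Z\<close> corresponds to
  \<open>(X \<times> Y) \<times> Z \<cong> X \<times> (Y \<times> Z) \<rightarrow> X \<times> (Y \<otimes> Z) \<rightarrow> X \<otimes> (Y \<otimes> Z)\<close>.\<close>

definition fibre_monoidal :: "('x, 'g, 'b, 'f) opfib \<Rightarrow> 'b \<Rightarrow> ('x, 'g) monoidal_cat" where
  "fibre_monoidal Q A = (let T = Total Q; ten = (\<lambda>X Y. ObF (fibre_tensor Q A) (X, Y));
       t = ten_arrow Q A; E = fibre_unit Q A; \<epsilon> = unit_arrow Q A in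
     category.extend (fibre Q A) \<lparr>Ten = fibre_tensor Q A, Unt = E,
       Asc = (\<lambda>X Y Z. vfactor Q (t (ten X Y) Z \<cdot>\<^bsub>T\<^esub> cross T (t X Y) (Idn T Z))
                (t X (ten Y Z) \<cdot>\<^bsub>T\<^esub> cross T (Idn T X) (t Y Z) \<cdot>\<^bsub>T\<^esub> prod_assoc T X Y Z)),
       LUn = (\<lambda>X. vfactor Q (t E X \<cdot>\<^bsub>T\<^esub> cross T \<epsilon> (Idn T X)) (Snd T (One T) X)),
       RUn = (\<lambda>X. vfactor Q (t X E \<cdot>\<^bsub>T\<^esub> cross T (Idn T X) \<epsilon>) (Fst T X (One T))),
       Brd = (\<lambda>X Y. vfactor Q (t X Y) (t Y X \<cdot>\<^bsub>T\<^esub> prod_swap T X Y))\<rparr>)"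

definition factors_through_Sym2Gp :: "('x, 'g, 'b, 'f) opfib \<Rightarrow> bool" where
  "factors_through_Sym2Gp Q \<longleftrightarrow>
     (\<exists>G. pseudofunctor (Base Q) Sym2Gp G \<and>
          (\<forall>A \<in> Obj (Base Q). PObj G A = fibre_monoidal Q A) \<and>
          same_pseudofunctor (Base Q) (comp_pseudo forget_Sym2Gp G) (associated_pseudofunctor Q))"

end

theory Submission
  imports Defs
begin

text \<open>Addition is the only unital multiplication on an object of \<open>B\<close>, so \<open>m \<circ> \<langle>x, y\<rangle> = x + y\<close> and every
  arrow of \<open>B\<close> is a homomorphism.  For generalised elements \<open>x : D \<rightarrow> X\<close> and \<open>y : D \<rightarrow> Y\<close> over an object
  of \<open>B\<close> write \<open>x * y\<close> for the composite \<open>D \<rightarrow> X \<times> Y \<rightarrow> X \<otimes> Y\<close>; it lies over the sum of the projections of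
  \<open>x\<close> and \<open>y\<close>.  The associator is characterised by \<open>(x * y) * z \<mapsto> x * (y * z)\<close>, the monoidal constraint
  of \<open>f\<^sub>*\<close> by \<open>c x * c y \<mapsto> c (x * y)\<close> for the cocartesian liftings \<open>c\<close> of \<open>f\<close>, and likewise for the
  other constraints.  Each coherence law is then checked on one cocartesian generalised element, where
  both sides agree by inspection.  So every fibre is symmetric monoidal, and the lifting of \<open>F\<close> exists
  as soon as the fibres are 2-groups.

  If the fibres are groupoids, all objects over the terminal object are terminal, hence \<open>X \<rightarrow> 1\<close> is
  cocartesian for every \<open>X\<close>, and so is \<open>X \<rightarrow> 1 \<rightarrow> E\<close> over the zero arrow, with \<open>E\<close> the unit.  For the
  inversion \<open>i\<close> of \<open>A\<close> and the lifting \<open>c : X \<rightarrow> i\<^sub>* X\<close>, the element \<open>1 * c\<close> of \<open>X \<otimes> i\<^sub>* X\<close> lies over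
  \<open>1 + i = 0\<close> as well, which yields a vertical arrow \<open>E \<rightarrow> X \<otimes> i\<^sub>* X\<close>.  It is invertible since the
  fibre is a groupoid.\<close>

section \<open>Categories and functors\<close>

lemma Hom_iff: "f \<in> Hom C A B \<longleftrightarrow> f \<in> Arr C \<and> Dom C f = A \<and> Cod C f = B"
  by (simp add: Hom_def)

text \<open>Functors between monoidal categories have plain categories as source and target, so
  facts must pass between a monoidal record and its truncation.\<close>

lemma truncate_simps [simp]:
  "Obj (category.truncate M) = Obj M" "Arr (category.truncate M) = Arr M"
  "Dom (category.truncate M) = Dom M" "Cod (category.truncate M) = Cod M"
  "Idn (category.truncate M) = Idn M" "Cmp (category.truncate M) = Cmp M"
  by (simp_all add: category.defs)

lemma Hom_truncate [simp]: "Hom (category.truncate M) = Hom M"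
  by (simp add: Hom_def fun_eq_iff)

lemma category_truncate_iff [simp]: "category (category.truncate M) \<longleftrightarrow> category M"
  by (simp add: category_def)

lemma isomorphism_truncate [simp]: "isomorphism (category.truncate M) = isomorphism M"
  by (simp add: isomorphism_def inverse_arrows_def fun_eq_iff)

lemma groupoid_truncate_iff [simp]: "groupoid (category.truncate M) \<longleftrightarrow> groupoid M"
  by (simp add: groupoid_def)

lemma isomorphismI:
  "\<lbrakk>f \<in> Arr C; g \<in> Arr C; Dom C g = Cod C f; Cod C g = Dom C f;
    g \<cdot>\<^bsub>C\<^esub> f = Idn C (Dom C f); f \<cdot>\<^bsub>C\<^esub> g = Idn C (Cod C f)\<rbrakk> \<Longrightarrow> isomorphism C f"
  by (auto simp: isomorphism_def inverse_arrows_def Hom_iff)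

lemma isomorphismE:
  assumes "isomorphism C f"
  obtains g where "f \<in> Arr C" "g \<in> Arr C" "Dom C g = Cod C f" "Cod C g = Dom C f"
    "g \<cdot>\<^bsub>C\<^esub> f = Idn C (Dom C f)" "f \<cdot>\<^bsub>C\<^esub> g = Idn C (Cod C f)"
  using assms by (auto simp: isomorphism_def inverse_arrows_def Hom_iff)

text \<open>With \<open>Dom\<close> and \<open>Cod\<close> in place of membership in hom-sets no
  objects have to be guessed, and the simplifier can settle the typing conditions of
  composites.\<close>

lemma categoryI:
  assumes "\<And>f. f \<in> Arr C \<Longrightarrow> Dom C f \<in> Obj C" "\<And>f. f \<in> Arr C \<Longrightarrow> Cod C f \<in> Obj C"
    and "\<And>A. A \<in> Obj C \<Longrightarrow> Idn C A \<in> Arr C \<and> Dom C (Idn C A) = A \<and> Cod C (Idn C A) = A"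
    and "\<And>f g. \<lbrakk>f \<in> Arr C; g \<in> Arr C; Cod C f = Dom C g\<rbrakk> \<Longrightarrow>
      g \<cdot>\<^bsub>C\<^esub> f \<in> Arr C \<and> Dom C (g \<cdot>\<^bsub>C\<^esub> f) = Dom C f \<and> Cod C (g \<cdot>\<^bsub>C\<^esub> f) = Cod C g"
    and "\<And>f. f \<in> Arr C \<Longrightarrow> Idn C (Cod C f) \<cdot>\<^bsub>C\<^esub> f = f"
    and "\<And>f. f \<in> Arr C \<Longrightarrow> f \<cdot>\<^bsub>C\<^esub> Idn C (Dom C f) = f"
    and "\<And>f g h. \<lbrakk>f \<in> Arr C; g \<in> Arr C; h \<in> Arr C; Cod C f = Dom C g; Cod C g = Dom C h\<rbrakk> \<Longrightarrow>
      (h \<cdot>\<^bsub>C\<^esub> g) \<cdot>\<^bsub>C\<^esub> f = h \<cdot>\<^bsub>C\<^esub> (g \<cdot>\<^bsub>C\<^esub> f)"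
  shows "category C"
  using assms by unfold_locales (auto simp: Hom_iff)

context category
begin

lemma id_simps [simp]:
  assumes "A \<in> Obj C"
  shows "Idn C A \<in> Arr C" "Dom C (Idn C A) = A" "Cod C (Idn C A) = A"
  using id_closed[OF assms] by (simp_all add: Hom_iff)

lemma comp_simps [simp]:
  assumes "f \<in> Arr C" "g \<in> Arr C" "Cod C f = Dom C g"
  shows "g \<cdot> f \<in> Arr C" "Dom C (g \<cdot> f) = Dom C f" "Cod C (g \<cdot> f) = Cod C g"
  using comp_closed[of f "Dom C f" "Cod C f" g "Cod C g"] assms by (simp_all add: Hom_iff)

lemma comp_id_left [simp]: "\<lbrakk>f \<in> Arr C; Cod C f = A\<rbrakk> \<Longrightarrow> Idn C A \<cdot> f = f"
  using id_left[of f "Dom C f" A] by (simp add: Hom_iff)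

lemma comp_id_right [simp]: "\<lbrakk>f \<in> Arr C; Dom C f = A\<rbrakk> \<Longrightarrow> f \<cdot> Idn C A = f"
  using id_right[of f A "Cod C f"] by (simp add: Hom_iff)

lemma assoc [simp]:
  "\<lbrakk>f \<in> Arr C; g \<in> Arr C; h \<in> Arr C; Cod C f = Dom C g; Cod C g = Dom C h\<rbrakk> \<Longrightarrow>
    (h \<cdot> g) \<cdot> f = h \<cdot> (g \<cdot> f)"
  using comp_assoc[of f "Dom C f" "Cod C f" g "Cod C g" h "Cod C h"] by (simp add: Hom_iff)

lemma obj_simps [simp]: "f \<in> Arr C \<Longrightarrow> Dom C f \<in> Obj C" "f \<in> Arr C \<Longrightarrow> Cod C f \<in> Obj C"
  by (simp_all add: dom_closed cod_closed)

text \<open>Composites are normalised by \<open>assoc\<close> to right-nested form, where the left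
  side of \<open>g \<cdot> f = h\<close> is no longer visible once another arrow precedes
  \<open>f\<close>. In this form the equation still applies.\<close>

lemma comp_reassoc:
  "\<lbrakk>g \<cdot> f = h; f \<in> Arr C; g \<in> Arr C; k \<in> Arr C; Cod C f = Dom C g; Cod C k = Dom C f\<rbrakk> \<Longrightarrow>
    g \<cdot> (f \<cdot> k) = h \<cdot> k"
  by (metis assoc)

lemma inverse_cancel:
  assumes "g \<cdot> f = Idn C A" "f \<in> Arr C" "g \<in> Arr C" "Cod C f = Dom C g" "k \<in> Arr C" "Cod C k = A"
    and "Dom C f = A"
  shows "g \<cdot> (f \<cdot> k) = k"
  using comp_reassoc[OF assms(1,2,3,5,4)] assms by simp

lemma isomorphism_comp:
  assumes "isomorphism C f" "isomorphism C g" "Cod C f = Dom C g"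
  shows "isomorphism C (g \<cdot> f)"
proof -
  from assms(1) obtain f' where f: "f \<in> Arr C" "f' \<in> Arr C" "Dom C f' = Cod C f"
      "Cod C f' = Dom C f"
    "f' \<cdot> f = Idn C (Dom C f)" "f \<cdot> f' = Idn C (Cod C f)" by (rule isomorphismE)
  from assms(2) obtain g' where g: "g \<in> Arr C" "g' \<in> Arr C" "Dom C g' = Cod C g"
      "Cod C g' = Dom C g"
    "g' \<cdot> g = Idn C (Dom C g)" "g \<cdot> g' = Idn C (Cod C g)" by (rule isomorphismE)
  show ?thesis
    by (rule isomorphismI[where g = "f' \<cdot> g'"])
      (use f g assms(3) inverse_cancel[OF g(5)] inverse_cancel[OF f(6)] in simp_all)
qed

end

lemma is_functorI:
  assumes "category (Src F)" "category (Tgt F)"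
    and "\<And>A. A \<in> Obj (Src F) \<Longrightarrow> ObF F A \<in> Obj (Tgt F)"
    and "\<And>f. f \<in> Arr (Src F) \<Longrightarrow> ArF F f \<in> Arr (Tgt F) \<and>
      Dom (Tgt F) (ArF F f) = ObF F (Dom (Src F) f) \<and> Cod (Tgt F) (ArF F f) = ObF F (Cod (Src F) f)"
    and "\<And>A. A \<in> Obj (Src F) \<Longrightarrow> ArF F (Idn (Src F) A) = Idn (Tgt F) (ObF F A)"
    and "\<And>f g. \<lbrakk>f \<in> Arr (Src F); g \<in> Arr (Src F); Cod (Src F) f = Dom (Src F) g\<rbrakk> \<Longrightarrow>
      ArF F (g \<cdot>\<^bsub>Src F\<^esub> f) = ArF F g \<cdot>\<^bsub>Tgt F\<^esub> ArF F f"
  shows "is_functor F"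
proof -
  interpret s: category "Src F" by fact
  interpret t: category "Tgt F" by fact
  show ?thesis
    by unfold_locales (use assms in \<open>auto simp: Hom_iff\<close>)
qed

context is_functor
begin

lemma arr_simps:
  assumes "f \<in> Arr (Src F)"
  shows "ArF F f \<in> Arr (Tgt F)" "Dom (Tgt F) (ArF F f) = ObF F (Dom (Src F) f)"
    "Cod (Tgt F) (ArF F f) = ObF F (Cod (Src F) f)"
  using map_hom[of f "Dom (Src F) f" "Cod (Src F) f"] assms by (simp_all add: Hom_iff)

lemma comp_map:
  "\<lbrakk>f \<in> Arr (Src F); g \<in> Arr (Src F); Cod (Src F) f = Dom (Src F) g\<rbrakk> \<Longrightarrow>
    ArF F (g \<cdot>\<^bsub>Src F\<^esub> f) = ArF F g \<cdot>\<^bsub>Tgt F\<^esub> ArF F f"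
  using map_comp[of f "Dom (Src F) f" "Cod (Src F) f" g "Cod (Src F) g"] by (simp add: Hom_iff)

end

lemma is_functor_comp:
  assumes "is_functor F" "is_functor G" "Src G = Tgt F"
  shows "is_functor (comp_functor G F)"
proof -
  interpret F: is_functor F by fact
  interpret G: is_functor G by fact
  show ?thesis
    by (rule is_functorI)
      (use assms(3) G.arr_simps G.map_obj G.map_id G.comp_map in
        \<open>auto simp: comp_functor_def F.source.category_axioms G.target.category_axioms
          F.arr_simps F.map_obj F.map_id F.comp_map\<close>)
qed

lemma id_functor_simps [simp]:
  "Src (id_functor C) = C" "Tgt (id_functor C) = C"
  "X \<in> Obj C \<Longrightarrow> ObF (id_functor C) X = X" "u \<in> Arr C \<Longrightarrow> ArF (id_functor C) u = u"
  by (simp_all add: id_functor_def)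

lemma is_functor_id: "category C \<Longrightarrow> is_functor (id_functor C)"
proof -
  assume "category C"
  then interpret category C .
  show ?thesis
    by (rule is_functorI) (auto simp: id_functor_def category_axioms)
qed

section \<open>Symmetric monoidal functors\<close>

lemma product_category_simps [simp]:
  "Obj (product_category C D) = Obj C \<times> Obj D" "Arr (product_category C D) = Arr C \<times> Arr D"
  "Dom (product_category C D) = map_prod (Dom C) (Dom D)"
  "Cod (product_category C D) = map_prod (Cod C) (Cod D)"
  "Idn (product_category C D) = map_prod (Idn C) (Idn D)"
  "(g, g') \<cdot>\<^bsub>product_category C D\<^esub> (f, f') = (g \<cdot>\<^bsub>C\<^esub> f, g' \<cdot>\<^bsub>D\<^esub> f')"
  by (simp_all add: product_category_def)

context symmetric_monoidal_category
begin

lemma ten_simps [simp]: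
  "\<lbrakk>X \<in> Obj M; Y \<in> Obj M\<rbrakk> \<Longrightarrow> ten_obj M X Y \<in> Obj M"
  "\<lbrakk>u \<in> Arr M; v \<in> Arr M\<rbrakk> \<Longrightarrow> ten_arr M u v \<in> Arr M"
  "\<lbrakk>u \<in> Arr M; v \<in> Arr M\<rbrakk> \<Longrightarrow> Dom M (ten_arr M u v) = ten_obj M (Dom M u) (Dom M v)"
  "\<lbrakk>u \<in> Arr M; v \<in> Arr M\<rbrakk> \<Longrightarrow> Cod M (ten_arr M u v) = ten_obj M (Cod M u) (Cod M v)"
  "\<lbrakk>X \<in> Obj M; Y \<in> Obj M\<rbrakk> \<Longrightarrow> ten_arr M (Idn M X) (Idn M Y) = Idn M (ten_obj M X Y)"
  using tensor.map_obj[of "(X, Y)"] tensor.arr_simps[of "(u, v)"] tensor.map_id[of "(X, Y)"]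
  by (simp_all add: ten_src ten_tgt)

lemma ten_comp:
  "\<lbrakk>u \<in> Arr M; v \<in> Arr M; u' \<in> Arr M; v' \<in> Arr M; Cod M u = Dom M u'; Cod M v = Dom M v'\<rbrakk> \<Longrightarrow>
    ten_arr M (u' \<cdot> u) (v' \<cdot> v) = ten_arr M u' v' \<cdot> ten_arr M u v"
  using tensor.comp_map[of "(u, v)" "(u', v')"] by (simp add: ten_src ten_tgt)

lemma constraint_simps [simp]:
  "Unt M \<in> Obj M"
  "\<lbrakk>X \<in> Obj M; Y \<in> Obj M; Z \<in> Obj M\<rbrakk> \<Longrightarrow> Asc M X Y Z \<in> Arr M"
  "\<lbrakk>X \<in> Obj M; Y \<in> Obj M; Z \<in> Obj M\<rbrakk> \<Longrightarrow> Dom M (Asc M X Y Z) = ten_obj M (ten_obj M X Y) Z"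
  "\<lbrakk>X \<in> Obj M; Y \<in> Obj M; Z \<in> Obj M\<rbrakk> \<Longrightarrow> Cod M (Asc M X Y Z) = ten_obj M X (ten_obj M Y Z)"
  "X \<in> Obj M \<Longrightarrow> LUn M X \<in> Arr M" "X \<in> Obj M \<Longrightarrow> Dom M (LUn M X) = ten_obj M (Unt M) X"
  "X \<in> Obj M \<Longrightarrow> Cod M (LUn M X) = X"
  "X \<in> Obj M \<Longrightarrow> RUn M X \<in> Arr M" "X \<in> Obj M \<Longrightarrow> Dom M (RUn M X) = ten_obj M X (Unt M)"
  "X \<in> Obj M \<Longrightarrow> Cod M (RUn M X) = X"
  "\<lbrakk>X \<in> Obj M; Y \<in> Obj M\<rbrakk> \<Longrightarrow> Brd M X Y \<in> Arr M"
  "\<lbrakk>X \<in> Obj M; Y \<in> Obj M\<rbrakk> \<Longrightarrow> Dom M (Brd M X Y) = ten_obj M X Y"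
  "\<lbrakk>X \<in> Obj M; Y \<in> Obj M\<rbrakk> \<Longrightarrow> Cod M (Brd M X Y) = ten_obj M Y X"
  using unit_obj asc_hom[of X Y Z] lun_hom[of X] run_hom[of X] brd_hom[of X Y]
      by (simp_all add: Hom_iff)

lemma smc: "symmetric_monoidal_category M"
  by unfold_locales

end

lemma symmetric_monoidal_functorI:
  assumes "symmetric_monoidal_category (MSrc \<Phi>)" "symmetric_monoidal_category (MTgt \<Phi>)"
    "is_functor (MFun \<Phi>)" "Src (MFun \<Phi>) = underlying (MSrc \<Phi>)" "Tgt (MFun \<Phi>) = underlying (MTgt \<Phi>)"
    and "\<And>X Y. \<lbrakk>X \<in> Obj (MSrc \<Phi>); Y \<in> Obj (MSrc \<Phi>)\<rbrakk> \<Longrightarrow>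
      isomorphism (MTgt \<Phi>) (Mul \<Phi> (X, Y)) \<and>
      Dom (MTgt \<Phi>) (Mul \<Phi> (X, Y)) = ten_obj (MTgt \<Phi>) (ObF (MFun \<Phi>) X) (ObF (MFun \<Phi>) Y) \<and>
      Cod (MTgt \<Phi>) (Mul \<Phi> (X, Y)) = ObF (MFun \<Phi>) (ten_obj (MSrc \<Phi>) X Y)"
    and "isomorphism (MTgt \<Phi>) (Uni \<Phi>) \<and> Dom (MTgt \<Phi>) (Uni \<Phi>) = Unt (MTgt \<Phi>) \<and>
      Cod (MTgt \<Phi>) (Uni \<Phi>) = ObF (MFun \<Phi>) (Unt (MSrc \<Phi>))"
    and "\<And>u v. \<lbrakk>u \<in> Arr (MSrc \<Phi>); v \<in> Arr (MSrc \<Phi>)\<rbrakk> \<Longrightarrow>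
      Mul \<Phi> (Cod (MSrc \<Phi>) u, Cod (MSrc \<Phi>) v)
          \<cdot>\<^bsub>MTgt \<Phi>\<^esub> ten_arr (MTgt \<Phi>) (ArF (MFun \<Phi>) u) (ArF (MFun \<Phi>) v)
        = ArF (MFun \<Phi>) (ten_arr (MSrc \<Phi>) u v) \<cdot>\<^bsub>MTgt \<Phi>\<^esub> Mul \<Phi> (Dom (MSrc \<Phi>) u, Dom (MSrc \<Phi>) v)"
    and "\<And>X Y Z. \<lbrakk>X \<in> Obj (MSrc \<Phi>); Y \<in> Obj (MSrc \<Phi>); Z \<in> Obj (MSrc \<Phi>)\<rbrakk> \<Longrightarrow>
      ArF (MFun \<Phi>) (Asc (MSrc \<Phi>) X Y Z) \<cdot>\<^bsub>MTgt \<Phi>\<^esub> Mul \<Phi> (ten_obj (MSrc \<Phi>) X Y, Z)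
          \<cdot>\<^bsub>MTgt \<Phi>\<^esub> ten_arr (MTgt \<Phi>) (Mul \<Phi> (X, Y)) (Idn (MTgt \<Phi>) (ObF (MFun \<Phi>) Z))
        = Mul \<Phi> (X, ten_obj (MSrc \<Phi>) Y Z)
          \<cdot>\<^bsub>MTgt \<Phi>\<^esub> ten_arr (MTgt \<Phi>) (Idn (MTgt \<Phi>) (ObF (MFun \<Phi>) X)) (Mul \<Phi> (Y, Z))
          \<cdot>\<^bsub>MTgt \<Phi>\<^esub> Asc (MTgt \<Phi>) (ObF (MFun \<Phi>) X) (ObF (MFun \<Phi>) Y) (ObF (MFun \<Phi>) Z)"
    and "\<And>X. X \<in> Obj (MSrc \<Phi>) \<Longrightarrow>
      ArF (MFun \<Phi>) (LUn (MSrc \<Phi>) X) \<cdot>\<^bsub>MTgt \<Phi>\<^esub> Mul \<Phi> (Unt (MSrc \<Phi>), X)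
          \<cdot>\<^bsub>MTgt \<Phi>\<^esub> ten_arr (MTgt \<Phi>) (Uni \<Phi>) (Idn (MTgt \<Phi>) (ObF (MFun \<Phi>) X))
        = LUn (MTgt \<Phi>) (ObF (MFun \<Phi>) X)"
    and "\<And>X. X \<in> Obj (MSrc \<Phi>) \<Longrightarrow>
      ArF (MFun \<Phi>) (RUn (MSrc \<Phi>) X) \<cdot>\<^bsub>MTgt \<Phi>\<^esub> Mul \<Phi> (X, Unt (MSrc \<Phi>))
          \<cdot>\<^bsub>MTgt \<Phi>\<^esub> ten_arr (MTgt \<Phi>) (Idn (MTgt \<Phi>) (ObF (MFun \<Phi>) X)) (Uni \<Phi>)
        = RUn (MTgt \<Phi>) (ObF (MFun \<Phi>) X)"
    and "\<And>X Y. \<lbrakk>X \<in> Obj (MSrc \<Phi>); Y \<in> Obj (MSrc \<Phi>)\<rbrakk> \<Longrightarrow>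
      ArF (MFun \<Phi>) (Brd (MSrc \<Phi>) X Y) \<cdot>\<^bsub>MTgt \<Phi>\<^esub> Mul \<Phi> (X, Y)
        = Mul \<Phi> (Y, X) \<cdot>\<^bsub>MTgt \<Phi>\<^esub> Brd (MTgt \<Phi>) (ObF (MFun \<Phi>) X) (ObF (MFun \<Phi>) Y)"
  shows "symmetric_monoidal_functor \<Phi>"
  using assms
  by (intro symmetric_monoidal_functor.intro symmetric_monoidal_functor_axioms.intro)
    (auto simp: Hom_iff elim: isomorphismE)

text \<open>These are the 1-cells of \<open>Sym2Gp\<close> from \<open>M\<close> to
  \<open>N\<close>, without asking \<open>M\<close> and \<open>N\<close> to be 2-groups. With source
  and target as parameters, typing facts can be stated in \<open>M\<close> and \<open>N\<close>
  directly.\<close>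

locale sym_fun =
  M: symmetric_monoidal_category M + N: symmetric_monoidal_category N
  for M N :: "('o, 'a) monoidal_cat" and \<Phi> :: "('o, 'a) monoidal_fun" +
  assumes smf: "symmetric_monoidal_functor \<Phi>" and ext: "monoidal_fun_ext \<Phi>"
    and src: "MSrc \<Phi> = M" and tgt: "MTgt \<Phi> = N"
begin

interpretation S: symmetric_monoidal_functor \<Phi> by (rule smf)

lemma fun_simps [simp]:
  "MSrc \<Phi> = M" "MTgt \<Phi> = N" "Src (MFun \<Phi>) = underlying M" "Tgt (MFun \<Phi>) = underlying N"
  using S.fun_src S.fun_tgt by (simp_all add: src tgt)

lemma is_functor: "is_functor (MFun \<Phi>)"
  by unfold_locales

lemma map_simps [simp]:
  "X \<in> Obj M \<Longrightarrow> ObF (MFun \<Phi>) X \<in> Obj N"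
  "u \<in> Arr M \<Longrightarrow> ArF (MFun \<Phi>) u \<in> Arr N"
  "u \<in> Arr M \<Longrightarrow> Dom N (ArF (MFun \<Phi>) u) = ObF (MFun \<Phi>) (Dom M u)"
  "u \<in> Arr M \<Longrightarrow> Cod N (ArF (MFun \<Phi>) u) = ObF (MFun \<Phi>) (Cod M u)"
  "X \<in> Obj M \<Longrightarrow> ArF (MFun \<Phi>) (Idn M X) = Idn N (ObF (MFun \<Phi>) X)"
  using S.F.map_obj[of X] S.F.arr_simps[of u] S.F.map_id[of X] by simp_all

lemma map_comp:
  "\<lbrakk>u \<in> Arr M; v \<in> Arr M; Cod M u = Dom M v\<rbrakk> \<Longrightarrow>
    ArF (MFun \<Phi>) (v \<cdot>\<^bsub>M\<^esub> u) = ArF (MFun \<Phi>) v \<cdot>\<^bsub>N\<^esub> ArF (MFun \<Phi>) u"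
  using S.F.comp_map[of u v] by simp

lemma mul_simps [simp]:
  "\<lbrakk>X \<in> Obj M; Y \<in> Obj M\<rbrakk> \<Longrightarrow> Mul \<Phi> (X, Y) \<in> Arr N"
  "\<lbrakk>X \<in> Obj M; Y \<in> Obj M\<rbrakk> \<Longrightarrow>
    Dom N (Mul \<Phi> (X, Y)) = ten_obj N (ObF (MFun \<Phi>) X) (ObF (MFun \<Phi>) Y)"
  "\<lbrakk>X \<in> Obj M; Y \<in> Obj M\<rbrakk> \<Longrightarrow> Cod N (Mul \<Phi> (X, Y)) = ObF (MFun \<Phi>) (ten_obj M X Y)"
  "Uni \<Phi> \<in> Arr N" "Dom N (Uni \<Phi>) = Unt N" "Cod N (Uni \<Phi>) = ObF (MFun \<Phi>) (Unt M)"
  using S.mul_hom[of X Y] S.uni_hom by (simp_all add: Hom_iff)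

lemma iso_simps:
  "\<lbrakk>X \<in> Obj M; Y \<in> Obj M\<rbrakk> \<Longrightarrow> isomorphism N (Mul \<Phi> (X, Y))" "isomorphism N (Uni \<Phi>)"
  using S.mul_iso[of X Y] S.uni_iso by simp_all

lemma mul_nat:
  "\<lbrakk>u \<in> Arr M; v \<in> Arr M\<rbrakk> \<Longrightarrow>
    Mul \<Phi> (Cod M u, Cod M v) \<cdot>\<^bsub>N\<^esub> ten_arr N (ArF (MFun \<Phi>) u) (ArF (MFun \<Phi>) v)
      = ArF (MFun \<Phi>) (ten_arr M u v) \<cdot>\<^bsub>N\<^esub> Mul \<Phi> (Dom M u, Dom M v)"
  using S.mul_nat[of u _ _ v] by (simp add: Hom_iff)

lemmas coherence = S.mul_assoc[simplified] S.mul_lunit[simplified] S.mul_runit[simplified]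
  S.mul_braid[simplified]

lemma map_iso: "isomorphism M u \<Longrightarrow> isomorphism N (ArF (MFun \<Phi>) u)"
proof (erule isomorphismE)
  fix v assume "u \<in> Arr M" "v \<in> Arr M" "Dom M v = Cod M u" "Cod M v = Dom M u"
    "v \<cdot>\<^bsub>M\<^esub> u = Idn M (Dom M u)" "u \<cdot>\<^bsub>M\<^esub> v = Idn M (Cod M u)"
  then show ?thesis
    by (intro isomorphismI[where g = "ArF (MFun \<Phi>) v"]) (simp_all flip: map_comp)
qed

lemma ext_simps:
  "ObF (MFun \<Phi>) \<in> extensional (Obj M)" "ArF (MFun \<Phi>) \<in> extensional (Arr M)"
  "Mul \<Phi> \<in> extensional (Obj M \<times> Obj M)"
  using ext by (simp_all add: monoidal_fun_ext_def functor_ext_def)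

end

text \<open>The functor and \<open>Mul\<close> are extensional, so their values outside
  \<open>M\<close> are fixed and agreement on \<open>M\<close> is equality of records.\<close>

lemma sym_fun_eqI:
  assumes "sym_fun M N \<Phi>" "sym_fun M N \<Psi>"
    and "\<And>X. X \<in> Obj M \<Longrightarrow> ObF (MFun \<Phi>) X = ObF (MFun \<Psi>) X"
    and "\<And>u. u \<in> Arr M \<Longrightarrow> ArF (MFun \<Phi>) u = ArF (MFun \<Psi>) u"
    and "\<And>X Y. \<lbrakk>X \<in> Obj M; Y \<in> Obj M\<rbrakk> \<Longrightarrow> Mul \<Phi> (X, Y) = Mul \<Psi> (X, Y)"
    and "Uni \<Phi> = Uni \<Psi>"
  shows "\<Phi> = \<Psi>"
proof -
  interpret F: sym_fun M N \<Phi> by fact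
  interpret G: sym_fun M N \<Psi> by fact
  have "ObF (MFun \<Phi>) = ObF (MFun \<Psi>)"
    using F.ext_simps(1) G.ext_simps(1) assms(3) by (rule extensionalityI)
  moreover have "ArF (MFun \<Phi>) = ArF (MFun \<Psi>)"
    using F.ext_simps(2) G.ext_simps(2) assms(4) by (rule extensionalityI)
  moreover have "Mul \<Phi> = Mul \<Psi>"
    using F.ext_simps(3) G.ext_simps(3) by (rule extensionalityI) (auto simp: assms(5))
  ultimately show ?thesis
    using assms(6) F.fun_simps G.fun_simps by simp
qed

lemma Cell1_Sym2Gp:
  assumes "M \<in> Cell0 Sym2Gp" "N \<in> Cell0 Sym2Gp"
  shows "\<Phi> \<in> Cell1 Sym2Gp M N \<longleftrightarrow> sym_fun M N \<Phi>"
  using assms by (auto simp: Sym2Gp_def symmetric_2_group_def sym_fun_def sym_fun_axioms_def)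

lemma sym_fun_id:
  assumes "symmetric_monoidal_category M"
  shows "sym_fun M M (id_monoidal_fun M)"
proof -
  interpret M: symmetric_monoidal_category M by fact
  have iso: "isomorphism M (Idn M X)" if "X \<in> Obj M" for X
    by (rule isomorphismI[where g = "Idn M X"]) (use that in simp_all)
  have "symmetric_monoidal_functor (id_monoidal_fun M)"
    by (rule symmetric_monoidal_functorI)
      (simp_all add: id_monoidal_fun_def M.smc iso
        is_functor_id M.category_axioms)
  then show ?thesis
    by (simp add: sym_fun_def sym_fun_axioms_def M.smc id_monoidal_fun_def monoidal_fun_ext_def
        functor_ext_def id_functor_def)
qed

section \<open>Composition of symmetric monoidal functors\<close>

locale sym_fun_pair = F: sym_fun M N \<Phi> + G: sym_fun N P \<Psi> for M N P \<Phi> \<Psi>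
begin

lemma comp_mul:
  "\<lbrakk>X \<in> Obj M; Y \<in> Obj M\<rbrakk> \<Longrightarrow> Mul (comp_monoidal_fun \<Psi> \<Phi>) (X, Y)
    = ArF (MFun \<Psi>) (Mul \<Phi> (X, Y)) \<cdot>\<^bsub>P\<^esub> Mul \<Psi> (ObF (MFun \<Phi>) X, ObF (MFun \<Phi>) Y)"
  by (simp add: comp_monoidal_fun_def)

text \<open>Naturality of \<open>Mul \<Psi>\<close> in a form that rewrites inside right-nested
  composites. Objects enter through equations, so that the rule matches them in whatever form they
  occur.\<close>

lemma mul_nat_G:
  assumes "u \<in> Arr N" "v \<in> Arr N" "z \<in> Arr P" "Dom N u = X'" "Dom N v = Y'"
    "Cod N u = X" "Cod N v = Y" "Cod P z = ten_obj P (ObF (MFun \<Psi>) X') (ObF (MFun \<Psi>) Y')"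
  shows "Mul \<Psi> (X, Y) \<cdot>\<^bsub>P\<^esub> (ten_arr P (ArF (MFun \<Psi>) u) (ArF (MFun \<Psi>) v) \<cdot>\<^bsub>P\<^esub> z)
      = ArF (MFun \<Psi>) (ten_arr N u v) \<cdot>\<^bsub>P\<^esub> (Mul \<Psi> (X', Y') \<cdot>\<^bsub>P\<^esub> z)"
  using G.N.comp_reassoc[OF G.mul_nat[of u v], of z] assms(1-3,8) unfolding assms(4-7)[symmetric]
      by simp

text \<open>In the coherence laws one tensor factor is an identity. The simplifier turns its image
  under \<open>\<Psi>\<close> into an identity of \<open>P\<close>, which hides the pattern of
  \<open>mul_nat_G\<close>.\<close>

lemma mul_nat_G_id:
  assumes "u \<in> Arr N" "A \<in> Obj N" "z \<in> Arr P" "Dom N u = X'" "Cod N u = X"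
  shows "Cod P z = ten_obj P (ObF (MFun \<Psi>) X') (ObF (MFun \<Psi>) A) \<Longrightarrow>
      Mul \<Psi> (X, A) \<cdot>\<^bsub>P\<^esub> (ten_arr P (ArF (MFun \<Psi>) u) (Idn P (ObF (MFun \<Psi>) A)) \<cdot>\<^bsub>P\<^esub> z)
      = ArF (MFun \<Psi>) (ten_arr N u (Idn N A)) \<cdot>\<^bsub>P\<^esub> (Mul \<Psi> (X', A) \<cdot>\<^bsub>P\<^esub> z)"
    and "Cod P z = ten_obj P (ObF (MFun \<Psi>) A) (ObF (MFun \<Psi>) X') \<Longrightarrow>
      Mul \<Psi> (A, X) \<cdot>\<^bsub>P\<^esub> (ten_arr P (Idn P (ObF (MFun \<Psi>) A)) (ArF (MFun \<Psi>) u) \<cdot>\<^bsub>P\<^esub> z)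
      = ArF (MFun \<Psi>) (ten_arr N (Idn N A) u) \<cdot>\<^bsub>P\<^esub> (Mul \<Psi> (A, X') \<cdot>\<^bsub>P\<^esub> z)"
  using mul_nat_G[of u "Idn N A" z X' A X A] mul_nat_G[of "Idn N A" u z A X' A X] assms by simp_all

text \<open>Each law for the composite is obtained by pasting the image under \<open>\<Psi>\<close>
  of the law for \<open>\<Phi>\<close>, naturality of \<open>Mul \<Psi>\<close>, and the law for
  \<open>\<Psi>\<close>.\<close>

lemma sym_fun_comp: "sym_fun M P (comp_monoidal_fun \<Psi> \<Phi>)"
proof -
  let ?F = "ObF (MFun \<Phi>)" and ?F' = "ArF (MFun \<Phi>)" and ?G = "ObF (MFun \<Psi>)" and ?G' = "ArF (MFun \<Psi>)"
  let ?\<Theta> = "comp_monoidal_fun \<Psi> \<Phi>"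
  note [simp] = comp_mul
  have simps [simp]: "MSrc ?\<Theta> = M" "MTgt ?\<Theta> = P" "MFun ?\<Theta> = comp_functor (MFun \<Psi>) (MFun \<Phi>)"
    "Uni ?\<Theta> = ?G' (Uni \<Phi>) \<cdot>\<^bsub>P\<^esub> Uni \<Psi>"
    "\<And>X. X \<in> Obj M \<Longrightarrow> ObF (comp_functor (MFun \<Psi>) (MFun \<Phi>)) X = ?G (?F X)"
    "\<And>u. u \<in> Arr M \<Longrightarrow> ArF (comp_functor (MFun \<Psi>) (MFun \<Phi>)) u = ?G' (?F' u)"
    "Src (comp_functor (MFun \<Psi>) (MFun \<Phi>)) = underlying M"
        "Tgt (comp_functor (MFun \<Psi>) (MFun \<Phi>)) = underlying P"
    by (simp_all add: comp_monoidal_fun_def comp_functor_def)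
  have "symmetric_monoidal_functor ?\<Theta>"
  proof (rule symmetric_monoidal_functorI, goal_cases)
    case 1 show ?case by (simp add: F.M.smc)
  next
    case 2 show ?case by (simp add: G.N.smc)
  next
    case 3 show ?case by (simp add: is_functor_comp F.is_functor G.is_functor)
  next
    case 4 show ?case by simp
  next
    case 5 show ?case by simp
  next
    case (6 X Y) then show ?case
      by (simp add: G.N.isomorphism_comp G.map_iso F.iso_simps G.iso_simps)
  next
    case 7 show ?case
      by (simp add: G.N.isomorphism_comp G.map_iso F.iso_simps G.iso_simps)
  next
    case (8 u v)
    then have "?G' (Mul \<Phi> (Cod M u, Cod M v)) \<cdot>\<^bsub>P\<^esub> ?G' (ten_arr N (?F' u) (?F' v))
      = ?G' (?F' (ten_arr M u v)) \<cdot>\<^bsub>P\<^esub> ?G' (Mul \<Phi> (Dom M u, Dom M v))"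
      using F.mul_nat[of u v] by (simp flip: G.map_comp)
    from G.N.comp_reassoc[OF this, of "Mul \<Psi> (?F (Dom M u), ?F (Dom M v))"] 8
    show ?case using G.mul_nat[of "?F' u" "?F' v"] by simp
  next
    case (9 X Y Z)
    then have "?G' (?F' (Asc M X Y Z)) \<cdot>\<^bsub>P\<^esub> ?G' (Mul \<Phi> (ten_obj M X Y, Z))
        \<cdot>\<^bsub>P\<^esub> ?G' (ten_arr N (Mul \<Phi> (X, Y)) (Idn N (?F Z)))
      = ?G' (Mul \<Phi> (X, ten_obj M Y Z)) \<cdot>\<^bsub>P\<^esub> ?G' (ten_arr N (Idn N (?F X)) (Mul \<Phi> (Y, Z)))
          \<cdot>\<^bsub>P\<^esub> ?G' (Asc N (?F X) (?F Y) (?F Z))"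
      using F.coherence(1)[of X Y Z] by (simp flip: G.map_comp)
    \<comment> \<open>Precomposition with the constraints of \<open>\<Psi>\<close> supplies the
      missing half of the law; naturality of \<open>Mul \<Psi>\<close> then moves these constraints
      past the images of the arrows of \<open>N\<close>.\<close>
    from arg_cong[OF this, of "\<lambda>w. w \<cdot>\<^bsub>P\<^esub> (Mul \<Psi> (ten_obj N (?F X) (?F Y), ?F Z)
        \<cdot>\<^bsub>P\<^esub> ten_arr P (Mul \<Psi> (?F X, ?F Y)) (Idn P (?G (?F Z))))"] 9
    show ?case
      using G.coherence(1)[of "?F X" "?F Y" "?F Z"]
        G.N.ten_comp[of "Mul \<Psi> (?F X, ?F Y)" "Idn P (?G (?F Z))" "?G' (Mul \<Phi> (X, Y))"
            "Idn P (?G (?F Z))"]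
        G.N.ten_comp[of "Idn P (?G (?F X))" "Mul \<Psi> (?F Y, ?F Z)" "Idn P (?G (?F X))"
            "?G' (Mul \<Phi> (Y, Z))"]
      by (simp add: mul_nat_G_id)
  next
    case (10 X)
    then have "?G' (?F' (LUn M X)) \<cdot>\<^bsub>P\<^esub> ?G' (Mul \<Phi> (Unt M, X))
        \<cdot>\<^bsub>P\<^esub> ?G' (ten_arr N (Uni \<Phi>) (Idn N (?F X)))
      = ?G' (LUn N (?F X))"
      using F.coherence(2)[of X] by (simp flip: G.map_comp)
    from arg_cong[OF this, of "\<lambda>w. w \<cdot>\<^bsub>P\<^esub> (Mul \<Psi> (Unt N, ?F X)
        \<cdot>\<^bsub>P\<^esub> ten_arr P (Uni \<Psi>) (Idn P (?G (?F X))))"] 10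
    show ?case
      using G.coherence(2)[of "?F X"]
        G.N.ten_comp[of "Uni \<Psi>" "Idn P (?G (?F X))" "?G' (Uni \<Phi>)" "Idn P (?G (?F X))"]
      by (simp add: mul_nat_G_id)
  next
    case (11 X)
    then have "?G' (?F' (RUn M X)) \<cdot>\<^bsub>P\<^esub> ?G' (Mul \<Phi> (X, Unt M))
        \<cdot>\<^bsub>P\<^esub> ?G' (ten_arr N (Idn N (?F X)) (Uni \<Phi>))
      = ?G' (RUn N (?F X))"
      using F.coherence(3)[of X] by (simp flip: G.map_comp)
    from arg_cong[OF this, of "\<lambda>w. w \<cdot>\<^bsub>P\<^esub> (Mul \<Psi> (?F X, Unt N)
        \<cdot>\<^bsub>P\<^esub> ten_arr P (Idn P (?G (?F X))) (Uni \<Psi>))"] 11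
    show ?case
      using G.coherence(3)[of "?F X"]
        G.N.ten_comp[of "Idn P (?G (?F X))" "Uni \<Psi>" "Idn P (?G (?F X))" "?G' (Uni \<Phi>)"]
      by (simp add: mul_nat_G_id)
  next
    case (12 X Y)
    then have "?G' (?F' (Brd M X Y)) \<cdot>\<^bsub>P\<^esub> ?G' (Mul \<Phi> (X, Y))
      = ?G' (Mul \<Phi> (Y, X)) \<cdot>\<^bsub>P\<^esub> ?G' (Brd N (?F X) (?F Y))"
      using F.coherence(4)[of X Y] by (simp flip: G.map_comp)
    from G.N.comp_reassoc[OF this, of "Mul \<Psi> (?F X, ?F Y)"] 12
    show ?case using G.coherence(4)[of "?F X" "?F Y"] by simp
  qed
  then show ?thesis
    by (simp add: sym_fun_def sym_fun_axioms_def F.M.smc G.N.smc monoidal_fun_ext_def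
        functor_ext_def)
      (simp add: comp_monoidal_fun_def comp_functor_def)
qed

end

section \<open>The 2-category of symmetric 2-groups\<close>

lemma is_monoidal_transI:
  assumes "symmetric_monoidal_functor (TSrc \<theta>)" "symmetric_monoidal_functor (TTgt \<theta>)"
    and "MSrc (TTgt \<theta>) = MSrc (TSrc \<theta>)" "MTgt (TTgt \<theta>) = MTgt (TSrc \<theta>)"
    and "NSrc (TNat \<theta>) = MFun (TSrc \<theta>)" "NTgt (TNat \<theta>) = MFun (TTgt \<theta>)"
    and "\<And>X. X \<in> Obj (MSrc (TSrc \<theta>)) \<Longrightarrow> NCmp (TNat \<theta>) X \<in> Arr (MTgt (TSrc \<theta>)) \<and>
      Dom (MTgt (TSrc \<theta>)) (NCmp (TNat \<theta>) X) = ObF (MFun (TSrc \<theta>)) X \<and>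
      Cod (MTgt (TSrc \<theta>)) (NCmp (TNat \<theta>) X) = ObF (MFun (TTgt \<theta>)) X"
    and "\<And>u. u \<in> Arr (MSrc (TSrc \<theta>)) \<Longrightarrow>
      NCmp (TNat \<theta>) (Cod (MSrc (TSrc \<theta>)) u) \<cdot>\<^bsub>MTgt (TSrc \<theta>)\<^esub> ArF (MFun (TSrc \<theta>)) u
        = ArF (MFun (TTgt \<theta>)) u \<cdot>\<^bsub>MTgt (TSrc \<theta>)\<^esub> NCmp (TNat \<theta>) (Dom (MSrc (TSrc \<theta>)) u)"
    and "\<And>X Y. \<lbrakk>X \<in> Obj (MSrc (TSrc \<theta>)); Y \<in> Obj (MSrc (TSrc \<theta>))\<rbrakk> \<Longrightarrow>
      NCmp (TNat \<theta>) (ten_obj (MSrc (TSrc \<theta>)) X Y) \<cdot>\<^bsub>MTgt (TSrc \<theta>)\<^esub> Mul (TSrc \<theta>) (X, Y)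
        = Mul (TTgt \<theta>) (X, Y)
          \<cdot>\<^bsub>MTgt (TSrc \<theta>)\<^esub> ten_arr (MTgt (TSrc \<theta>)) (NCmp (TNat \<theta>) X) (NCmp (TNat \<theta>) Y)"
    and "NCmp (TNat \<theta>) (Unt (MSrc (TSrc \<theta>))) \<cdot>\<^bsub>MTgt (TSrc \<theta>)\<^esub> Uni (TSrc \<theta>) = Uni (TTgt \<theta>)"
  shows "is_monoidal_trans \<theta>"
proof -
  interpret F: symmetric_monoidal_functor "TSrc \<theta>" by fact
  interpret G: symmetric_monoidal_functor "TTgt \<theta>" by fact
  have "is_nat_trans (TNat \<theta>)"
    using assms F.F.is_functor_axioms G.F.is_functor_axioms
    by (intro is_nat_trans.intro is_nat_trans_axioms.intro)
      (auto simp: Hom_iff F.fun_src F.fun_tgt G.fun_src G.fun_tgt)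
  then show ?thesis
    using assms by (intro is_monoidal_trans.intro is_monoidal_trans_axioms.intro) auto
qed

text \<open>The 2-cells of \<open>Sym2Gp\<close>, again with explicit boundary and without the
  2-group condition.\<close>

locale sym_trans = F: sym_fun M N \<Phi> + G: sym_fun M N \<Psi>
  for M N :: "('o, 'a) monoidal_cat" and \<Phi> \<Psi> \<theta> +
  assumes trans: "is_monoidal_trans \<theta>" and cmp_ext: "NCmp (TNat \<theta>) \<in> extensional (Obj M)"
    and tsrc [simp]: "TSrc \<theta> = \<Phi>" and ttgt [simp]: "TTgt \<theta> = \<Psi>"
begin

interpretation S: is_monoidal_trans \<theta> by (rule trans)

lemma nat_simps [simp]: "NSrc (TNat \<theta>) = MFun \<Phi>" "NTgt (TNat \<theta>) = MFun \<Psi>"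
  using S.nat_src S.nat_tgt by simp_all

lemma cmp_simps [simp]:
  assumes "X \<in> Obj M"
  shows "NCmp (TNat \<theta>) X \<in> Arr N" "Dom N (NCmp (TNat \<theta>) X) = ObF (MFun \<Phi>) X"
    "Cod N (NCmp (TNat \<theta>) X) = ObF (MFun \<Psi>) X"
  using S.nat.component[of X] assms by (simp_all add: Hom_iff)

lemma naturality:
  "u \<in> Arr M \<Longrightarrow> NCmp (TNat \<theta>) (Cod M u) \<cdot>\<^bsub>N\<^esub> ArF (MFun \<Phi>) u
    = ArF (MFun \<Psi>) u \<cdot>\<^bsub>N\<^esub> NCmp (TNat \<theta>) (Dom M u)"
  using S.nat.naturality[of u "Dom M u" "Cod M u"] by (simp add: Hom_iff)

lemma mul_compat:
  "\<lbrakk>X \<in> Obj M; Y \<in> Obj M\<rbrakk> \<Longrightarrow> NCmp (TNat \<theta>) (ten_obj M X Y) \<cdot>\<^bsub>N\<^esub> Mul \<Phi> (X, Y)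
    = Mul \<Psi> (X, Y) \<cdot>\<^bsub>N\<^esub> ten_arr N (NCmp (TNat \<theta>) X) (NCmp (TNat \<theta>) Y)"
  using S.mul_compat[of X Y] by simp

lemma uni_compat: "NCmp (TNat \<theta>) (Unt M) \<cdot>\<^bsub>N\<^esub> Uni \<Phi> = Uni \<Psi>"
  using S.uni_compat by simp

lemma sym_trans: "sym_trans M N \<Phi> \<Psi> \<theta>"
  by unfold_locales

end

lemma sym_transI:
  assumes "sym_fun M N \<Phi>" "sym_fun M N \<Psi>"
    and "TSrc \<theta> = \<Phi>" "TTgt \<theta> = \<Psi>" "NSrc (TNat \<theta>) = MFun \<Phi>" "NTgt (TNat \<theta>) = MFun \<Psi>"
    and "NCmp (TNat \<theta>) \<in> extensional (Obj M)"
    and "\<And>X. X \<in> Obj M \<Longrightarrow> NCmp (TNat \<theta>) X \<in> Arr N \<and>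
      Dom N (NCmp (TNat \<theta>) X) = ObF (MFun \<Phi>) X \<and> Cod N (NCmp (TNat \<theta>) X) = ObF (MFun \<Psi>) X"
    and "\<And>u. u \<in> Arr M \<Longrightarrow> NCmp (TNat \<theta>) (Cod M u) \<cdot>\<^bsub>N\<^esub> ArF (MFun \<Phi>) u
        = ArF (MFun \<Psi>) u \<cdot>\<^bsub>N\<^esub> NCmp (TNat \<theta>) (Dom M u)"
    and "\<And>X Y. \<lbrakk>X \<in> Obj M; Y \<in> Obj M\<rbrakk> \<Longrightarrow> NCmp (TNat \<theta>) (ten_obj M X Y) \<cdot>\<^bsub>N\<^esub> Mul \<Phi> (X, Y)
        = Mul \<Psi> (X, Y) \<cdot>\<^bsub>N\<^esub> ten_arr N (NCmp (TNat \<theta>) X) (NCmp (TNat \<theta>) Y)"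
    and "NCmp (TNat \<theta>) (Unt M) \<cdot>\<^bsub>N\<^esub> Uni \<Phi> = Uni \<Psi>"
  shows "sym_trans M N \<Phi> \<Psi> \<theta>"
proof -
  interpret F: sym_fun M N \<Phi> by fact
  interpret G: sym_fun M N \<Psi> by fact
  have "is_monoidal_trans \<theta>"
    by (rule is_monoidal_transI) (use assms in \<open>simp_all add: F.smf G.smf\<close>)
  with assms show ?thesis
    by (simp add: sym_trans_def sym_trans_axioms_def)
qed

text \<open>The boundary determines source and target of the underlying transformation and the
  component function is extensional, so only its values on objects are left to compare.\<close>

lemma sym_trans_eqI:
  assumes "sym_trans M N \<Phi> \<Psi> \<theta>" "sym_trans M N \<Phi> \<Psi> \<eta>"
    and "\<And>X. X \<in> Obj M \<Longrightarrow> NCmp (TNat \<theta>) X = NCmp (TNat \<eta>) X"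
  shows "\<theta> = \<eta>"
proof -
  interpret F: sym_trans M N \<Phi> \<Psi> \<theta> by fact
  interpret G: sym_trans M N \<Phi> \<Psi> \<eta> by fact
  have "NCmp (TNat \<theta>) = NCmp (TNat \<eta>)"
    using F.cmp_ext G.cmp_ext assms(3) by (rule extensionalityI)
  then show ?thesis
    using F.nat_simps G.nat_simps F.tsrc F.ttgt G.tsrc G.ttgt by simp
qed

lemma Cell2_Sym2Gp:
  assumes "sym_fun M N \<Phi>" "sym_fun M N \<Psi>"
  shows "\<theta> \<in> Cell2 Sym2Gp \<Phi> \<Psi> \<longleftrightarrow> sym_trans M N \<Phi> \<Psi> \<theta>"
proof -
  interpret F: sym_fun M N \<Phi> by fact
  interpret G: sym_fun M N \<Psi> by fact
  show ?thesis
    by (auto simp: Sym2Gp_def sym_trans_def sym_trans_axioms_def F.sym_fun_axioms G.sym_fun_axioms)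
qed

lemma Sym2Gp_simps [simp]:
  "Id1 Sym2Gp = id_monoidal_fun" "Comp1 Sym2Gp = comp_monoidal_fun"
  "TSrc (Id2 Sym2Gp \<Phi>) = \<Phi>" "TTgt (Id2 Sym2Gp \<Phi>) = \<Phi>" "TNat (Id2 Sym2Gp \<Phi>) = id_trans (MFun \<Phi>)"
  "TSrc (VComp Sym2Gp \<theta> \<eta>) = TSrc \<eta>" "TTgt (VComp Sym2Gp \<theta> \<eta>) = TTgt \<theta>"
  "TNat (VComp Sym2Gp \<theta> \<eta>) = vcomp_trans (TNat \<theta>) (TNat \<eta>)"
  "TSrc (HComp Sym2Gp \<theta> \<eta>) = comp_monoidal_fun (TSrc \<theta>) (TSrc \<eta>)"
  "TTgt (HComp Sym2Gp \<theta> \<eta>) = comp_monoidal_fun (TTgt \<theta>) (TTgt \<eta>)"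
  "TNat (HComp Sym2Gp \<theta> \<eta>) = hcomp_trans (TNat \<theta>) (TNat \<eta>)"
  by (simp_all add: Sym2Gp_def)

lemma comp_monoidal_fun_simps [simp]:
  "MSrc (comp_monoidal_fun \<Psi> \<Phi>) = MSrc \<Phi>" "MTgt (comp_monoidal_fun \<Psi> \<Phi>) = MTgt \<Psi>"
  "MFun (comp_monoidal_fun \<Psi> \<Phi>) = comp_functor (MFun \<Psi>) (MFun \<Phi>)"
  "Uni (comp_monoidal_fun \<Psi> \<Phi>) = ArF (MFun \<Psi>) (Uni \<Phi>) \<cdot>\<^bsub>MTgt \<Psi>\<^esub> Uni \<Psi>"
  by (simp_all add: comp_monoidal_fun_def)

lemma comp_functor_simps [simp]:
  "Src (comp_functor G F) = Src F" "Tgt (comp_functor G F) = Tgt G"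
  "X \<in> Obj (Src F) \<Longrightarrow> ObF (comp_functor G F) X = ObF G (ObF F X)"
  "u \<in> Arr (Src F) \<Longrightarrow> ArF (comp_functor G F) u = ArF G (ArF F u)"
  by (simp_all add: comp_functor_def)

lemma id_monoidal_fun_simps [simp]:
  "MSrc (id_monoidal_fun M) = M" "MTgt (id_monoidal_fun M) = M"
  "Src (MFun (id_monoidal_fun M)) = underlying M" "Tgt (MFun (id_monoidal_fun M)) = underlying M"
  "X \<in> Obj M \<Longrightarrow> ObF (MFun (id_monoidal_fun M)) X = X"
  "u \<in> Arr M \<Longrightarrow> ArF (MFun (id_monoidal_fun M)) u = u"
  "\<lbrakk>X \<in> Obj M; Y \<in> Obj M\<rbrakk> \<Longrightarrow> Mul (id_monoidal_fun M) (X, Y) = Idn M (ten_obj M X Y)"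
  "Uni (id_monoidal_fun M) = Idn M (Unt M)"
  by (simp_all add: id_monoidal_fun_def id_functor_def)

lemma nat_trans_simps [simp]:
  "NSrc (id_trans F) = F" "NTgt (id_trans F) = F"
  "NSrc (vcomp_trans \<tau> \<sigma>) = NSrc \<sigma>" "NTgt (vcomp_trans \<tau> \<sigma>) = NTgt \<tau>"
  "NSrc (hcomp_trans \<tau> \<sigma>) = comp_functor (NSrc \<tau>) (NSrc \<sigma>)"
  "NTgt (hcomp_trans \<tau> \<sigma>) = comp_functor (NTgt \<tau>) (NTgt \<sigma>)"
  "X \<in> Obj (Src F) \<Longrightarrow> NCmp (id_trans F) X = Idn (Tgt F) (ObF F X)"
  "X \<in> Obj (Src (NSrc \<sigma>)) \<Longrightarrow>
    NCmp (vcomp_trans \<tau> \<sigma>) X = NCmp \<tau> X \<cdot>\<^bsub>Tgt (NSrc \<sigma>)\<^esub> NCmp \<sigma> X"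
  "X \<in> Obj (Src (NSrc \<sigma>)) \<Longrightarrow> NCmp (hcomp_trans \<tau> \<sigma>) X
    = NCmp \<tau> (ObF (NTgt \<sigma>) X) \<cdot>\<^bsub>Tgt (NSrc \<tau>)\<^esub> ArF (NSrc \<tau>) (NCmp \<sigma> X)"
  "NCmp (id_trans F) \<in> extensional (Obj (Src F))"
  "NCmp (vcomp_trans \<tau> \<sigma>) \<in> extensional (Obj (Src (NSrc \<sigma>)))"
  "NCmp (hcomp_trans \<tau> \<sigma>) \<in> extensional (Obj (Src (NSrc \<sigma>)))"
  by (simp_all add: id_trans_def vcomp_trans_def hcomp_trans_def)

section \<open>Strict unit and associativity laws for symmetric monoidal functors\<close>

lemma comp_sym_fun:
  assumes "sym_fun M N \<Phi>" "sym_fun N P \<Psi>"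
  shows "sym_fun M P (comp_monoidal_fun \<Psi> \<Phi>)"
  by (rule sym_fun_pair.sym_fun_comp[OF sym_fun_pair.intro[OF assms]])

lemma comp_mul:
  assumes "sym_fun M N \<Phi>" "sym_fun N P \<Psi>" "X \<in> Obj M" "Y \<in> Obj M"
  shows "Mul (comp_monoidal_fun \<Psi> \<Phi>) (X, Y)
    = ArF (MFun \<Psi>) (Mul \<Phi> (X, Y)) \<cdot>\<^bsub>P\<^esub> Mul \<Psi> (ObF (MFun \<Phi>) X, ObF (MFun \<Phi>) Y)"
  by (rule sym_fun_pair.comp_mul[OF sym_fun_pair.intro[OF assms(1,2)] assms(3,4)])

lemma comp_id_left_sym_fun:
  assumes "sym_fun M N \<Phi>"
  shows "comp_monoidal_fun (id_monoidal_fun N) \<Phi> = \<Phi>"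
proof -
  interpret F: sym_fun M N \<Phi> by fact
  note N = sym_fun_id[OF F.N.smc]
  show ?thesis
    by (rule sym_fun_eqI[OF comp_sym_fun[OF assms N] assms]) (simp_all add: comp_mul[OF assms N])
qed

lemma comp_id_right_sym_fun:
  assumes "sym_fun M N \<Phi>"
  shows "comp_monoidal_fun \<Phi> (id_monoidal_fun M) = \<Phi>"
proof -
  interpret F: sym_fun M N \<Phi> by fact
  note M = sym_fun_id[OF F.M.smc]
  show ?thesis
    by (rule sym_fun_eqI[OF comp_sym_fun[OF M assms] assms]) (simp_all add: comp_mul[OF M assms])
qed

lemma comp_assoc_sym_fun:
  assumes F: "sym_fun M N \<Phi>" and G: "sym_fun N P \<Psi>" and H: "sym_fun P R \<Theta>"
  shows "comp_monoidal_fun (comp_monoidal_fun \<Theta> \<Psi>) \<Phi> = comp_monoidal_fun \<Theta> (comp_monoidal_fun \<Psi> \<Phi>)"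
proof -
  interpret F: sym_fun M N \<Phi> by fact
  interpret G: sym_fun N P \<Psi> by fact
  interpret H: sym_fun P R \<Theta> by fact
  note GF = comp_sym_fun[OF F G] and HG = comp_sym_fun[OF G H]
  show ?thesis
    by (rule sym_fun_eqI[OF comp_sym_fun[OF F HG] comp_sym_fun[OF GF H]])
      (simp_all add: comp_mul[OF F G] comp_mul[OF G H] comp_mul[OF F HG] comp_mul[OF GF H]
          H.map_comp)
qed

section \<open>Identities and composites of monoidal transformations\<close>

lemma sym_trans_id:
  assumes "sym_fun M N \<Phi>"
  shows "sym_trans M N \<Phi> \<Phi> (Id2 Sym2Gp \<Phi>)"
proof -
  interpret F: sym_fun M N \<Phi> by fact
  show ?thesis
  proof (rule sym_transI[OF assms assms])
    show "NCmp (TNat (Id2 Sym2Gp \<Phi>)) \<in> extensional (Obj M)"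
      using nat_trans_simps(10)[of "MFun \<Phi>"] by simp
  qed simp_all
qed

lemma sym_trans_vcomp:
  assumes "sym_trans M N \<Phi> \<Psi> \<eta>" "sym_trans M N \<Psi> \<Theta> \<theta>"
  shows "sym_trans M N \<Phi> \<Theta> (VComp Sym2Gp \<theta> \<eta>)"
proof -
  interpret s: sym_trans M N \<Phi> \<Psi> \<eta> by fact
  interpret t: sym_trans M N \<Psi> \<Theta> \<theta> by fact
  show ?thesis
  proof (rule sym_transI[OF s.F.sym_fun_axioms t.G.sym_fun_axioms], goal_cases)
    case 5 show ?case
      using nat_trans_simps(11)[of "TNat \<theta>" "TNat \<eta>"] by simp
  next
    case (7 u) then show ?case
      using s.naturality[of u] s.F.N.comp_reassoc[OF t.naturality[of u], of
          "NCmp (TNat \<eta>) (Dom M u)"]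
      by simp
  next
    case (8 X Y) then show ?case
      using s.mul_compat[of X Y] s.F.N.comp_reassoc[OF t.mul_compat[of X Y],
          of "ten_arr N (NCmp (TNat \<eta>) X) (NCmp (TNat \<eta>) Y)"]
      by (simp add: s.F.N.ten_comp)
  next
    case 9 show ?case
      using s.uni_compat t.uni_compat by simp
  qed simp_all
qed

text \<open>Compatibility with multiplication combines three squares: the image under
  \<open>\<Psi>\<close> of the one for \<open>\<eta>\<close>, naturality of \<open>\<theta>\<close>
  at the arrow \<open>Mul \<Phi>' (X, Y)\<close>, and the one for \<open>\<theta>\<close>. The unit
  is treated alike.\<close>

lemma sym_trans_hcomp:
  assumes "sym_trans M N \<Phi> \<Phi>' \<eta>" "sym_trans N P \<Psi> \<Psi>' \<theta>"
  shows "sym_trans M P (comp_monoidal_fun \<Psi> \<Phi>) (comp_monoidal_fun \<Psi>' \<Phi>') (HComp Sym2Gp \<theta> \<eta>)"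
proof -
  interpret s: sym_trans M N \<Phi> \<Phi>' \<eta> by fact
  interpret t: sym_trans N P \<Psi> \<Psi>' \<theta> by fact
  let ?G = "\<lambda>u. ArF (MFun \<Psi>) u" and ?G' = "\<lambda>u. ArF (MFun \<Psi>') u"
  let ?s = "NCmp (TNat \<eta>)" and ?t = "NCmp (TNat \<theta>)"
  note mul = comp_mul[OF s.F.sym_fun_axioms t.F.sym_fun_axioms]
      comp_mul[OF s.G.sym_fun_axioms t.G.sym_fun_axioms]
  show ?thesis
  proof (rule sym_transI[OF comp_sym_fun[OF s.F.sym_fun_axioms t.F.sym_fun_axioms]
        comp_sym_fun[OF s.G.sym_fun_axioms t.G.sym_fun_axioms]], goal_cases)
    case 5 show ?case
      using nat_trans_simps(12)[of "TNat \<theta>" "TNat \<eta>"] by simp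
  next
    case (7 u)
    then have "?G (?s (Cod M u)) \<cdot>\<^bsub>P\<^esub> ?G (ArF (MFun \<Phi>) u) = ?G (ArF (MFun \<Phi>') u) \<cdot>\<^bsub>P\<^esub> ?G (?s (Dom M u))"
      using s.naturality[of u] by (simp flip: t.F.map_comp)
    with 7 show ?case
      using t.F.N.comp_reassoc[OF t.naturality[of "ArF (MFun \<Phi>') u"], of "?G (?s (Dom M u))"]
          by simp
  next
    case (8 X Y)
    let ?F = "ObF (MFun \<Phi>)" and ?F' = "ObF (MFun \<Phi>')"
    have "?G (?s (ten_obj M X Y)) \<cdot>\<^bsub>P\<^esub> ?G (Mul \<Phi> (X, Y)) = ?G (Mul \<Phi>' (X, Y))
        \<cdot>\<^bsub>P\<^esub> ?G (ten_arr N (?s X) (?s Y))"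
      using s.mul_compat[of X Y] 8 by (simp flip: t.F.map_comp)
    from t.F.N.comp_reassoc[OF this, of "Mul \<Psi> (?F X, ?F Y)"] 8
    have "?G (?s (ten_obj M X Y)) \<cdot>\<^bsub>P\<^esub> ?G (Mul \<Phi> (X, Y)) \<cdot>\<^bsub>P\<^esub> Mul \<Psi> (?F X, ?F Y)
      = ?G (Mul \<Phi>' (X, Y)) \<cdot>\<^bsub>P\<^esub> Mul \<Psi> (?F' X, ?F' Y) \<cdot>\<^bsub>P\<^esub> ten_arr P (?G (?s X)) (?G (?s Y))"
      using t.F.mul_nat[of "?s X" "?s Y"] by simp
    moreover have "?t (?F' (ten_obj M X Y)) \<cdot>\<^bsub>P\<^esub> ?G (Mul \<Phi>' (X, Y)) \<cdot>\<^bsub>P\<^esub> z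
      = ?G' (Mul \<Phi>' (X, Y)) \<cdot>\<^bsub>P\<^esub> ?t (ten_obj N (?F' X) (?F' Y)) \<cdot>\<^bsub>P\<^esub> z"
      if "z \<in> Arr P" "Cod P z = ObF (MFun \<Psi>) (ten_obj N (?F' X) (?F' Y))" for z
      using t.F.N.comp_reassoc[OF t.naturality[of "Mul \<Phi>' (X, Y)"], of z] 8 that by simp
    moreover have "?t (ten_obj N (?F' X) (?F' Y)) \<cdot>\<^bsub>P\<^esub> Mul \<Psi> (?F' X, ?F' Y) \<cdot>\<^bsub>P\<^esub> z
      = Mul \<Psi>' (?F' X, ?F' Y) \<cdot>\<^bsub>P\<^esub> ten_arr P (?t (?F' X)) (?t (?F' Y)) \<cdot>\<^bsub>P\<^esub> z"
      if "z \<in> Arr P" "Cod P z = ten_obj P (ObF (MFun \<Psi>) (?F' X)) (ObF (MFun \<Psi>) (?F' Y))" for z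
      using t.F.N.comp_reassoc[OF t.mul_compat[of "?F' X" "?F' Y"], of z] 8 that by simp
    ultimately show ?case
      using 8 by (simp add: mul t.F.N.ten_comp)
  next
    case 9
    have "?G (?s (Unt M)) \<cdot>\<^bsub>P\<^esub> ?G (Uni \<Phi>) = ?G (Uni \<Phi>')"
      using s.uni_compat by (simp flip: t.F.map_comp)
    from t.F.N.comp_reassoc[OF this, of "Uni \<Psi>"] show ?case
      using t.F.N.comp_reassoc[OF t.naturality[of "Uni \<Phi>'"], of "Uni \<Psi>"] t.uni_compat by simp
  qed (simp_all)
qed

text \<open>By \<open>sym_fun_eqI\<close> and \<open>sym_trans_eqI\<close> the equational axioms
  become equations between components, which follow from the category laws, functoriality and, for
  interchange, naturality.\<close>

lemma two_category_Sym2Gp: "two_category (Sym2Gp :: (('o, 'a) monoidal_cat, _, _) two_cat)"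
proof -
  have smc: "symmetric_monoidal_category a" if "a \<in> Cell0 Sym2Gp" for a :: "('o, 'a) monoidal_cat"
    using that by (simp add: Sym2Gp_def symmetric_2_group_def)
  note cells = Cell1_Sym2Gp smc sym_fun_id
  show ?thesis
  proof (unfold_locales, goal_cases)
    case (1 a)
    then show ?case by (simp add: cells)
  next
    case (2 a b c f g)
    then show ?case by (simp add: cells comp_sym_fun[of a b _ c])
  next
    case (3 a b f)
    then show ?case by (simp add: cells comp_id_left_sym_fun)
  next
    case (4 a b f)
    then show ?case by (simp add: cells comp_id_right_sym_fun)
  next
    case (5 a b c d f g h)
    then show ?case by (simp add: cells comp_assoc_sym_fun[of a b _ c _ d])
  next
    case (6 a b f)
    then show ?case by (simp add: Cell1_Sym2Gp Cell2_Sym2Gp[of a b] sym_trans_id)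
  next
    case (7 a b f g h s t)
    then show ?case by (simp add: Cell1_Sym2Gp Cell2_Sym2Gp[of a b] sym_trans_vcomp)
  next
    case (8 a b f g s)
    then interpret s: sym_trans a b f g s by (simp add: Cell1_Sym2Gp Cell2_Sym2Gp[of a b])
    show ?case
      by (rule sym_trans_eqI[OF sym_trans_vcomp[OF s.sym_trans sym_trans_id] s.sym_trans])
        (simp_all add: s.G.sym_fun_axioms)
  next
    case (9 a b f g s)
    then interpret s: sym_trans a b f g s by (simp add: Cell1_Sym2Gp Cell2_Sym2Gp[of a b])
    show ?case
      by (rule sym_trans_eqI[OF sym_trans_vcomp[OF sym_trans_id s.sym_trans] s.sym_trans])
        (simp_all add: s.F.sym_fun_axioms)
  next
    case (10 a b f g h k r s t)
    then have *: "sym_trans a b f g r" "sym_trans a b g h s" "sym_trans a b h k t"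
      by (simp_all add: Cell1_Sym2Gp Cell2_Sym2Gp[of a b])
    interpret r: sym_trans a b f g r by fact
    interpret s: sym_trans a b g h s by fact
    interpret t: sym_trans a b h k t by fact
    show ?case
      by (rule sym_trans_eqI[OF sym_trans_vcomp[OF *(1) sym_trans_vcomp[OF *(2,3)]]
            sym_trans_vcomp[OF sym_trans_vcomp[OF *(1,2)] *(3)]]) simp
  next
    case (11 a b c f f' g g' s t)
    then have *: "sym_trans a b f f' s" "sym_trans b c g g' t"
      by (simp_all add: Cell1_Sym2Gp Cell2_Sym2Gp[of a b] Cell2_Sym2Gp[of b c])
    from 11 show ?case
      using sym_trans_hcomp[OF *] by (simp add: Cell1_Sym2Gp Cell2_Sym2Gp[of a c]
          comp_sym_fun[of a b _ c])
  next
    case (12 a b c f g)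
    then interpret f: sym_fun a b f by (simp add: Cell1_Sym2Gp)
    from 12 interpret g: sym_fun b c g by (simp add: Cell1_Sym2Gp)
    note f = f.sym_fun_axioms and g = g.sym_fun_axioms
    show ?case
      unfolding Sym2Gp_simps
      by (rule sym_trans_eqI[OF sym_trans_hcomp[OF sym_trans_id[OF f] sym_trans_id[OF g]]
            sym_trans_id[OF comp_sym_fun[OF f g]]]) simp
  next
    case (13 a b c f f' f'' g g' g'' s s' t t')
    then have *: "sym_trans a b f f' s" "sym_trans a b f' f'' s'" "sym_trans b c g g' t"
        "sym_trans b c g' g'' t'"
      by (simp_all add: Cell1_Sym2Gp Cell2_Sym2Gp[of a b] Cell2_Sym2Gp[of b c])
    interpret s: sym_trans a b f f' s by fact
    interpret s': sym_trans a b f' f'' s' by fact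
    interpret t: sym_trans b c g g' t by fact
    interpret t': sym_trans b c g' g'' t' by fact
    show ?case
    proof (rule sym_trans_eqI[OF sym_trans_hcomp[OF sym_trans_vcomp[OF *(1,2)]
        sym_trans_vcomp[OF *(3,4)]]
            sym_trans_vcomp[OF sym_trans_hcomp[OF *(1,3)] sym_trans_hcomp[OF *(2,4)]]])
      fix X assume "X \<in> Obj a"
      \<comment> \<open>Both sides are composites of four arrows; they differ in the middle two,
        which naturality of \<open>t\<close> at the component of \<open>s'\<close>
        exchanges.\<close>
      then show "NCmp (TNat (HComp Sym2Gp (VComp Sym2Gp t' t) (VComp Sym2Gp s' s))) X
        = NCmp (TNat (VComp Sym2Gp (HComp Sym2Gp t' s') (HComp Sym2Gp t s))) X"
        using t.F.N.comp_reassoc[OF t.naturality[of "NCmp (TNat s') X"], of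
            "ArF (MFun g) (NCmp (TNat s) X)"]
        by (simp add: t.F.map_comp)
    qed
  next
    case (14 a b f g s)
    then interpret s: sym_trans a b f g s by (simp add: Cell1_Sym2Gp Cell2_Sym2Gp[of a b])
    \<comment> \<open>The boundary of the whiskered cell consists of composites with an identity
      functor. The strict unit law turns it into \<open>f\<close> and \<open>g\<close>, so that
      \<open>sym_trans_eqI\<close> applies.\<close>
    have "sym_trans a b f g (HComp Sym2Gp (Id2 Sym2Gp (Id1 Sym2Gp b)) s)"
      using sym_trans_hcomp[OF s.sym_trans sym_trans_id[OF sym_fun_id[OF s.F.N.smc]]]
      by (simp add: comp_id_left_sym_fun s.F.sym_fun_axioms s.G.sym_fun_axioms
          comp_id_left_sym_fun[of a b])
    then show ?case
      by (rule sym_trans_eqI[OF _ s.sym_trans]) simp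
  next
    case (15 a b f g s)
    then interpret s: sym_trans a b f g s by (simp add: Cell1_Sym2Gp Cell2_Sym2Gp[of a b])
    have "sym_trans a b f g (HComp Sym2Gp s (Id2 Sym2Gp (Id1 Sym2Gp a)))"
      using sym_trans_hcomp[OF sym_trans_id[OF sym_fun_id[OF s.F.M.smc]] s.sym_trans]
      by (simp add: s.F.sym_fun_axioms s.G.sym_fun_axioms comp_id_right_sym_fun[of a b])
    then show ?case
      by (rule sym_trans_eqI[OF _ s.sym_trans]) simp
  next
    case (16 a b c d f f' g g' h h' r s t)
    then have *: "sym_trans a b f f' r" "sym_trans b c g g' s" "sym_trans c d h h' t"
      by (simp_all add: Cell1_Sym2Gp Cell2_Sym2Gp[of a b] Cell2_Sym2Gp[of b c] Cell2_Sym2Gp[of c d])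
    interpret r: sym_trans a b f f' r by fact
    interpret s: sym_trans b c g g' s by fact
    interpret t: sym_trans c d h h' t by fact
    have "comp_monoidal_fun h (comp_monoidal_fun g f) = comp_monoidal_fun (comp_monoidal_fun h g) f"
      "comp_monoidal_fun h' (comp_monoidal_fun g' f')
          = comp_monoidal_fun (comp_monoidal_fun h' g') f'"
      by (rule comp_assoc_sym_fun[symmetric];
          fact r.F.sym_fun_axioms s.F.sym_fun_axioms t.F.sym_fun_axioms
            r.G.sym_fun_axioms s.G.sym_fun_axioms t.G.sym_fun_axioms)+
    then have "sym_trans a d (comp_monoidal_fun (comp_monoidal_fun h g) f)
        (comp_monoidal_fun (comp_monoidal_fun h' g') f')
        (HComp Sym2Gp t (HComp Sym2Gp s r))"
      using sym_trans_hcomp[OF sym_trans_hcomp[OF *(1,2)] *(3)] by simp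
    then show ?case
      by (rule sym_trans_eqI[OF sym_trans_hcomp[OF *(1) sym_trans_hcomp[OF *(2,3)]]])
          (simp add: t.F.map_comp)
  qed
qed

text \<open>In a groupoid every component has an inverse. Naturality and both compatibilities of the
  inverse family follow from those of \<open>\<theta>\<close> by cancelling its components.\<close>

lemma invertible2_Sym2Gp:
  assumes "sym_trans M N \<Phi> \<Psi> \<theta>" and N: "groupoid N"
  shows "invertible2 Sym2Gp \<Phi> \<Psi> \<theta>"
proof -
  interpret t: sym_trans M N \<Phi> \<Psi> \<theta> by fact
  let ?t = "NCmp (TNat \<theta>)"
  have "\<exists>v. v \<in> Arr N \<and> Dom N v = ObF (MFun \<Psi>) X \<and> Cod N v = ObF (MFun \<Phi>) X \<and>
      v \<cdot>\<^bsub>N\<^esub> ?t X = Idn N (ObF (MFun \<Phi>) X) \<and> ?t X \<cdot>\<^bsub>N\<^esub> v = Idn N (ObF (MFun \<Psi>) X)" if "X \<in> Obj M" for X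
  proof -
    have "isomorphism N (?t X)" using N that by (simp add: groupoid_def)
    then show ?thesis using that by (auto elim!: isomorphismE)
  qed
  then obtain v where v: "\<And>X. X \<in> Obj M \<Longrightarrow> v X \<in> Arr N \<and> Dom N (v X) = ObF (MFun \<Psi>) X \<and>
      Cod N (v X) = ObF (MFun \<Phi>) X \<and>
      v X \<cdot>\<^bsub>N\<^esub> ?t X = Idn N (ObF (MFun \<Phi>) X) \<and> ?t X \<cdot>\<^bsub>N\<^esub> v X = Idn N (ObF (MFun \<Psi>) X)"
    by metis
  \<comment> \<open>The components of \<open>\<theta>\<close> are split monic, so equations for the
    inverse family may be checked after composing with them.\<close>
  have cancel: "x = y" if "X \<in> Obj M" "?t X \<cdot>\<^bsub>N\<^esub> x = ?t X \<cdot>\<^bsub>N\<^esub> y" "x \<in> Arr N" "y \<in> Arr N"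
    "Cod N x = ObF (MFun \<Phi>) X" "Cod N y = ObF (MFun \<Phi>) X" for x y X
  proof -
    have "v X \<cdot>\<^bsub>N\<^esub> (?t X \<cdot>\<^bsub>N\<^esub> z) = z" if "z \<in> Arr N" "Cod N z = ObF (MFun \<Phi>) X" for z
      by (rule t.F.N.inverse_cancel) (use that v \<open>X \<in> Obj M\<close> in simp_all)
    from this[of x] this[of y] that show ?thesis by metis
  qed
  have cancel': "?t X \<cdot>\<^bsub>N\<^esub> (v X \<cdot>\<^bsub>N\<^esub> x) = x" if "X \<in> Obj M" "x \<in> Arr N"
      "Cod N x = ObF (MFun \<Psi>) X" for x X
    using that v[of X] t.F.N.inverse_cancel[of "?t X" "v X" "ObF (MFun \<Psi>) X" x] by simp
  \<comment> \<open>Components of 2-cells are extensional, hence the restriction to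
    \<open>Obj M\<close>.\<close>
  define \<eta> where "\<eta> = \<lparr>TSrc = \<Psi>, TTgt = \<Phi>, TNat
      = \<lparr>NSrc = MFun \<Psi>, NTgt = MFun \<Phi>, NCmp = restrict v (Obj M)\<rparr>\<rparr>"
  have \<eta>: "sym_trans M N \<Psi> \<Phi> \<eta>"
  proof (rule sym_transI[OF t.G.sym_fun_axioms t.F.sym_fun_axioms], goal_cases)
    case (7 u)
    have "v (Cod M u) \<cdot>\<^bsub>N\<^esub> ArF (MFun \<Psi>) u = ArF (MFun \<Phi>) u \<cdot>\<^bsub>N\<^esub> v (Dom M u)"
      by (rule cancel[of "Cod M u"])
        (use 7 v cancel' t.F.N.comp_reassoc[OF t.naturality[of u], of "v (Dom M u)"] in simp_all)
    with 7 show ?case by (simp add: \<eta>_def)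
  next
    case (8 X Y)
    have "v (ten_obj M X Y) \<cdot>\<^bsub>N\<^esub> Mul \<Psi> (X, Y) = Mul \<Phi> (X, Y) \<cdot>\<^bsub>N\<^esub> ten_arr N (v X) (v Y)"
      by (rule cancel[of "ten_obj M X Y"])
        (use 8 v cancel' t.F.N.comp_reassoc[OF t.mul_compat[of X Y], of "ten_arr N (v X) (v Y)"] in
          \<open>simp_all flip: t.F.N.ten_comp\<close>)
    with 8 show ?case by (simp add: \<eta>_def)
  next
    case 9
    have "v (Unt M) \<cdot>\<^bsub>N\<^esub> Uni \<Psi> = Uni \<Phi>"
      by (rule cancel[of "Unt M"]) (use v cancel' t.uni_compat in simp_all)
    then show ?case by (simp add: \<eta>_def)
  qed (use v in \<open>simp_all add: \<eta>_def\<close>)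
  have "VComp Sym2Gp \<eta> \<theta> = Id2 Sym2Gp \<Phi>"
    by (rule sym_trans_eqI[OF sym_trans_vcomp[OF assms(1) \<eta>] sym_trans_id[OF t.F.sym_fun_axioms]])
      (use v in \<open>simp add: \<eta>_def\<close>)
  moreover have "VComp Sym2Gp \<theta> \<eta> = Id2 Sym2Gp \<Psi>"
    by (rule sym_trans_eqI[OF sym_trans_vcomp[OF \<eta> assms(1)] sym_trans_id[OF t.G.sym_fun_axioms]])
      (use v in \<open>simp add: \<eta>_def\<close>)
  ultimately show ?thesis
    using assms(1) \<eta> by (auto simp: invertible2_def Cell2_Sym2Gp[of M N] t.F.sym_fun_axioms
        t.G.sym_fun_axioms)
qed

section \<open>Finite products\<close>

context cartesian_category
begin

lemma product_simps [simp]: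
  "One C \<in> Obj C"
  "\<lbrakk>A \<in> Obj C; A' \<in> Obj C\<rbrakk> \<Longrightarrow> Times C A A' \<in> Obj C"
  "\<lbrakk>A \<in> Obj C; A' \<in> Obj C\<rbrakk> \<Longrightarrow> Fst C A A' \<in> Arr C"
  "\<lbrakk>A \<in> Obj C; A' \<in> Obj C\<rbrakk> \<Longrightarrow> Dom C (Fst C A A') = Times C A A'"
  "\<lbrakk>A \<in> Obj C; A' \<in> Obj C\<rbrakk> \<Longrightarrow> Cod C (Fst C A A') = A"
  "\<lbrakk>A \<in> Obj C; A' \<in> Obj C\<rbrakk> \<Longrightarrow> Snd C A A' \<in> Arr C"
  "\<lbrakk>A \<in> Obj C; A' \<in> Obj C\<rbrakk> \<Longrightarrow> Dom C (Snd C A A') = Times C A A'"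
  "\<lbrakk>A \<in> Obj C; A' \<in> Obj C\<rbrakk> \<Longrightarrow> Cod C (Snd C A A') = A'"
  using one_obj times_obj[of A A'] fst_hom[of A A'] snd_hom[of A A'] by (simp_all add: Hom_iff)

lemma bang_simps [simp]:
  assumes "A \<in> Obj C"
  shows "bang C A \<in> Arr C" "Dom C (bang C A) = A" "Cod C (bang C A) = One C"
  using theI'[OF one_terminal[OF assms]] by (simp_all add: Hom_iff bang_def)

lemma into_One_eqI:
  "\<lbrakk>f \<in> Arr C; g \<in> Arr C; Dom C f = Dom C g; Cod C f = One C; Cod C g = One C\<rbrakk> \<Longrightarrow> f = g"
  using one_terminal[of "Dom C f"] by (auto simp: Hom_iff)

lemma tuple_simps [simp]:
  assumes "f \<in> Arr C" "g \<in> Arr C" "Dom C f = Dom C g"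
  shows "tuple C f g \<in> Arr C" "Dom C (tuple C f g) = Dom C f"
    "Cod C (tuple C f g) = Times C (Cod C f) (Cod C g)"
    "Cod C f = A \<Longrightarrow> Cod C g = A' \<Longrightarrow> Fst C A A' \<cdot> tuple C f g = f"
    "Cod C f = A \<Longrightarrow> Cod C g = A' \<Longrightarrow> Snd C A A' \<cdot> tuple C f g = g"
  using theI'[OF times_universal[of f "Dom C f" "Cod C f" g "Cod C g"]] assms
  by (auto simp: Hom_iff tuple_def)

lemma into_Times_eqI:
  assumes "f \<in> Arr C" "g \<in> Arr C" "Dom C f = Dom C g" "Cod C f = Times C A A'"
      "Cod C g = Times C A A'"
    and "A \<in> Obj C" "A' \<in> Obj C"
    and "Fst C A A' \<cdot> f = Fst C A A' \<cdot> g" "Snd C A A' \<cdot> f = Snd C A A' \<cdot> g"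
  shows "f = g"
proof -
  have "\<exists>!h. h \<in> Hom C (Dom C f) (Times C A A') \<and> Fst C A A' \<cdot> h = Fst C A A' \<cdot> f \<and> Snd C A A' \<cdot> h
      = Snd C A A' \<cdot> f"
    by (rule times_universal) (use assms in \<open>simp_all add: Hom_iff\<close>)
  with assms show ?thesis by (auto simp: Hom_iff)
qed

lemma tuple_comp [simp]:
  assumes "f \<in> Arr C" "g \<in> Arr C" "h \<in> Arr C" "Dom C f = Dom C g" "Cod C h = Dom C f"
  shows "tuple C f g \<cdot> h = tuple C (f \<cdot> h) (g \<cdot> h)"
  by (rule into_Times_eqI[of _ _ "Cod C f" "Cod C g"])
    (use assms comp_reassoc[of "Fst C (Cod C f) (Cod C g)" "tuple C f g" f h]
      comp_reassoc[of "Snd C (Cod C f) (Cod C g)" "tuple C f g" g h] in simp_all)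

lemma tuple_eta: "\<lbrakk>A \<in> Obj C; A' \<in> Obj C\<rbrakk> \<Longrightarrow> tuple C (Fst C A A') (Snd C A A')
    = Idn C (Times C A A')"
  by (rule into_Times_eqI[of _ _ A A']) simp_all

lemma cross_tuple:
  assumes "f \<in> Arr C" "g \<in> Arr C" "x \<in> Arr C" "y \<in> Arr C" "Dom C x = Dom C y" "Cod C x = Dom C f"
      "Cod C y = Dom C g"
  shows "cross C f g \<cdot> tuple C x y = tuple C (f \<cdot> x) (g \<cdot> y)"
  using assms by (simp add: cross_def)

lemma assoc_isomorphism:
  assumes "A \<in> Obj C" "A' \<in> Obj C" "A'' \<in> Obj C"
  shows "isomorphism C (prod_assoc C A A' A'')"
proof (rule isomorphismI)
  let ?p = "Fst C A (Times C A' A'')" and ?q = "Snd C A (Times C A' A'')"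
  let ?g = "tuple C (tuple C ?p (Fst C A' A'' \<cdot> ?q)) (Snd C A' A'' \<cdot> ?q)"
  \<comment> \<open>Surjective pairing: it collapses the tuples of projections that remain after
    composing.\<close>
  have *: "tuple C (Fst C X Y \<cdot> h) (Snd C X Y \<cdot> h) = h"
    if "X \<in> Obj C" "Y \<in> Obj C" "h \<in> Arr C" "Cod C h = Times C X Y" for X Y h
    using that tuple_comp[of "Fst C X Y" "Snd C X Y" h] by (simp add: tuple_eta del: tuple_comp)
  show "?g \<cdot> prod_assoc C A A' A'' = Idn C (Dom C (prod_assoc C A A' A''))"
    using assms by (simp add: prod_assoc_def comp_reassoc * tuple_eta)
  show "prod_assoc C A A' A'' \<cdot> ?g = Idn C (Cod C (prod_assoc C A A' A''))"
    using assms by (simp add: prod_assoc_def comp_reassoc * tuple_eta)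
qed (use assms in \<open>simp_all add: prod_assoc_def\<close>)

end

section \<open>Abelian group objects of a preadditive category with finite products\<close>

locale preadditive_cartesian = cartesian_category C + preadditive_category C add zero
  for C :: "('o, 'a, 'm) cart_cat_scheme" (structure) and add zero
begin

abbreviation hom_grp :: "'o \<Rightarrow> 'o \<Rightarrow> 'a monoid" where
  "hom_grp A A' \<equiv> \<lparr>carrier = Hom C A A', monoid.mult = add, one = zero A A'\<rparr>"

lemma add_simps [simp]:
  assumes "f \<in> Arr C" "g \<in> Arr C" "Dom C f = Dom C g" "Cod C f = Cod C g"
  shows "add f g \<in> Arr C" "Dom C (add f g) = Dom C f" "Cod C (add f g) = Cod C f"
proof -
  interpret G: comm_group "hom_grp (Dom C f) (Cod C f)"
    using assms by (simp add: hom_group)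
  show "add f g \<in> Arr C" "Dom C (add f g) = Dom C f" "Cod C (add f g) = Cod C f"
    using G.m_closed[of f g] assms by (simp_all add: Hom_iff)
qed

lemma zero_simps [simp]:
  assumes "A \<in> Obj C" "A' \<in> Obj C"
  shows "zero A A' \<in> Arr C" "Dom C (zero A A') = A" "Cod C (zero A A') = A'"
proof -
  interpret G: comm_group "hom_grp A A'"
    using assms by (simp add: hom_group)
  show "zero A A' \<in> Arr C" "Dom C (zero A A') = A" "Cod C (zero A A') = A'"
    using G.one_closed by (simp_all add: Hom_iff)
qed

lemma add_zero [simp]:
  assumes "f \<in> Arr C" "Dom C f = A" "Cod C f = A'"
  shows "add (zero A A') f = f" "add f (zero A A') = f"
proof -
  interpret G: comm_group "hom_grp A A'"
    using assms by (auto simp: hom_group)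
  show "add (zero A A') f = f" "add f (zero A A') = f"
    using G.l_one[of f] G.r_one[of f] assms by (simp_all add: Hom_iff)
qed

lemma add_assoc:
  assumes "f \<in> Arr C" "g \<in> Arr C" "h \<in> Arr C" "Dom C f = Dom C h" "Dom C g = Dom C h"
      "Cod C f = Cod C h" "Cod C g = Cod C h"
  shows "add (add f g) h = add f (add g h)"
proof -
  interpret G: comm_group "hom_grp (Dom C h) (Cod C h)"
    using assms by (auto simp: hom_group)
  show ?thesis
    using G.m_assoc[of f g h] assms by (simp add: Hom_iff)
qed

lemma add_commute:
  assumes "f \<in> Arr C" "g \<in> Arr C" "Dom C f = Dom C g" "Cod C f = Cod C g"
  shows "add f g = add g f"
proof -
  interpret G: comm_group "hom_grp (Dom C g) (Cod C g)"
    using assms by (auto simp: hom_group)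
  show ?thesis
    using G.m_comm[of f g] assms by (simp add: Hom_iff)
qed

lemma neg_exists:
  assumes "f \<in> Arr C"
  obtains g where "g \<in> Arr C" "Dom C g = Dom C f" "Cod C g = Cod C f"
    "add f g = zero (Dom C f) (Cod C f)" "add g f = zero (Dom C f) (Cod C f)"
proof -
  interpret G: comm_group "hom_grp (Dom C f) (Cod C f)"
    using assms by (auto simp: hom_group)
  show thesis
    using G.r_inv_ex[of f] G.l_inv_ex[of f] that assms add_commute by (auto simp: Hom_iff)
qed

lemma comp_add_distrib:
  assumes "f \<in> Arr C" "g \<in> Arr C" "h \<in> Arr C" "Dom C f = Dom C g" "Cod C f = Cod C g"
  shows "Cod C h = Dom C f \<Longrightarrow> add f g \<cdot> h = add (f \<cdot> h) (g \<cdot> h)"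
    and "Dom C h = Cod C f \<Longrightarrow> h \<cdot> add f g = add (h \<cdot> f) (h \<cdot> g)"
  using comp_add_left[of h _ _ f _ g] comp_add_right[of f _ _ g h] assms by (auto simp: Hom_iff)

lemma add_self_zero:
  assumes "f \<in> Arr C" "add f f = f"
  shows "f = zero (Dom C f) (Cod C f)"
proof -
  interpret G: comm_group "hom_grp (Dom C f) (Cod C f)"
    using assms by (auto simp: hom_group)
  show ?thesis
    using G.l_cancel_one[of f f] assms by (simp add: Hom_iff)
qed

text \<open>By distributivity the composite equals its own double, and in a group only the neutral
  element does.\<close>

lemma comp_zero [simp]:
  assumes "h \<in> Arr C" "A \<in> Obj C" "A' \<in> Obj C"
  shows "Cod C h = A \<Longrightarrow> zero A A' \<cdot> h = zero (Dom C h) A'"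
    and "Dom C h = A' \<Longrightarrow> h \<cdot> zero A A' = zero A (Cod C h)"
proof -
  show "zero A A' \<cdot> h = zero (Dom C h) A'" if "Cod C h = A"
    using add_self_zero[of "zero A A' \<cdot> h"] comp_add_distrib(1)[of "zero A A'" "zero A A'" h]
        assms that
    by simp
  show "h \<cdot> zero A A' = zero A (Cod C h)" if "Dom C h = A'"
    using add_self_zero[of "h \<cdot> zero A A'"] comp_add_distrib(2)[of "zero A A'" "zero A A'" h]
        assms that
    by simp
qed

text \<open>Composition with the projections preserves sums, so both sides have the components
  \<open>f\<close> and \<open>g\<close>.\<close>

lemma tuple_eq_add:
  assumes "f \<in> Arr C" "g \<in> Arr C" "Dom C f = D" "Dom C g = D" "Cod C f = A" "Cod C g = A'"
  shows "tuple C f g = add (tuple C f (zero D A')) (tuple C (zero D A) g)"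
  by (rule into_Times_eqI[of _ _ A A']) (use assms in \<open>auto simp: comp_add_distrib\<close>)

text \<open>The identity of a terminal object is its zero endomorphism, and \<open>e\<close> factors
  through it.\<close>

lemma from_One_eq_zero:
  assumes "e \<in> Arr C" "Dom C e = One C"
  shows "e = zero (One C) (Cod C e)"
proof -
  have "Idn C (One C) = zero (One C) (One C)"
    by (rule into_One_eqI) simp_all
  then have "e = e \<cdot> zero (One C) (One C)"
    using assms comp_id_right[of e] by metis
  with assms show ?thesis by simp
qed

text \<open>Every unital multiplication is addition: \<open>m = m \<circ> (\<langle>\<pi>\<^sub>1, 0\<rangle> + \<langle>0, \<pi>\<^sub>2\<rangle>)\<close>.\<close>

lemma unital_mult_eq_add:
  assumes A: "A \<in> Obj C" and m: "m \<in> Hom C (Times C A A) A" and e: "e \<in> Hom C (One C) A"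
    and l: "m \<cdot> cross C e (Idn C A) = Snd C (One C) A"
    and r: "m \<cdot> cross C (Idn C A) e = Fst C A (One C)"
  shows "m = add (Fst C A A) (Snd C A A)"
proof -
  let ?p = "Fst C A A" and ?q = "Snd C A A" and ?D = "Times C A A"
  have e0: "e = zero (One C) A"
    using from_One_eq_zero[of e] e by (simp add: Hom_iff)
  \<comment> \<open>The left unit law is evaluated at the pair of \<open>bang C ?D\<close> and
    \<open>?q\<close>; since \<open>e\<close> is zero, the first entry becomes the zero arrow. The
    right unit law is used symmetrically.\<close>
  have "m \<cdot> tuple C (zero ?D A) ?q = ?q"
    using arg_cong[OF l, of "\<lambda>h. h \<cdot> tuple C (bang C ?D) ?q"] A m
        by (simp add: cross_tuple Hom_iff e0 cross_def)
  moreover have "m \<cdot> tuple C ?p (zero ?D A) = ?p"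
    using arg_cong[OF r, of "\<lambda>h. h \<cdot> tuple C ?p (bang C ?D)"] A m
        by (simp add: cross_tuple Hom_iff e0 cross_def)
  moreover have "m = m \<cdot> tuple C ?p ?q"
    using A m by (simp add: tuple_eta Hom_iff)
  ultimately show ?thesis
    using tuple_eq_add[of ?p ?q ?D A A] A m by (simp add: comp_add_distrib Hom_iff)
qed

lemma abelian_group_object_add:
  assumes "A \<in> Obj C"
  shows "\<exists>i. abelian_group_object C A (add (Fst C A A) (Snd C A A)) (zero (One C) A) i"
proof -
  \<comment> \<open>The inversion is the additive inverse of the identity.\<close>
  obtain i where i: "i \<in> Arr C" "Dom C i = A" "Cod C i = A" "add (Idn C A) i = zero A A"
      "add i (Idn C A) = zero A A"
    using neg_exists[of "Idn C A"] assms by auto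
  then have "abelian_group_object C A (add (Fst C A A) (Snd C A A)) (zero (One C) A) i"
    using assms
    by (simp add: abelian_group_object_def Hom_iff comp_add_distrib cross_def prod_assoc_def
        prod_swap_def
        add_assoc add_commute[of "Snd C A A" "Fst C A A"])
  then show ?thesis ..
qed

lemma group_mult_eq:
  assumes "A \<in> Obj C"
  shows "group_mult C A = add (Fst C A A) (Snd C A A)"
  unfolding group_mult_def
proof (rule the_equality)
  show "\<exists>e i. abelian_group_object C A (add (Fst C A A) (Snd C A A)) e i"
    using abelian_group_object_add[OF assms] by blast
  show "m = add (Fst C A A) (Snd C A A)" if "\<exists>e i. abelian_group_object C A m e i" for m
    using that unital_mult_eq_add[OF assms] unfolding abelian_group_object_def by blast
qed

lemma group_unit_eq:
  assumes "A \<in> Obj C"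
  shows "group_unit C A = zero (One C) A"
  unfolding group_unit_def
proof (rule the_equality)
  show "\<exists>m i. abelian_group_object C A m (zero (One C) A) i"
    using abelian_group_object_add[OF assms] by blast
  show "e = zero (One C) A" if "\<exists>m i. abelian_group_object C A m e i" for e
  proof -
    have "e \<in> Arr C" "Dom C e = One C" "Cod C e = A"
      using that by (auto simp: abelian_group_object_def Hom_iff)
    then show ?thesis using from_One_eq_zero[of e] by metis
  qed
qed

lemma group_mult_simps [simp]:
  assumes "A \<in> Obj C"
  shows "group_mult C A \<in> Arr C" "Dom C (group_mult C A) = Times C A A" "Cod C (group_mult C A) = A"
    "group_unit C A \<in> Arr C" "Dom C (group_unit C A) = One C" "Cod C (group_unit C A) = A"
  using assms by (simp_all add: group_mult_eq group_unit_eq)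

text \<open>This computes projections to the base: an element of a tensor product given by two
  elements lies over the sum of their projections.\<close>

lemma group_mult_tuple:
  assumes "x \<in> Arr C" "y \<in> Arr C" "Dom C x = Dom C y" "Cod C x = A" "Cod C y = A"
  shows "group_mult C A \<cdot> tuple C x y = add x y"
proof -
  have "A \<in> Obj C" using assms(1,4) by auto
  with assms show ?thesis by (simp add: group_mult_eq comp_add_distrib)
qed

end

section \<open>Cocartesian arrows and fibres\<close>

locale additive_opfibration =
  cartesian_monoidal_opfibration Q + B: preadditive_cartesian "Base Q" add zero
  for Q :: "('x, 'g, 'b, 'f) opfib" and add zero
begin

abbreviation "T \<equiv> Total Q"
abbreviation "B \<equiv> Base Q"
abbreviation comp_total (infixr "\<bullet>" 70) where "g \<bullet> f \<equiv> g \<cdot>\<^bsub>T\<^esub> f"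

lemma proj_simps [simp]:
  "X \<in> Obj T \<Longrightarrow> pobj Q X \<in> Obj B"
  "u \<in> Arr T \<Longrightarrow> parr Q u \<in> Arr B"
  "u \<in> Arr T \<Longrightarrow> Dom B (parr Q u) = pobj Q (Dom T u)"
  "u \<in> Arr T \<Longrightarrow> Cod B (parr Q u) = pobj Q (Cod T u)"
  "X \<in> Obj T \<Longrightarrow> parr Q (Idn T X) = Idn B (pobj Q X)"
  "\<lbrakk>u \<in> Arr T; v \<in> Arr T; Cod T u = Dom T v\<rbrakk> \<Longrightarrow> parr Q (v \<bullet> u) = parr Q v \<cdot>\<^bsub>B\<^esub> parr Q u"
  using proj.map_obj[of X] proj.arr_simps[of u] proj.map_id[of X] proj.comp_map[of u v]
  by (simp_all add: proj_src proj_tgt)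

declare pres_one [simp] pres_times [simp] pres_fst [simp] pres_snd [simp]

text \<open>The projections are preserved strictly, so the universal property of the product in the
  base identifies the image of a tuple.\<close>

lemma parr_tuple [simp]:
  assumes "f \<in> Arr T" "g \<in> Arr T" "Dom T f = Dom T g"
  shows "parr Q (tuple T f g) = tuple B (parr Q f) (parr Q g)"
proof -
  let ?X = "Cod T f" and ?Y = "Cod T g" and ?t = "tuple T f g"
  have "parr Q (Fst T ?X ?Y) \<cdot>\<^bsub>B\<^esub> parr Q ?t = parr Q f" "parr Q (Snd T ?X ?Y) \<cdot>\<^bsub>B\<^esub> parr Q ?t = parr Q g"
    using assms by (simp_all del: pres_fst pres_snd flip: proj_simps(6))
  then show ?thesis
    using assms by (intro base.into_Times_eqI[of "parr Q ?t" _ "pobj Q ?X" "pobj Q ?Y"]) simp_all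
qed

section \<open>Cocartesian arrows: cancellation, composition, isomorphisms\<close>

lemma cocartesian_arr: "cocartesian Q k \<Longrightarrow> k \<in> Arr T"
  by (simp add: cocartesian_def)

lemma cocartesian_factor:
  assumes "cocartesian Q k" "h \<in> Arr T" "Dom T h = Dom T k" "w \<in> Arr B"
    and "Dom B w = pobj Q (Cod T k)" "Cod B w = pobj Q (Cod T h)" "w \<cdot>\<^bsub>B\<^esub> parr Q k = parr Q h"
  shows "\<exists>!u. u \<in> Arr T \<and> Dom T u = Cod T k \<and> Cod T u = Cod T h \<and> parr Q u = w \<and> u \<bullet> k = h"
  using assms by (auto simp: cocartesian_def Hom_iff)

text \<open>Uniqueness of factorisations. The coherence laws below are checked in this way, after
  precomposition with one cocartesian arrow.\<close>

lemma cocartesian_cancel: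
  assumes "cocartesian Q k" "u \<in> Arr T" "v \<in> Arr T" "Dom T u = Cod T k" "Dom T v = Cod T k"
    and "Cod T u = Cod T v" "parr Q u = parr Q v" "u \<bullet> k = v \<bullet> k"
  shows "u = v"
  using cocartesian_factor[OF assms(1), of "v \<bullet> k" "parr Q v"] assms cocartesian_arr[OF assms(1)]
      by auto

lemma cocartesian_comp:
  assumes k: "cocartesian Q k" and l: "cocartesian Q l" and kl: "Cod T k = Dom T l"
  shows "cocartesian Q (l \<bullet> k)"
  unfolding cocartesian_def
proof (intro conjI ballI impI)
  note [simp] = cocartesian_arr[OF k] cocartesian_arr[OF l] kl
  show "l \<bullet> k \<in> Arr T" by simp
  fix h w
  assume h: "h \<in> Arr T" and w: "w \<in> Hom B (pobj Q (Cod T (l \<bullet> k))) (pobj Q (Cod T h))"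
    and eq: "Dom T h = Dom T (l \<bullet> k) \<and> w \<cdot>\<^bsub>B\<^esub> parr Q (l \<bullet> k) = parr Q h"
  \<comment> \<open>The factorisation is made in two stages: through \<open>k\<close>, over the
    composite of \<open>w\<close> with the projection of \<open>l\<close>, and then through
    \<open>l\<close>, over \<open>w\<close>.\<close>
  obtain v where v: "v \<in> Arr T" "Dom T v = Cod T k" "Cod T v = Cod T h" "parr Q v = w \<cdot>\<^bsub>B\<^esub> parr Q l"
      "v \<bullet> k = h"
    using cocartesian_factor[OF k, of h "w \<cdot>\<^bsub>B\<^esub> parr Q l"] h w eq by (auto simp: Hom_iff)
  obtain u where u: "u \<in> Arr T" "Dom T u = Cod T l" "Cod T u = Cod T v" "parr Q u = w" "u \<bullet> l = v"
    using cocartesian_factor[OF l, of v w] h w v by (auto simp: Hom_iff)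
  show "\<exists>!u. u \<in> Hom T (Cod T (l \<bullet> k)) (Cod T h) \<and> parr Q u = w \<and> u \<bullet> l \<bullet> k = h"
  proof (rule ex1I[of _ u])
    show "u \<in> Hom T (Cod T (l \<bullet> k)) (Cod T h) \<and> parr Q u = w \<and> u \<bullet> l \<bullet> k = h"
      using u v total.comp_reassoc[OF u(5), of k] by (simp add: Hom_iff)
    fix u' assume u': "u' \<in> Hom T (Cod T (l \<bullet> k)) (Cod T h) \<and> parr Q u' = w \<and> u' \<bullet> l \<bullet> k = h"
    have "u' \<bullet> l = v"
      by (rule cocartesian_cancel[OF k]) (use u' v in \<open>simp_all add: Hom_iff\<close>)
    show "u' = u"
      by (rule cocartesian_cancel[OF l]) (use u u' v \<open>u' \<bullet> l = v\<close> in \<open>simp_all add: Hom_iff\<close>)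
  qed
qed

lemma cocartesian_iso:
  assumes "isomorphism T k"
  shows "cocartesian Q k"
proof -
  obtain g where k: "k \<in> Arr T" "g \<in> Arr T" "Dom T g = Cod T k" "Cod T g = Dom T k"
    and gk: "g \<bullet> k = Idn T (Dom T k)" and kg: "k \<bullet> g = Idn T (Cod T k)"
    using assms by (rule isomorphismE)
  have pkg: "parr Q k \<cdot>\<^bsub>B\<^esub> parr Q g = Idn B (pobj Q (Cod T k))"
    using arg_cong[OF kg, of "parr Q"] k by simp
  show ?thesis
    unfolding cocartesian_def
  proof (intro conjI ballI impI)
    fix h w
    assume h: "h \<in> Arr T" and w: "w \<in> Hom B (pobj Q (Cod T k)) (pobj Q (Cod T h))"
      and eq: "Dom T h = Dom T k \<and> w \<cdot>\<^bsub>B\<^esub> parr Q k = parr Q h"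
    show "\<exists>!u. u \<in> Hom T (Cod T k) (Cod T h) \<and> parr Q u = w \<and> u \<bullet> k = h"
    proof (rule ex1I[of _ "h \<bullet> g"])
      have "parr Q (h \<bullet> g) = (w \<cdot>\<^bsub>B\<^esub> parr Q k) \<cdot>\<^bsub>B\<^esub> parr Q g"
        using h k eq by simp
      also have "\<dots> = w"
        using k w pkg by (simp add: Hom_iff)
      finally show "h \<bullet> g \<in> Hom T (Cod T k) (Cod T h) \<and> parr Q (h \<bullet> g) = w \<and> (h \<bullet> g) \<bullet> k = h"
        using h k eq gk by (simp add: Hom_iff)
      fix u assume "u \<in> Hom T (Cod T k) (Cod T h) \<and> parr Q u = w \<and> u \<bullet> k = h"
      then have "u \<in> Arr T" "Dom T u = Cod T k" "h = u \<bullet> k" by (auto simp: Hom_iff)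
      then show "u = h \<bullet> g"
        using k kg by simp
    qed
  qed (use k in simp)
qed

lemma cocartesian_Idn: "X \<in> Obj T \<Longrightarrow> cocartesian Q (Idn T X)"
  by (rule cocartesian_iso, rule isomorphismI[where g = "Idn T X"]) simp_all

section \<open>Fibres and vertical factorisations\<close>

lemma fibre_simps [simp]:
  "X \<in> Obj (fibre Q A) \<longleftrightarrow> X \<in> Obj T \<and> pobj Q X = A"
  "Dom (fibre Q A) = Dom T" "Cod (fibre Q A) = Cod T" "Idn (fibre Q A) = Idn T"
      "Cmp (fibre Q A) = Cmp T"
  by (simp_all add: fibre_def)

lemma vertical_cod: "\<lbrakk>u \<in> Arr T; parr Q u = Idn B A; A \<in> Obj B\<rbrakk> \<Longrightarrow> pobj Q (Cod T u) = A"
  by (metis proj_simps(4) base.id_simps(3))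

lemma fibre_arr [simp]:
  assumes "A \<in> Obj B"
  shows "u \<in> Arr (fibre Q A) \<longleftrightarrow>
    u \<in> Arr T \<and> pobj Q (Dom T u) = A \<and> pobj Q (Cod T u) = A \<and> parr Q u = Idn B A"
  using assms vertical_cod[of u A] by (auto simp: fibre_def)

lemma category_fibre:
  assumes "A \<in> Obj B"
  shows "category (fibre Q A)"
  by (rule categoryI) (use assms in auto)

text \<open>This is the universal property of \<open>k\<close> at an identity of the base. Equal
  projections put the codomains of \<open>k\<close> and \<open>h\<close> into one fibre and make the
  description \<open>vfactor\<close> proper.\<close>

lemma vfactor_simps:
  assumes k: "cocartesian Q k" and h: "h \<in> Arr T" "Dom T h = Dom T k" "parr Q h = parr Q k"
  shows "vfactor Q k h \<in> Arr T" "Dom T (vfactor Q k h) = Cod T k" "Cod T (vfactor Q k h) = Cod T h"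
    "parr Q (vfactor Q k h) = Idn B (pobj Q (Cod T k))" "vfactor Q k h \<bullet> k = h"
proof -
  let ?A = "pobj Q (Cod T k)"
  note [simp] = cocartesian_arr[OF k]
  have cod: "pobj Q (Cod T h) = ?A"
    using h cocartesian_arr[OF k] by (metis proj_simps(4))
  have "\<exists>!u. u \<in> Arr T \<and> Dom T u = Cod T k \<and> Cod T u = Cod T h \<and> parr Q u = Idn B ?A \<and> u \<bullet> k = h"
    by (rule cocartesian_factor[OF k]) (use h cod in simp_all)
  \<comment> \<open>Between these two objects the arrows of the fibre are exactly the arrows over
    the identity, so the two uniqueness statements coincide.\<close>
  then have "\<exists>!u. u \<in> Hom (fibre Q ?A) (Cod T k) (Cod T h) \<and> u \<bullet> k = h"
    by (rule back_subst[of Ex1]) (auto simp: Hom_iff cod fun_eq_iff vertical_cod)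
  from theI'[OF this] show "vfactor Q k h \<in> Arr T" "Dom T (vfactor Q k h) = Cod T k"
    "Cod T (vfactor Q k h) = Cod T h" "parr Q (vfactor Q k h) = Idn B ?A" "vfactor Q k h \<bullet> k = h"
    by (auto simp: vfactor_def Hom_iff)
qed

text \<open>The factorisations of \<open>h\<close> through \<open>k\<close> and of \<open>k\<close>
  through \<open>h\<close> are mutually inverse, by cancelling \<open>k\<close> and
  \<open>h\<close>.\<close>

lemma vfactor_iso:
  assumes k: "cocartesian Q k" and h: "cocartesian Q h" "Dom T h = Dom T k" "parr Q h = parr Q k"
    and A: "pobj Q (Cod T k) = A"
  shows "isomorphism (fibre Q A) (vfactor Q k h)"
proof -
  note [simp] = cocartesian_arr[OF k] cocartesian_arr[OF h(1)]
  have A': "pobj Q (Cod T h) = A" "A \<in> Obj B"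
    using h A \<open>h \<in> Arr T\<close> \<open>k \<in> Arr T\<close>
        by (metis proj_simps(4), metis proj_simps(1) total.obj_simps(2))
  have kh: "h \<in> Arr T" "k \<in> Arr T" "Dom T k = Dom T h" "parr Q k = parr Q h" using h by simp_all
  note u = vfactor_simps[OF k kh(1) h(2,3)] and v = vfactor_simps[OF h(1) kh(2-4)]
  show ?thesis
  proof (rule isomorphismI[where g = "vfactor Q h k"])
    have "vfactor Q h k \<bullet> vfactor Q k h = Idn T (Cod T k)"
      by (rule cocartesian_cancel[OF k]) (use u v A A' in simp_all)
    then show "vfactor Q h k \<cdot>\<^bsub>fibre Q A\<^esub> vfactor Q k h
        = Idn (fibre Q A) (Dom (fibre Q A) (vfactor Q k h))"
      using u by simp
    have "vfactor Q k h \<bullet> vfactor Q h k = Idn T (Cod T h)"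
      by (rule cocartesian_cancel[OF h(1)]) (use u v A A' in simp_all)
    then show "vfactor Q k h \<cdot>\<^bsub>fibre Q A\<^esub> vfactor Q h k
        = Idn (fibre Q A) (Cod (fibre Q A) (vfactor Q k h))"
      using u by simp
  qed (use u v A A' in simp_all)
qed

section \<open>Change of base\<close>

lemma push_simps [simp]:
  "Src (push Q f) = fibre Q (Dom B f)" "Tgt (push Q f) = fibre Q (Cod B f)"
  by (simp_all add: push_def)

lemma cleav_simps [simp]:
  assumes "f \<in> Arr B" "X \<in> Obj T" "pobj Q X = Dom B f"
  shows "cocartesian Q (Cleav Q f X)" "Cleav Q f X \<in> Arr T" "Dom T (Cleav Q f X) = X"
    "parr Q (Cleav Q f X) = f" "Cod T (Cleav Q f X) = ObF (push Q f) X"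
    "ObF (push Q f) X \<in> Obj T" "pobj Q (ObF (push Q f) X) = Cod B f"
proof -
  show *: "cocartesian Q (Cleav Q f X)" "Cleav Q f X \<in> Arr T" "Dom T (Cleav Q f X) = X"
    "parr Q (Cleav Q f X) = f" "Cod T (Cleav Q f X) = ObF (push Q f) X"
    using cleav_dom[OF assms] cleav_over[OF assms] cleav_cocartesian[OF assms] assms
    by (simp_all add: push_def)
  show "ObF (push Q f) X \<in> Obj T" "pobj Q (ObF (push Q f) X) = Cod B f"
    using * by (metis total.obj_simps(2), metis proj_simps(4))
qed

text \<open>The last two facts are the square that determines \<open>f\<^sub>*\<close> on arrows,
  alone and inside a right-nested composite.\<close>

lemma push_arr_simps [simp]:
  assumes f: "f \<in> Arr B" and u: "u \<in> Arr T" "pobj Q (Dom T u) = Dom B f"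
      "pobj Q (Cod T u) = Dom B f"
    "parr Q u = Idn B (Dom B f)"
  shows "ArF (push Q f) u \<in> Arr T" "Dom T (ArF (push Q f) u) = ObF (push Q f) (Dom T u)"
    "Cod T (ArF (push Q f) u) = ObF (push Q f) (Cod T u)"
    "parr Q (ArF (push Q f) u) = Idn B (Cod B f)"
    "Dom T u = X \<Longrightarrow> ArF (push Q f) u \<bullet> Cleav Q f X = Cleav Q f (Cod T u) \<bullet> u"
    "\<lbrakk>x \<in> Arr T; Cod T x = X; Dom T u = X\<rbrakk> \<Longrightarrow>
      ArF (push Q f) u \<bullet> (Cleav Q f X \<bullet> x) = Cleav Q f (Cod T u) \<bullet> (u \<bullet> x)"
proof -
  have eq: "ArF (push Q f) u = vfactor Q (Cleav Q f (Dom T u)) (Cleav Q f (Cod T u) \<bullet> u)"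
    using assms by (simp add: push_def)
  note v = vfactor_simps[of "Cleav Q f (Dom T u)" "Cleav Q f (Cod T u) \<bullet> u"]
  show a: "ArF (push Q f) u \<in> Arr T" "Dom T (ArF (push Q f) u) = ObF (push Q f) (Dom T u)"
    "Cod T (ArF (push Q f) u) = ObF (push Q f) (Cod T u)"
    "parr Q (ArF (push Q f) u) = Idn B (Cod B f)"
    unfolding eq using assms v by simp_all
  have c: "ArF (push Q f) u \<bullet> Cleav Q f (Dom T u) = Cleav Q f (Cod T u) \<bullet> u"
    unfolding eq by (rule v(5)) (use assms in simp_all)
  then show "Dom T u = X \<Longrightarrow> ArF (push Q f) u \<bullet> Cleav Q f X = Cleav Q f (Cod T u) \<bullet> u"
    by blast
  show "\<lbrakk>x \<in> Arr T; Cod T x = X; Dom T u = X\<rbrakk> \<Longrightarrow>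
      ArF (push Q f) u \<bullet> (Cleav Q f X \<bullet> x) = Cleav Q f (Cod T u) \<bullet> (u \<bullet> x)"
    using total.comp_reassoc[OF c, of x] assms a by auto
qed

text \<open>Identities and composites are preserved because both candidates agree after
  precomposition with the lifting at the domain.\<close>

lemma is_functor_push:
  assumes f: "f \<in> Arr B"
  shows "is_functor (push Q f)"
proof (rule is_functorI)
  fix X assume "X \<in> Obj (Src (push Q f))"
  then have X: "X \<in> Obj T" "pobj Q X = Dom B f" by simp_all
  have "ArF (push Q f) (Idn T X) = Idn T (ObF (push Q f) X)"
    by (rule cocartesian_cancel[of "Cleav Q f X"]) (use f X in simp_all)
  then show "ArF (push Q f) (Idn (Src (push Q f)) X) = Idn (Tgt (push Q f)) (ObF (push Q f) X)"
    by simp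
next
  fix u v assume uv: "u \<in> Arr (Src (push Q f))" "v \<in> Arr (Src (push Q f))"
    "Cod (Src (push Q f)) u = Dom (Src (push Q f)) v"
  have "ArF (push Q f) (v \<bullet> u) = ArF (push Q f) v \<bullet> ArF (push Q f) u"
    by (rule cocartesian_cancel[of "Cleav Q f (Dom T u)"]) (use f uv in simp_all)
  then show "ArF (push Q f) (v \<cdot>\<^bsub>Src (push Q f)\<^esub> u) = ArF (push Q f) v
      \<cdot>\<^bsub>Tgt (push Q f)\<^esub> ArF (push Q f) u"
    by simp
qed (use f in \<open>simp_all add: category_fibre\<close>)

section \<open>The symmetric monoidal structure of a fibre\<close>

lemma cross_arr_simps [simp]:
  assumes "u \<in> Arr T" "v \<in> Arr T"
  shows "cross T u v \<in> Arr T" "Dom T (cross T u v) = Times T (Dom T u) (Dom T v)"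
    "Cod T (cross T u v) = Times T (Cod T u) (Cod T v)"
  using assms by (simp_all add: cross_def)

lemma cross_vertical:
  assumes "u \<in> Arr T" "v \<in> Arr T" "parr Q u = Idn B A" "parr Q v = Idn B A'"
    "pobj Q (Dom T u) = A" "pobj Q (Dom T v) = A'"
  shows "parr Q (cross T u v) = Idn B (Times B A A')"
proof -
  have "A \<in> Obj B" "A' \<in> Obj B" using assms by auto
  then show ?thesis using assms by (simp add: cross_def base.tuple_eta)
qed

lemma is_functor_lax_mult:
  assumes "A \<in> Obj B" "A' \<in> Obj B"
  shows "is_functor (lax_mult Q A A')"
proof -
  interpret AA: category "product_category (fibre Q A) (fibre Q A')"
  proof -
    interpret a: category "fibre Q A" by (rule category_fibre) fact
    interpret a': category "fibre Q A'" by (rule category_fibre) fact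
    show "category (product_category (fibre Q A) (fibre Q A'))"
      by (rule categoryI) (use a.obj_simps a'.obj_simps a.comp_simps a'.comp_simps assms in auto)
  qed
  show ?thesis
    by (rule is_functorI)
      (use assms AA.category_axioms in
          \<open>auto simp: lax_mult_def cross_vertical category_fibre total.tuple_eta
        base.tuple_eta cross_def\<close>)
qed

text \<open>\<open>pair A x y\<close> is the generalised element \<open>D \<rightarrow> X \<times> Y \<rightarrow> X \<otimes> Y\<close> of the tensor product in the
  fibre over \<open>A\<close> that generalised elements \<open>x : D \<rightarrow> X\<close> and \<open>y : D \<rightarrow> Y\<close> determine.\<close>

definition pair :: "'b \<Rightarrow> 'g \<Rightarrow> 'g \<Rightarrow> 'g" where
  "pair A x y = ten_arrow Q A (Cod T x) (Cod T y) \<bullet> tuple T x y"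

abbreviation ten :: "'b \<Rightarrow> 'x \<Rightarrow> 'x \<Rightarrow> 'x" where
  "ten A X Y \<equiv> ObF (fibre_tensor Q A) (X, Y)"

abbreviation tenA :: "'b \<Rightarrow> 'g \<Rightarrow> 'g \<Rightarrow> 'g" where
  "tenA A u v \<equiv> ArF (fibre_tensor Q A) (u, v)"

context
  fixes A assumes A [simp]: "A \<in> Obj B"
begin

lemma ten_arrow_simps [simp]:
  assumes "X \<in> Obj T" "Y \<in> Obj T" "pobj Q X = A" "pobj Q Y = A"
  shows "cocartesian Q (ten_arrow Q A X Y)" "ten_arrow Q A X Y \<in> Arr T"
    "Dom T (ten_arrow Q A X Y) = Times T X Y" "Cod T (ten_arrow Q A X Y) = ten A X Y"
    "parr Q (ten_arrow Q A X Y) = group_mult B A"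
    "ten A X Y \<in> Obj T" "pobj Q (ten A X Y) = A"
proof -
  have "ten A X Y = ObF (push Q (group_mult B A)) (Times T X Y)"
    using assms by (simp add: fibre_tensor_def comp_functor_def lax_mult_def)
  then show "cocartesian Q (ten_arrow Q A X Y)" "ten_arrow Q A X Y \<in> Arr T"
    "Dom T (ten_arrow Q A X Y) = Times T X Y" "Cod T (ten_arrow Q A X Y) = ten A X Y"
    "parr Q (ten_arrow Q A X Y) = group_mult B A"
    "ten A X Y \<in> Obj T" "pobj Q (ten A X Y) = A"
    using assms by (simp_all add: ten_arrow_def)
qed

lemma unit_arrow_simps [simp]:
  "cocartesian Q (unit_arrow Q A)" "unit_arrow Q A \<in> Arr T"
  "Dom T (unit_arrow Q A) = One T" "Cod T (unit_arrow Q A) = fibre_unit Q A"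
  "parr Q (unit_arrow Q A) = zero (One B) A"
  "fibre_unit Q A \<in> Obj T" "pobj Q (fibre_unit Q A) = A"
proof -
  have "fibre_unit Q A = ObF (push Q (group_unit B A)) (One T)"
    by (simp add: fibre_unit_def comp_functor_def lax_unit_def terminal_category_def)
  then show "cocartesian Q (unit_arrow Q A)" "unit_arrow Q A \<in> Arr T"
    "Dom T (unit_arrow Q A) = One T" "Cod T (unit_arrow Q A) = fibre_unit Q A"
    "parr Q (unit_arrow Q A) = zero (One B) A"
    "fibre_unit Q A \<in> Obj T" "pobj Q (fibre_unit Q A) = A"
    by (simp_all add: unit_arrow_def flip: B.group_unit_eq)
qed

lemma pair_simps [simp]:
  assumes "x \<in> Arr T" "y \<in> Arr T" "Dom T x = Dom T y" "pobj Q (Cod T x) = A" "pobj Q (Cod T y) = A"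
  shows "pair A x y \<in> Arr T" "Dom T (pair A x y) = Dom T x"
    "Cod T (pair A x y) = ten A (Cod T x) (Cod T y)"
    "parr Q (pair A x y) = add (parr Q x) (parr Q y)"
    "\<lbrakk>h \<in> Arr T; Cod T h = Dom T x\<rbrakk> \<Longrightarrow> pair A x y \<bullet> h = pair A (x \<bullet> h) (y \<bullet> h)"
  using assms by (simp_all add: pair_def B.group_mult_tuple)

text \<open>An arrow into a product is the tuple of its components, so its composite with
  \<open>X \<times> Y \<rightarrow> X \<otimes> Y\<close> is a value of \<open>pair\<close>.\<close>

lemma ten_arrow_comp:
  assumes "w \<in> Arr T" "Cod T w = Times T X Y" "X \<in> Obj T" "Y \<in> Obj T" "pobj Q X = A" "pobj Q Y = A"
  shows "ten_arrow Q A X Y \<bullet> w = pair A (Fst T X Y \<bullet> w) (Snd T X Y \<bullet> w)"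
proof -
  have "w = tuple T (Fst T X Y \<bullet> w) (Snd T X Y \<bullet> w)"
    using total.tuple_comp[of "Fst T X Y" "Snd T X Y" w] assms
    by (simp add: total.tuple_eta del: total.tuple_comp)
  with assms show ?thesis by (simp add: pair_def)
qed

lemma ten_arrow_eq:
  assumes "X \<in> Obj T" "Y \<in> Obj T" "pobj Q X = A" "pobj Q Y = A"
  shows "ten_arrow Q A X Y = pair A (Fst T X Y) (Snd T X Y)"
  using ten_arrow_comp[of "Idn T (Times T X Y)" X Y] assms by simp

lemma ten_arrow_cross:
  assumes "u \<in> Arr T" "v \<in> Arr T" "pobj Q (Cod T u) = A" "pobj Q (Cod T v) = A"
    "Dom T u = X" "Dom T v = Y" "Cod T u = X'" "Cod T v = Y'"
  shows "ten_arrow Q A X' Y' \<bullet> cross T u v = pair A (u \<bullet> Fst T X Y) (v \<bullet> Snd T X Y)"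
  using assms by (auto simp: cross_def pair_def)

lemma fibre_tensor_simps [simp]:
  "Src (fibre_tensor Q A) = product_category (fibre Q A) (fibre Q A)"
  "Tgt (fibre_tensor Q A) = fibre Q A"
  by (simp_all add: fibre_tensor_def comp_functor_def lax_mult_def)

lemma is_functor_fibre_tensor: "is_functor (fibre_tensor Q A)"
  unfolding fibre_tensor_def
  by (rule is_functor_comp[OF is_functor_lax_mult is_functor_push]) (simp_all add: lax_mult_def)

lemma tenA_simps [simp]:
  assumes "u \<in> Arr T" "pobj Q (Dom T u) = A" "pobj Q (Cod T u) = A" "parr Q u = Idn B A"
    and "v \<in> Arr T" "pobj Q (Dom T v) = A" "pobj Q (Cod T v) = A" "parr Q v = Idn B A"
  shows "tenA A u v \<in> Arr T" "Dom T (tenA A u v) = ten A (Dom T u) (Dom T v)"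
    "Cod T (tenA A u v) = ten A (Cod T u) (Cod T v)" "parr Q (tenA A u v) = Idn B A"
    "\<lbrakk>x \<in> Arr T; y \<in> Arr T; Dom T x = Dom T y; Cod T x = Dom T u; Cod T y = Dom T v\<rbrakk> \<Longrightarrow>
      tenA A u v \<bullet> pair A x y = pair A (u \<bullet> x) (v \<bullet> y)"
proof -
  interpret t: is_functor "fibre_tensor Q A" by (rule is_functor_fibre_tensor)
  show a: "tenA A u v \<in> Arr T" "Dom T (tenA A u v) = ten A (Dom T u) (Dom T v)"
    "Cod T (tenA A u v) = ten A (Cod T u) (Cod T v)" "parr Q (tenA A u v) = Idn B A"
    using t.arr_simps[of "(u, v)"] assms by simp_all
  have "tenA A u v = ArF (push Q (group_mult B A)) (cross T u v)"
    using assms by (simp add: fibre_tensor_def comp_functor_def lax_mult_def)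
  \<comment> \<open>The square for change of base along the multiplication, at the product of
    \<open>u\<close> and \<open>v\<close>, which is vertical by
    \<open>cross_vertical\<close>.\<close>
  then have "tenA A u v \<bullet> ten_arrow Q A (Dom T u) (Dom T v) = ten_arrow Q A (Cod T u) (Cod T v)
      \<bullet> cross T u v"
    using assms by (simp add: ten_arrow_def cross_vertical)
  from total.comp_reassoc[OF this, of "tuple T x y"]
  show "tenA A u v \<bullet> pair A x y = pair A (u \<bullet> x) (v \<bullet> y)"
    if "x \<in> Arr T" "y \<in> Arr T" "Dom T x = Dom T y" "Cod T x = Dom T u" "Cod T y = Dom T v"
    using that assms a by (simp add: total.cross_tuple pair_def)
qed

text \<open>Arrows out of iterated tensor products are determined by their values on the following generic
  elements.\<close>

lemma generic2:
  assumes "cocartesian Q k" "cocartesian Q l" "pobj Q (Cod T k) = A" "pobj Q (Cod T l) = A"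
  obtains x y where "x \<in> Arr T" "y \<in> Arr T" "Dom T x = Dom T y" "Cod T x = Dom T k"
      "Cod T y = Dom T l"
    "cocartesian Q (pair A (k \<bullet> x) (l \<bullet> y))"
proof -
  note [simp] = assms(1,2)[THEN cocartesian_arr]
  \<comment> \<open>Taken at the two projections of the product of the domains, the element is the
    product of \<open>k\<close> and \<open>l\<close> followed by the arrow to the tensor product.
    Here closure of cocartesian arrows under products enters.\<close>
  have "cocartesian Q (ten_arrow Q A (Cod T k) (Cod T l) \<bullet> cross T k l)"
    by (rule cocartesian_comp[OF cross_cocartesian]) (use assms in simp_all)
  moreover have "ten_arrow Q A (Cod T k) (Cod T l) \<bullet> cross T k l
      = pair A (k \<bullet> Fst T (Dom T k) (Dom T l)) (l \<bullet> Snd T (Dom T k) (Dom T l))"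
    by (rule ten_arrow_cross) (use assms in simp_all)
  ultimately show thesis
    by (intro that[of "Fst T (Dom T k) (Dom T l)" "Snd T (Dom T k) (Dom T l)"]) simp_all
qed

text \<open>Obtained by iterating \<open>generic2\<close> on the element just found. The entries are
  built on arbitrary cocartesian arrows, not only identities, since the laws also involve
  \<open>unit_arrow\<close> and the liftings of base arrows.\<close>

lemma generic3:
  assumes "cocartesian Q k" "cocartesian Q l" "cocartesian Q n"
    and "pobj Q (Cod T k) = A" "pobj Q (Cod T l) = A" "pobj Q (Cod T n) = A"
  obtains x y z where "x \<in> Arr T" "y \<in> Arr T" "z \<in> Arr T" "Dom T x = Dom T z" "Dom T y = Dom T z"
    "Cod T x = Dom T k" "Cod T y = Dom T l" "Cod T z = Dom T n"
    "cocartesian Q (pair A (pair A (k \<bullet> x) (l \<bullet> y)) (n \<bullet> z))"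
proof -
  note [simp] = assms(1-3)[THEN cocartesian_arr]
  obtain x y where xy: "x \<in> Arr T" "y \<in> Arr T" "Dom T x = Dom T y" "Cod T x = Dom T k"
      "Cod T y = Dom T l"
    "cocartesian Q (pair A (k \<bullet> x) (l \<bullet> y))"
    using generic2[OF assms(1,2,4,5)] .
  have "pobj Q (Cod T (pair A (k \<bullet> x) (l \<bullet> y))) = A" using xy assms by simp
  from generic2[OF xy(6) assms(3) this assms(6)]
  obtain p z where pz: "p \<in> Arr T" "z \<in> Arr T" "Dom T p = Dom T z"
      "Cod T p = Dom T (pair A (k \<bullet> x) (l \<bullet> y))"
    "Cod T z = Dom T n" "cocartesian Q (pair A (pair A (k \<bullet> x) (l \<bullet> y) \<bullet> p) (n \<bullet> z))" .
  show thesis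
    \<comment> \<open>Restriction along \<open>p\<close> brings all three entries to one common
      domain.\<close>
    by (rule that[of "x \<bullet> p" "y \<bullet> p" z]) (use xy pz assms in simp_all)
qed

lemma generic4:
  assumes "X \<in> Obj T" "Y \<in> Obj T" "Z \<in> Obj T" "W \<in> Obj T"
    and "pobj Q X = A" "pobj Q Y = A" "pobj Q Z = A" "pobj Q W = A"
  obtains x y z w where "x \<in> Arr T" "y \<in> Arr T" "z \<in> Arr T" "w \<in> Arr T"
    "Dom T x = Dom T w" "Dom T y = Dom T w" "Dom T z = Dom T w"
    "Cod T x = X" "Cod T y = Y" "Cod T z = Z" "Cod T w = W"
    "cocartesian Q (pair A (pair A (pair A x y) z) w)"
proof -
  obtain x y z where xyz: "x \<in> Arr T" "y \<in> Arr T" "z \<in> Arr T" "Dom T x = Dom T z"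
      "Dom T y = Dom T z"
    "Cod T x = X" "Cod T y = Y" "Cod T z = Z" "cocartesian Q (pair A (pair A x y) z)"
    using generic3[of "Idn T X" "Idn T Y" "Idn T Z"] assms by (auto simp: cocartesian_Idn)
  obtain p w where pw: "p \<in> Arr T" "w \<in> Arr T" "Dom T p = Dom T w"
      "Cod T p = Dom T (pair A (pair A x y) z)"
    "Cod T w = W" "cocartesian Q (pair A (pair A (pair A x y) z \<bullet> p) w)"
    using generic2[OF xyz(9), of "Idn T W"] xyz assms by (auto simp: cocartesian_Idn)
  show thesis
    by (rule that[of "x \<bullet> p" "y \<bullet> p" "z \<bullet> p" w]) (use xyz pw assms in simp_all)
qed

lemmas generic_obj2 = generic2[OF cocartesian_Idn cocartesian_Idn]
lemmas generic_obj3 = generic3[OF cocartesian_Idn cocartesian_Idn cocartesian_Idn]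

section \<open>The constraints of the fibre evaluated on generalised elements\<close>

lemma fibre_monoidal_simps [simp]:
  "Obj (fibre_monoidal Q A) = Obj (fibre Q A)" "Arr (fibre_monoidal Q A) = Arr (fibre Q A)"
  "Dom (fibre_monoidal Q A) = Dom T" "Cod (fibre_monoidal Q A) = Cod T"
  "Idn (fibre_monoidal Q A) = Idn T" "Cmp (fibre_monoidal Q A) = Cmp T"
  "Ten (fibre_monoidal Q A) = fibre_tensor Q A" "Unt (fibre_monoidal Q A) = fibre_unit Q A"
  "category.truncate (fibre_monoidal Q A) = fibre Q A"
  by (simp_all add: fibre_monoidal_def Let_def category.defs fibre_def)

text \<open>The arrows \<open>k\<close> and \<open>h\<close> are those of the definition, rewritten
  as elements built from the projections \<open>?p\<close>, \<open>?q\<close>, \<open>?r\<close> of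
  the triple product. Both are cocartesian, so \<open>vfactor_iso\<close> gives invertibility. The
  other constraints follow the same pattern.\<close>

lemma Asc_simps [simp]:
  assumes "X \<in> Obj T" "Y \<in> Obj T" "Z \<in> Obj T" "pobj Q X = A" "pobj Q Y = A" "pobj Q Z = A"
  shows "Asc (fibre_monoidal Q A) X Y Z \<in> Arr T"
    "Dom T (Asc (fibre_monoidal Q A) X Y Z) = ten A (ten A X Y) Z"
    "Cod T (Asc (fibre_monoidal Q A) X Y Z) = ten A X (ten A Y Z)"
    "parr Q (Asc (fibre_monoidal Q A) X Y Z) = Idn B A"
    "isomorphism (fibre Q A) (Asc (fibre_monoidal Q A) X Y Z)"
    "\<lbrakk>x \<in> Arr T; y \<in> Arr T; z \<in> Arr T; Dom T x = Dom T z; Dom T y = Dom T z; Cod T x = X; Cod T y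
        = Y; Cod T z = Z\<rbrakk>
      \<Longrightarrow> Asc (fibre_monoidal Q A) X Y Z \<bullet> pair A (pair A x y) z = pair A x (pair A y z)"
proof -
  let ?p = "Fst T X Y \<bullet> Fst T (Times T X Y) Z" and ?q = "Snd T X Y \<bullet> Fst T (Times T X Y) Z"
  let ?r = "Snd T (Times T X Y) Z"
  define k where "k = ten_arrow Q A (ten A X Y) Z \<bullet> cross T (ten_arrow Q A X Y) (Idn T Z)"
  define h where "h = ten_arrow Q A X (ten A Y Z) \<bullet> cross T (Idn T X) (ten_arrow Q A Y Z)
      \<bullet> prod_assoc T X Y Z"
  have k: "k = pair A (pair A ?p ?q) ?r"
    unfolding k_def using assms by (simp add: ten_arrow_cross) (simp add: ten_arrow_comp)
  have h: "h = pair A ?p (pair A ?q ?r)"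
    unfolding h_def using assms by (simp add: ten_arrow_cross prod_assoc_def total.cross_tuple)
        (simp add: pair_def)
  have ck: "cocartesian Q k"
    unfolding k_def
    by (rule cocartesian_comp[OF cross_cocartesian]) (use assms in \<open>simp_all add: cocartesian_Idn\<close>)
  have ch: "cocartesian Q h"
    unfolding h_def
    by (intro cocartesian_comp cross_cocartesian)
      (use assms in \<open>simp_all add: cocartesian_Idn cocartesian_iso total.assoc_isomorphism
          prod_assoc_def[symmetric]\<close>,
        simp_all add: prod_assoc_def)
  have eq: "Asc (fibre_monoidal Q A) X Y Z = vfactor Q k h"
    by (simp add: fibre_monoidal_def Let_def category.defs k_def h_def)
  \<comment> \<open>Associativity of addition puts \<open>h\<close> and \<open>k\<close> over the
    same base arrow.\<close>
  have par: "parr Q h = parr Q k"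
    unfolding k h using assms by (simp add: B.add_assoc)
  have "h \<in> Arr T" "Dom T h = Dom T k" and kA: "pobj Q (Cod T k) = A"
    using assms by (simp_all add: h k)
  note v = vfactor_simps[OF ck this(1,2) par] and i = vfactor_iso[OF ck ch this(2) par this(3)]
  show "Asc (fibre_monoidal Q A) X Y Z \<in> Arr T"
    "Dom T (Asc (fibre_monoidal Q A) X Y Z) = ten A (ten A X Y) Z"
    "Cod T (Asc (fibre_monoidal Q A) X Y Z) = ten A X (ten A Y Z)"
    "parr Q (Asc (fibre_monoidal Q A) X Y Z) = Idn B A"
    "isomorphism (fibre Q A) (Asc (fibre_monoidal Q A) X Y Z)"
    unfolding eq using v(1-4) i kA assms by (simp_all add: h k)
  assume xyz: "x \<in> Arr T" "y \<in> Arr T" "z \<in> Arr T" "Dom T x = Dom T z" "Dom T y = Dom T z"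
      "Cod T x = X" "Cod T y = Y" "Cod T z = Z"
  \<comment> \<open>The equation known for the projections, restricted along the triple formed by
    \<open>x\<close>, \<open>y\<close> and \<open>z\<close>, gives it for arbitrary
    elements.\<close>
  have "vfactor Q k h \<bullet> (k \<bullet> tuple T (tuple T x y) z) = h \<bullet> tuple T (tuple T x y) z"
    by (rule total.comp_reassoc[OF v(5)]) (use v(1,2) xyz assms in \<open>simp_all add: k\<close>)
  then show "Asc (fibre_monoidal Q A) X Y Z \<bullet> pair A (pair A x y) z = pair A x (pair A y z)"
    unfolding eq using xyz assms by (simp add: k h)
qed

lemma LUn_simps [simp]:
  assumes "X \<in> Obj T" "pobj Q X = A"
  shows "LUn (fibre_monoidal Q A) X \<in> Arr T"
      "Dom T (LUn (fibre_monoidal Q A) X) = ten A (fibre_unit Q A) X"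
    "Cod T (LUn (fibre_monoidal Q A) X) = X" "parr Q (LUn (fibre_monoidal Q A) X) = Idn B A"
    "isomorphism (fibre Q A) (LUn (fibre_monoidal Q A) X)"
    "\<lbrakk>b \<in> Arr T; x \<in> Arr T; Dom T b = Dom T x; Cod T b = One T; Cod T x = X\<rbrakk>
      \<Longrightarrow> LUn (fibre_monoidal Q A) X \<bullet> pair A (unit_arrow Q A \<bullet> b) x = x"
proof -
  define k where "k = ten_arrow Q A (fibre_unit Q A) X \<bullet> cross T (unit_arrow Q A) (Idn T X)"
  define h where "h = Snd T (One T) X"
  have k: "k = pair A (unit_arrow Q A \<bullet> Fst T (One T) X) (Snd T (One T) X)"
    unfolding k_def using assms by (simp add: ten_arrow_cross)
  have ck: "cocartesian Q k"
    unfolding k_def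
    by (rule cocartesian_comp[OF cross_cocartesian]) (use assms in \<open>simp_all add: cocartesian_Idn\<close>)
  \<comment> \<open>The projection away from the terminal object is invertible, hence cocartesian;
    this equation and the next verify its inverse.\<close>
  have "tuple T (bang T (Times T (One T) X)) (Snd T (One T) X) = Idn T (Times T (One T) X)"
    using total.tuple_eta[of "One T" X]
        total.into_One_eqI[of "Fst T (One T) X" "bang T (Times T (One T) X)"] assms
    by simp
  moreover have "bang T X \<bullet> Snd T (One T) X = bang T (Times T (One T) X)"
    by (rule total.into_One_eqI) (use assms in simp_all)
  ultimately have ch: "cocartesian Q h"
    unfolding h_def
    by (intro cocartesian_iso isomorphismI[where g = "tuple T (bang T X) (Idn T X)"])
        (use assms in simp_all)
  have eq: "LUn (fibre_monoidal Q A) X = vfactor Q k h"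
    by (simp add: fibre_monoidal_def Let_def category.defs k_def h_def)
  have par: "parr Q h = parr Q k"
    unfolding k h_def using assms by simp
  have "h \<in> Arr T" "Dom T h = Dom T k" and kA: "pobj Q (Cod T k) = A"
    using assms by (simp_all add: h_def k)
  note v = vfactor_simps[OF ck this(1,2) par] and i = vfactor_iso[OF ck ch this(2) par this(3)]
  show "LUn (fibre_monoidal Q A) X \<in> Arr T"
      "Dom T (LUn (fibre_monoidal Q A) X) = ten A (fibre_unit Q A) X"
    "Cod T (LUn (fibre_monoidal Q A) X) = X" "parr Q (LUn (fibre_monoidal Q A) X) = Idn B A"
    "isomorphism (fibre Q A) (LUn (fibre_monoidal Q A) X)"
    unfolding eq using v(1-4) i kA assms by (simp_all add: h_def k)
  assume x: "b \<in> Arr T" "x \<in> Arr T" "Dom T b = Dom T x" "Cod T b = One T" "Cod T x = X"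
  have "vfactor Q k h \<bullet> (k \<bullet> tuple T b x) = h \<bullet> tuple T b x"
    by (rule total.comp_reassoc[OF v(5)]) (use v(1,2) x assms in \<open>simp_all add: k\<close>)
  then show "LUn (fibre_monoidal Q A) X \<bullet> pair A (unit_arrow Q A \<bullet> b) x = x"
    unfolding eq using x assms by (simp add: k h_def)
qed

lemma RUn_simps [simp]:
  assumes "X \<in> Obj T" "pobj Q X = A"
  shows "RUn (fibre_monoidal Q A) X \<in> Arr T"
      "Dom T (RUn (fibre_monoidal Q A) X) = ten A X (fibre_unit Q A)"
    "Cod T (RUn (fibre_monoidal Q A) X) = X" "parr Q (RUn (fibre_monoidal Q A) X) = Idn B A"
    "isomorphism (fibre Q A) (RUn (fibre_monoidal Q A) X)"
    "\<lbrakk>b \<in> Arr T; x \<in> Arr T; Dom T b = Dom T x; Cod T b = One T; Cod T x = X\<rbrakk>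
      \<Longrightarrow> RUn (fibre_monoidal Q A) X \<bullet> pair A x (unit_arrow Q A \<bullet> b) = x"
proof -
  define k where "k = ten_arrow Q A X (fibre_unit Q A) \<bullet> cross T (Idn T X) (unit_arrow Q A)"
  define h where "h = Fst T X (One T)"
  have k: "k = pair A (Fst T X (One T)) (unit_arrow Q A \<bullet> Snd T X (One T))"
    unfolding k_def using assms by (simp add: ten_arrow_cross)
  have ck: "cocartesian Q k"
    unfolding k_def
    by (rule cocartesian_comp[OF cross_cocartesian]) (use assms in \<open>simp_all add: cocartesian_Idn\<close>)
  have "tuple T (Fst T X (One T)) (bang T (Times T X (One T))) = Idn T (Times T X (One T))"
    using total.tuple_eta[of X "One T"]
        total.into_One_eqI[of "Snd T X (One T)" "bang T (Times T X (One T))"] assms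
    by simp
  moreover have "bang T X \<bullet> Fst T X (One T) = bang T (Times T X (One T))"
    by (rule total.into_One_eqI) (use assms in simp_all)
  ultimately have ch: "cocartesian Q h"
    unfolding h_def
    by (intro cocartesian_iso isomorphismI[where g = "tuple T (Idn T X) (bang T X)"])
        (use assms in simp_all)
  have eq: "RUn (fibre_monoidal Q A) X = vfactor Q k h"
    by (simp add: fibre_monoidal_def Let_def category.defs k_def h_def)
  have par: "parr Q h = parr Q k"
    unfolding k h_def using assms by simp
  have "h \<in> Arr T" "Dom T h = Dom T k" and kA: "pobj Q (Cod T k) = A"
    using assms by (simp_all add: h_def k)
  note v = vfactor_simps[OF ck this(1,2) par] and i = vfactor_iso[OF ck ch this(2) par this(3)]
  show "RUn (fibre_monoidal Q A) X \<in> Arr T"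
      "Dom T (RUn (fibre_monoidal Q A) X) = ten A X (fibre_unit Q A)"
    "Cod T (RUn (fibre_monoidal Q A) X) = X" "parr Q (RUn (fibre_monoidal Q A) X) = Idn B A"
    "isomorphism (fibre Q A) (RUn (fibre_monoidal Q A) X)"
    unfolding eq using v(1-4) i kA assms by (simp_all add: h_def k)
  assume x: "b \<in> Arr T" "x \<in> Arr T" "Dom T b = Dom T x" "Cod T b = One T" "Cod T x = X"
  have "vfactor Q k h \<bullet> (k \<bullet> tuple T x b) = h \<bullet> tuple T x b"
    by (rule total.comp_reassoc[OF v(5)]) (use v(1,2) x assms in \<open>simp_all add: k\<close>)
  then show "RUn (fibre_monoidal Q A) X \<bullet> pair A x (unit_arrow Q A \<bullet> b) = x"
    unfolding eq using x assms by (simp add: k h_def)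
qed

text \<open>Commutativity of addition puts the two arrows over the same base arrow. Invertibility is
  left to the symmetry law, which follows by evaluating twice.\<close>

lemma Brd_simps [simp]:
  assumes "X \<in> Obj T" "Y \<in> Obj T" "pobj Q X = A" "pobj Q Y = A"
  shows "Brd (fibre_monoidal Q A) X Y \<in> Arr T" "Dom T (Brd (fibre_monoidal Q A) X Y) = ten A X Y"
    "Cod T (Brd (fibre_monoidal Q A) X Y) = ten A Y X"
        "parr Q (Brd (fibre_monoidal Q A) X Y) = Idn B A"
    "\<lbrakk>x \<in> Arr T; y \<in> Arr T; Dom T x = Dom T y; Cod T x = X; Cod T y = Y\<rbrakk>
      \<Longrightarrow> Brd (fibre_monoidal Q A) X Y \<bullet> pair A x y = pair A y x"
proof -
  define k where "k = ten_arrow Q A X Y"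
  define h where "h = ten_arrow Q A Y X \<bullet> prod_swap T X Y"
  have k: "k = pair A (Fst T X Y) (Snd T X Y)"
    unfolding k_def using assms by (simp add: ten_arrow_eq)
  have h: "h = pair A (Snd T X Y) (Fst T X Y)"
    unfolding h_def prod_swap_def using assms by (simp add: pair_def)
  have ck: "cocartesian Q k"
    unfolding k_def using assms by simp
  have eq: "Brd (fibre_monoidal Q A) X Y = vfactor Q k h"
    by (simp add: fibre_monoidal_def Let_def category.defs k_def h_def)
  have par: "parr Q h = parr Q k"
    unfolding k h using assms by (simp add: B.add_commute)
  have "h \<in> Arr T" "Dom T h = Dom T k" and kA: "pobj Q (Cod T k) = A"
    using assms by (simp_all add: h k)
  note v = vfactor_simps[OF ck this(1,2) par]
  show "Brd (fibre_monoidal Q A) X Y \<in> Arr T" "Dom T (Brd (fibre_monoidal Q A) X Y) = ten A X Y"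
    "Cod T (Brd (fibre_monoidal Q A) X Y) = ten A Y X"
        "parr Q (Brd (fibre_monoidal Q A) X Y) = Idn B A"
    unfolding eq using v(1-4) kA assms by (simp_all add: h k)
  assume x: "x \<in> Arr T" "y \<in> Arr T" "Dom T x = Dom T y" "Cod T x = X" "Cod T y = Y"
  have "vfactor Q k h \<bullet> (k \<bullet> tuple T x y) = h \<bullet> tuple T x y"
    by (rule total.comp_reassoc[OF v(5)]) (use v(1,2) x assms in \<open>simp_all add: k\<close>)
  then show "Brd (fibre_monoidal Q A) X Y \<bullet> pair A x y = pair A y x"
    unfolding eq using x assms by (simp add: k h)
qed

end

text \<open>For every law of arrows a generic element is chosen on which both composites can be
  evaluated; the simplifier reduces them to the same iterated \<open>pair\<close>, and
  \<open>cocartesian_cancel\<close> removes the element.\<close>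

lemma smc_fibre_monoidal:
  assumes A [simp]: "A \<in> Obj B"
  shows "symmetric_monoidal_category (fibre_monoidal Q A)"
proof -
  let ?V = "fibre_monoidal Q A"
  interpret category ?V
    using category_fibre[OF A] category_truncate_iff[of ?V] by simp
  interpret tensor: is_functor "Ten ?V"
    using is_functor_fibre_tensor[OF A] by simp
  have iso: "isomorphism ?V = isomorphism (fibre Q A)"
    using isomorphism_truncate[of ?V] by simp
  note [simp] = cocartesian_Idn
  show ?thesis
  proof (unfold_locales, goal_cases)
    case (11 u X X' v Y Y' w Z Z')
    then have h: "u \<in> Arr T" "v \<in> Arr T" "w \<in> Arr T" "Dom T u = X" "Dom T v = Y" "Dom T w = Z"
      "Cod T u = X'" "Cod T v = Y'" "Cod T w = Z'" "X \<in> Obj T" "Y \<in> Obj T" "Z \<in> Obj T"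
          "X' \<in> Obj T" "Y' \<in> Obj T" "Z' \<in> Obj T"
      "pobj Q X = A" "pobj Q Y = A" "pobj Q Z = A" "pobj Q X' = A" "pobj Q Y' = A" "pobj Q Z' = A"
      "parr Q u = Idn B A" "parr Q v = Idn B A" "parr Q w = Idn B A"
      by (auto simp: Hom_iff)
    obtain x y z where g: "x \<in> Arr T" "y \<in> Arr T" "z \<in> Arr T" "Dom T x = Dom T z"
        "Dom T y = Dom T z"
      "Cod T x = X" "Cod T y = Y" "Cod T z = Z" "cocartesian Q (pair A (pair A x y) z)"
      using generic_obj3[OF A, of X Y Z] h by auto
    show ?case
      unfolding fibre_monoidal_simps[OF A]
      by (rule cocartesian_cancel[of "pair A (pair A x y) z"]) (use h g in simp_all)
  next
    case (12 u X X')
    then have h: "u \<in> Arr T" "Dom T u = X" "Cod T u = X'" "X \<in> Obj T" "X' \<in> Obj T"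
      "pobj Q X = A" "pobj Q X' = A" "parr Q u = Idn B A"
      by (auto simp: Hom_iff)
    \<comment> \<open>The entry for the unit object has the form
      \<open>unit_arrow Q A \<bullet> b\<close>, since \<open>LUn\<close> is evaluated on such
      elements.\<close>
    obtain b x where g: "b \<in> Arr T" "x \<in> Arr T" "Dom T b = Dom T x" "Cod T b = One T" "Cod T x = X"
      "cocartesian Q (pair A (unit_arrow Q A \<bullet> b) x)"
      using generic2[OF A, of "unit_arrow Q A" "Idn T X"] h by auto
    show ?case
      unfolding fibre_monoidal_simps[OF A]
      by (rule cocartesian_cancel[of "pair A (unit_arrow Q A \<bullet> b) x"]) (use h g in simp_all)
  next
    case (13 u X X')
    then have h: "u \<in> Arr T" "Dom T u = X" "Cod T u = X'" "X \<in> Obj T" "X' \<in> Obj T"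
      "pobj Q X = A" "pobj Q X' = A" "parr Q u = Idn B A"
      by (auto simp: Hom_iff)
    obtain x b where g: "x \<in> Arr T" "b \<in> Arr T" "Dom T x = Dom T b" "Cod T x = X" "Cod T b = One T"
      "cocartesian Q (pair A x (unit_arrow Q A \<bullet> b))"
      using generic2[OF A, of "Idn T X" "unit_arrow Q A"] h by auto
    show ?case
      unfolding fibre_monoidal_simps[OF A]
      by (rule cocartesian_cancel[of "pair A x (unit_arrow Q A \<bullet> b)"]) (use h g in simp_all)
  next
    case (14 u X X' v Y Y')
    then have h: "u \<in> Arr T" "v \<in> Arr T" "Dom T u = X" "Dom T v = Y"
      "Cod T u = X'" "Cod T v = Y'" "X \<in> Obj T" "Y \<in> Obj T" "X' \<in> Obj T" "Y' \<in> Obj T"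
      "pobj Q X = A" "pobj Q Y = A" "pobj Q X' = A" "pobj Q Y' = A"
      "parr Q u = Idn B A" "parr Q v = Idn B A"
      by (auto simp: Hom_iff)
    obtain x y where g: "x \<in> Arr T" "y \<in> Arr T" "Dom T x = Dom T y"
      "Cod T x = X" "Cod T y = Y" "cocartesian Q (pair A x y)"
      using generic_obj2[OF A, of X Y] h by auto
    show ?case
      unfolding fibre_monoidal_simps[OF A]
      by (rule cocartesian_cancel[of "pair A x y"]) (use h g in simp_all)
  next
    case (15 W X Y Z)
    then have h: "W \<in> Obj T" "X \<in> Obj T" "Y \<in> Obj T" "Z \<in> Obj T" "pobj Q W = A" "pobj Q X = A"
        "pobj Q Y = A" "pobj Q Z = A"
      by simp_all
    obtain w x y z where g: "w \<in> Arr T" "x \<in> Arr T" "y \<in> Arr T" "z \<in> Arr T"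
      "Dom T w = Dom T z" "Dom T x = Dom T z" "Dom T y = Dom T z"
      "Cod T w = W" "Cod T x = X" "Cod T y = Y" "Cod T z = Z"
      "cocartesian Q (pair A (pair A (pair A w x) y) z)"
      using generic4[OF A h] .
    show ?case
      unfolding fibre_monoidal_simps[OF A]
      by (rule cocartesian_cancel[of "pair A (pair A (pair A w x) y) z"]) (use h g in simp_all)
  next
    case (16 X Y)
    then have h: "X \<in> Obj T" "Y \<in> Obj T" "pobj Q X = A" "pobj Q Y = A"
      by simp_all
    obtain x b y where g: "x \<in> Arr T" "b \<in> Arr T" "y \<in> Arr T" "Dom T x = Dom T y"
        "Dom T b = Dom T y"
      "Cod T x = X" "Cod T b = One T" "Cod T y = Y"
          "cocartesian Q (pair A (pair A x (unit_arrow Q A \<bullet> b)) y)"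
      using generic3[OF A, of "Idn T X" "unit_arrow Q A" "Idn T Y"] h by auto
    show ?case
      unfolding fibre_monoidal_simps[OF A]
      by (rule cocartesian_cancel[of "pair A (pair A x (unit_arrow Q A \<bullet> b)) y"])
          (use h g in simp_all)
  next
    case (17 X Y Z)
    then have h: "X \<in> Obj T" "Y \<in> Obj T" "Z \<in> Obj T" "pobj Q X = A" "pobj Q Y = A" "pobj Q Z = A"
      by simp_all
    obtain x y z where g: "x \<in> Arr T" "y \<in> Arr T" "z \<in> Arr T" "Dom T x = Dom T z"
        "Dom T y = Dom T z"
      "Cod T x = X" "Cod T y = Y" "Cod T z = Z" "cocartesian Q (pair A (pair A x y) z)"
      using generic_obj3[OF A, of X Y Z] h by auto
    show ?case
      unfolding fibre_monoidal_simps[OF A]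
      by (rule cocartesian_cancel[of "pair A (pair A x y) z"]) (use h g in simp_all)
  next
    case (18 X Y)
    then have h: "X \<in> Obj T" "Y \<in> Obj T" "pobj Q X = A" "pobj Q Y = A"
      by simp_all
    obtain x y where g: "x \<in> Arr T" "y \<in> Arr T" "Dom T x = Dom T y"
      "Cod T x = X" "Cod T y = Y" "cocartesian Q (pair A x y)"
      using generic_obj2[OF A, of X Y] h by auto
    show ?case
      unfolding fibre_monoidal_simps[OF A]
      by (rule cocartesian_cancel[of "pair A x y"]) (use h g in simp_all)
  qed (simp_all add: Hom_iff iso)
qed

section \<open>Change of base is symmetric monoidal\<close>

definition push_monoidal :: "'f \<Rightarrow> ('x, 'g) monoidal_fun" where
  "push_monoidal f = (let A = Dom B f; A' = Cod B f; c = Cleav Q f in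
     \<lparr>MSrc = fibre_monoidal Q A, MTgt = fibre_monoidal Q A', MFun = push Q f,
      Mul = (\<lambda>(X, Y) \<in> Obj (fibre_monoidal Q A) \<times> Obj (fibre_monoidal Q A).
        vfactor Q (ten_arrow Q A' (ObF (push Q f) X) (ObF (push Q f) Y) \<bullet> cross T (c X) (c Y))
          (c (ten A X Y) \<bullet> ten_arrow Q A X Y)),
      Uni = vfactor Q (unit_arrow Q A') (c (fibre_unit Q A) \<bullet> unit_arrow Q A)\<rparr>)"

lemma push_monoidal_simps [simp]:
  "MSrc (push_monoidal f) = fibre_monoidal Q (Dom B f)"
      "MTgt (push_monoidal f) = fibre_monoidal Q (Cod B f)"
  "MFun (push_monoidal f) = push Q f"
  by (simp_all add: push_monoidal_def Let_def)

context
  fixes f A A' assumes f [simp]: "f \<in> Arr B" "Dom B f = A" "Cod B f = A'"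
begin

lemma objs [simp]: "A \<in> Obj B" "A' \<in> Obj B"
  using f base.obj_simps by blast+

lemma Mul_simps [simp]:
  assumes "X \<in> Obj T" "Y \<in> Obj T" "pobj Q X = A" "pobj Q Y = A"
  shows "Mul (push_monoidal f) (X, Y) \<in> Arr T"
    "Dom T (Mul (push_monoidal f) (X, Y)) = ten A' (ObF (push Q f) X) (ObF (push Q f) Y)"
    "Cod T (Mul (push_monoidal f) (X, Y)) = ObF (push Q f) (ten A X Y)"
    "parr Q (Mul (push_monoidal f) (X, Y)) = Idn B A'"
    "isomorphism (fibre Q A') (Mul (push_monoidal f) (X, Y))"
    "\<lbrakk>x \<in> Arr T; y \<in> Arr T; Dom T x = Dom T y; Cod T x = X; Cod T y = Y\<rbrakk> \<Longrightarrow>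
      Mul (push_monoidal f) (X, Y) \<bullet> pair A' (Cleav Q f X \<bullet> x) (Cleav Q f Y \<bullet> y)
          = Cleav Q f (ten A X Y) \<bullet> pair A x y"
proof -
  define k where "k = ten_arrow Q A' (ObF (push Q f) X) (ObF (push Q f) Y)
      \<bullet> cross T (Cleav Q f X) (Cleav Q f Y)"
  define h where "h = Cleav Q f (ten A X Y) \<bullet> ten_arrow Q A X Y"
  have k: "k = pair A' (Cleav Q f X \<bullet> Fst T X Y) (Cleav Q f Y \<bullet> Snd T X Y)"
    unfolding k_def using assms by (simp add: ten_arrow_cross)
  have h: "h = Cleav Q f (ten A X Y) \<bullet> pair A (Fst T X Y) (Snd T X Y)"
    unfolding h_def using assms by (simp add: ten_arrow_eq)
  have ck: "cocartesian Q k"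
    unfolding k_def by (rule cocartesian_comp[OF cross_cocartesian]) (use assms in simp_all)
  have ch: "cocartesian Q h"
    unfolding h_def by (rule cocartesian_comp) (use assms in simp_all)
  have eq: "Mul (push_monoidal f) (X, Y) = vfactor Q k h"
    using assms by (simp add: push_monoidal_def Let_def k_def h_def)
  \<comment> \<open>Here \<open>f\<close> is a homomorphism for addition, by distributivity of
    composition.\<close>
  have par: "parr Q h = parr Q k"
    unfolding k h using assms by (simp add: B.comp_add_distrib)
  have "h \<in> Arr T" "Dom T h = Dom T k" and kA: "pobj Q (Cod T k) = A'"
    using assms by (simp_all add: h k)
  note v = vfactor_simps[OF ck this(1,2) par] and i = vfactor_iso[OF ck ch this(2) par this(3)]
  show "Mul (push_monoidal f) (X, Y) \<in> Arr T"
    "Dom T (Mul (push_monoidal f) (X, Y)) = ten A' (ObF (push Q f) X) (ObF (push Q f) Y)"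
    "Cod T (Mul (push_monoidal f) (X, Y)) = ObF (push Q f) (ten A X Y)"
    "parr Q (Mul (push_monoidal f) (X, Y)) = Idn B A'"
    "isomorphism (fibre Q A') (Mul (push_monoidal f) (X, Y))"
    unfolding eq using v(1-4) i kA assms by (simp_all add: h k)
  assume x: "x \<in> Arr T" "y \<in> Arr T" "Dom T x = Dom T y" "Cod T x = X" "Cod T y = Y"
  have "vfactor Q k h \<bullet> (k \<bullet> tuple T x y) = h \<bullet> tuple T x y"
    by (rule total.comp_reassoc[OF v(5)]) (use v(1,2) x assms in \<open>simp_all add: k\<close>)
  then show "Mul (push_monoidal f) (X, Y) \<bullet> pair A' (Cleav Q f X \<bullet> x) (Cleav Q f Y \<bullet> y)
      = Cleav Q f (ten A X Y) \<bullet> pair A x y"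
    unfolding eq using x assms by (simp add: k h)
qed

lemma Uni_simps [simp]:
  "Uni (push_monoidal f) \<in> Arr T" "Dom T (Uni (push_monoidal f)) = fibre_unit Q A'"
  "Cod T (Uni (push_monoidal f)) = ObF (push Q f) (fibre_unit Q A)"
  "parr Q (Uni (push_monoidal f)) = Idn B A'" "isomorphism (fibre Q A') (Uni (push_monoidal f))"
  "Uni (push_monoidal f) \<bullet> unit_arrow Q A' = Cleav Q f (fibre_unit Q A) \<bullet> unit_arrow Q A"
  "\<lbrakk>b \<in> Arr T; Cod T b = One T\<rbrakk> \<Longrightarrow>
    Uni (push_monoidal f) \<bullet> (unit_arrow Q A' \<bullet> b) = Cleav Q f (fibre_unit Q A)
        \<bullet> (unit_arrow Q A \<bullet> b)"
proof -
  let ?k = "unit_arrow Q A'" and ?h = "Cleav Q f (fibre_unit Q A) \<bullet> unit_arrow Q A"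
  have eq: "Uni (push_monoidal f) = vfactor Q ?k ?h"
    by (simp add: push_monoidal_def Let_def)
  have ch: "cocartesian Q ?h"
    by (rule cocartesian_comp) simp_all
  note v = vfactor_simps[of ?k ?h] and i = vfactor_iso[of ?k ?h A', OF _ ch]
  show a: "Uni (push_monoidal f) \<in> Arr T" "Dom T (Uni (push_monoidal f)) = fibre_unit Q A'"
    "Cod T (Uni (push_monoidal f)) = ObF (push Q f) (fibre_unit Q A)"
    "parr Q (Uni (push_monoidal f)) = Idn B A'" "isomorphism (fibre Q A') (Uni (push_monoidal f))"
    and c: "Uni (push_monoidal f) \<bullet> ?k = ?h"
    unfolding eq using v i by simp_all
  show "Uni (push_monoidal f) \<bullet> (?k \<bullet> b) = Cleav Q f (fibre_unit Q A) \<bullet> (unit_arrow Q A \<bullet> b)"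
    if "b \<in> Arr T" "Cod T b = One T"
    using total.comp_reassoc[OF c, of b] a that by simp
qed

text \<open>Generic elements are built on the liftings: \<open>Mul\<close> and the arrows
  \<open>ArF (push Q f) u\<close> can be evaluated on elements
  \<open>Cleav Q f X \<bullet> x\<close>, and \<open>Uni\<close> on elements
  \<open>unit_arrow Q A' \<bullet> b\<close>.\<close>

lemma sym_fun_push: "sym_fun (fibre_monoidal Q A) (fibre_monoidal Q A') (push_monoidal f)"
proof -
  have iso: "isomorphism (fibre_monoidal Q A') = isomorphism (fibre Q A')"
    using isomorphism_truncate[of "fibre_monoidal Q A'"] by simp
  let ?c = "Cleav Q f"
  have "symmetric_monoidal_functor (push_monoidal f)"
  proof (rule symmetric_monoidal_functorI,
      unfold push_monoidal_simps f fibre_monoidal_simps[OF objs(1)]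
      fibre_monoidal_simps[OF objs(2)], goal_cases)
    case 1 show ?case by (simp add: smc_fibre_monoidal)
  next
    case 2 show ?case by (simp add: smc_fibre_monoidal)
  next
    case 3 show ?case by (simp add: is_functor_push)
  next
    case (8 u v)
    let ?X = "Dom T u" and ?Y = "Dom T v"
    obtain x y where g: "x \<in> Arr T" "y \<in> Arr T" "Dom T x = Dom T y" "Cod T x = ?X" "Cod T y = ?Y"
      "cocartesian Q (pair A' (?c ?X \<bullet> x) (?c ?Y \<bullet> y))"
      using generic2[of A' "?c ?X" "?c ?Y"] 8 by auto
    show ?case
      by (rule cocartesian_cancel[of "pair A' (?c ?X \<bullet> x) (?c ?Y \<bullet> y)"]) (use 8 g in simp_all)
  next
    case (9 X Y Z)
    obtain x y z where g: "x \<in> Arr T" "y \<in> Arr T" "z \<in> Arr T" "Dom T x = Dom T z"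
        "Dom T y = Dom T z"
      "Cod T x = X" "Cod T y = Y" "Cod T z = Z"
      "cocartesian Q (pair A' (pair A' (?c X \<bullet> x) (?c Y \<bullet> y)) (?c Z \<bullet> z))"
      using generic3[of A' "?c X" "?c Y" "?c Z"] 9 by auto
    show ?case
      by (rule cocartesian_cancel[of "pair A' (pair A' (?c X \<bullet> x) (?c Y \<bullet> y)) (?c Z \<bullet> z)"])
          (use 9 g in simp_all)
  next
    case (10 X)
    obtain b x where g: "b \<in> Arr T" "x \<in> Arr T" "Dom T b = Dom T x" "Cod T b = One T" "Cod T x = X"
      "cocartesian Q (pair A' (unit_arrow Q A' \<bullet> b) (?c X \<bullet> x))"
      using generic2[of A' "unit_arrow Q A'" "?c X"] 10 by auto
    show ?case
      by (rule cocartesian_cancel[of "pair A' (unit_arrow Q A' \<bullet> b) (?c X \<bullet> x)"])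
          (use 10 g in simp_all)
  next
    case (11 X)
    obtain x b where g: "x \<in> Arr T" "b \<in> Arr T" "Dom T x = Dom T b" "Cod T x = X" "Cod T b = One T"
      "cocartesian Q (pair A' (?c X \<bullet> x) (unit_arrow Q A' \<bullet> b))"
      using generic2[of A' "?c X" "unit_arrow Q A'"] 11 by auto
    show ?case
      by (rule cocartesian_cancel[of "pair A' (?c X \<bullet> x) (unit_arrow Q A' \<bullet> b)"])
          (use 11 g in simp_all)
  next
    case (12 X Y)
    obtain x y where g: "x \<in> Arr T" "y \<in> Arr T" "Dom T x = Dom T y" "Cod T x = X" "Cod T y = Y"
      "cocartesian Q (pair A' (?c X \<bullet> x) (?c Y \<bullet> y))"
      using generic2[of A' "?c X" "?c Y"] 12 by auto
    show ?case
      by (rule cocartesian_cancel[of "pair A' (?c X \<bullet> x) (?c Y \<bullet> y)"]) (use 12 g in simp_all)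
  qed (simp_all add: iso)
  moreover have "monoidal_fun_ext (push_monoidal f)"
    by (simp add: monoidal_fun_ext_def functor_ext_def)
        (simp add: push_def push_monoidal_def Let_def)
  ultimately show ?thesis
    by (simp add: sym_fun_def sym_fun_axioms_def smc_fibre_monoidal)
qed

end

section \<open>The comparison cells\<close>

abbreviation "comp_cell_cat g f \<equiv> PComp (associated_pseudofunctor Q) g f"
abbreviation "unit_cell_cat A \<equiv> PUnit (associated_pseudofunctor Q) A"

lemma associated_simps [simp]:
  "PObj (associated_pseudofunctor Q) = fibre Q" "PArr (associated_pseudofunctor Q) = push Q"
  "NSrc (comp_cell_cat g f) = comp_functor (push Q g) (push Q f)"
  "NTgt (comp_cell_cat g f) = push Q (g \<cdot>\<^bsub>B\<^esub> f)"
  "NSrc (unit_cell_cat A) = id_functor (fibre Q A)" "NTgt (unit_cell_cat A) = push Q (Idn B A)"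
  "\<lbrakk>X \<in> Obj T; pobj Q X = A\<rbrakk> \<Longrightarrow> NCmp (unit_cell_cat A) X = Cleav Q (Idn B A) X"
  by (simp_all add: associated_pseudofunctor_def)

lemma comp_cell_simps [simp]:
  assumes f: "f \<in> Arr B" "g \<in> Arr B" "Cod B f = Dom B g" and X: "X \<in> Obj T" "pobj Q X = Dom B f"
  shows "NCmp (comp_cell_cat g f) X \<in> Arr T"
    "Dom T (NCmp (comp_cell_cat g f) X) = ObF (push Q g) (ObF (push Q f) X)"
    "Cod T (NCmp (comp_cell_cat g f) X) = ObF (push Q (g \<cdot>\<^bsub>B\<^esub> f)) X"
    "parr Q (NCmp (comp_cell_cat g f) X) = Idn B (Cod B g)"
    "NCmp (comp_cell_cat g f) X \<bullet> (Cleav Q g (ObF (push Q f) X) \<bullet> Cleav Q f X) = Cleav Q (g \<cdot>\<^bsub>B\<^esub> f) X"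
    "\<lbrakk>x \<in> Arr T; Cod T x = X\<rbrakk> \<Longrightarrow> NCmp (comp_cell_cat g f) X
        \<bullet> (Cleav Q g (ObF (push Q f) X) \<bullet> (Cleav Q f X \<bullet> x))
      = Cleav Q (g \<cdot>\<^bsub>B\<^esub> f) X \<bullet> x"
proof -
  let ?k = "Cleav Q g (ObF (push Q f) X) \<bullet> Cleav Q f X" and ?h = "Cleav Q (g \<cdot>\<^bsub>B\<^esub> f) X"
  have eq: "NCmp (comp_cell_cat g f) X = vfactor Q ?k ?h"
    using X by (simp add: associated_pseudofunctor_def)
  have ck: "cocartesian Q ?k"
    by (rule cocartesian_comp) (use assms in simp_all)
  note v = vfactor_simps[of ?k ?h, OF ck]
  show a: "NCmp (comp_cell_cat g f) X \<in> Arr T"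
    "Dom T (NCmp (comp_cell_cat g f) X) = ObF (push Q g) (ObF (push Q f) X)"
    "Cod T (NCmp (comp_cell_cat g f) X) = ObF (push Q (g \<cdot>\<^bsub>B\<^esub> f)) X"
    "parr Q (NCmp (comp_cell_cat g f) X) = Idn B (Cod B g)"
    and c: "NCmp (comp_cell_cat g f) X \<bullet> ?k = ?h"
    unfolding eq using v assms by simp_all
  show "NCmp (comp_cell_cat g f) X \<bullet> (Cleav Q g (ObF (push Q f) X) \<bullet> (Cleav Q f X \<bullet> x)) = ?h \<bullet> x"
    if "x \<in> Arr T" "Cod T x = X"
    using total.comp_reassoc[OF c, of x] a that assms by simp
qed

text \<open>The underlying transformation is the comparison cell of \<open>F\<close> itself, so
  forgetting the monoidal structure returns it on the nose.\<close>

definition comp_cell_mon :: "'f \<Rightarrow> 'f \<Rightarrow> ('x, 'g) monoidal_trans" where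
  "comp_cell_mon g f = \<lparr>TSrc = comp_monoidal_fun (push_monoidal g) (push_monoidal f),
     TTgt = push_monoidal (g \<cdot>\<^bsub>B\<^esub> f), TNat = comp_cell_cat g f\<rparr>"

definition unit_cell_mon :: "'b \<Rightarrow> ('x, 'g) monoidal_trans" where
  "unit_cell_mon A = \<lparr>TSrc = id_monoidal_fun (fibre_monoidal Q A), TTgt = push_monoidal (Idn B A),
     TNat = unit_cell_cat A\<rparr>"

lemma sym_trans_comp_cell:
  assumes f: "f \<in> Arr B" "g \<in> Arr B" "Dom B f = A" "Cod B f = A'" "Dom B g = A'" "Cod B g = A''"
  shows "sym_trans (fibre_monoidal Q A) (fibre_monoidal Q A'')
    (comp_monoidal_fun (push_monoidal g) (push_monoidal f)) (push_monoidal (g \<cdot>\<^bsub>B\<^esub> f))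
        (comp_cell_mon g f)"
proof -
  note F = sym_fun_push[OF f(1,3,4)] and G = sym_fun_push[OF f(2,5,6)]
  have A: "A \<in> Obj B" "A' \<in> Obj B" "A'' \<in> Obj B" using f by auto
  have gf: "g \<cdot>\<^bsub>B\<^esub> f \<in> Arr B" "Dom B (g \<cdot>\<^bsub>B\<^esub> f) = A" "Cod B (g \<cdot>\<^bsub>B\<^esub> f) = A''" using f by simp_all
  \<comment> \<open>The composites of liftings of \<open>f\<close> and \<open>g\<close>: cocartesian
    arrows that the comparison cell sends to the liftings of the composite base arrow.\<close>
  let ?c = "\<lambda>X. Cleav Q g (ObF (push Q f) X) \<bullet> Cleav Q f X"
  have cc: "cocartesian Q (?c X)" "?c X \<in> Arr T" "Dom T (?c X) = X" "pobj Q (Cod T (?c X)) = A''"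
    if "X \<in> Obj T" "pobj Q X = A" for X
    by (rule cocartesian_comp) (use f that in simp_all)
  note [simp] = f A gf comp_mul[OF F G]
  show ?thesis
  proof (rule sym_transI[OF comp_sym_fun[OF F G] sym_fun_push[OF gf]], goal_cases)
    case 5 show ?case
      by (simp add: comp_cell_mon_def associated_pseudofunctor_def)
  next
    case (7 u) show ?case
      by (rule cocartesian_cancel[of "?c (Dom T u)"])
          (use 7 cc(1)[of "Dom T u"] in \<open>simp_all add: comp_cell_mon_def\<close>)
  next
    case (8 X Y)
    obtain x y where g: "x \<in> Arr T" "y \<in> Arr T" "Dom T x = Dom T y" "Cod T x = X" "Cod T y = Y"
      "cocartesian Q (pair A'' (?c X \<bullet> x) (?c Y \<bullet> y))"
      using generic2[of A'' "?c X" "?c Y"] 8 cc[of X] cc[of Y] by auto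
    show ?case
      by (rule cocartesian_cancel[of "pair A'' (?c X \<bullet> x) (?c Y \<bullet> y)"])
          (use 8 g in \<open>simp_all add: comp_cell_mon_def\<close>)
  next
    case 9 show ?case
      by (rule cocartesian_cancel[of "unit_arrow Q A''"]) (simp_all add: comp_cell_mon_def)
  qed (simp_all add: comp_cell_mon_def)
qed

text \<open>The lifting of an identity is itself vertical and serves as component. Its compatibility
  with the monoidal structure is the evaluation rule for \<open>Mul\<close> and \<open>Uni\<close>
  of \<open>push_monoidal (Idn B A)\<close>.\<close>

lemma sym_trans_unit_cell:
  assumes A [simp]: "A \<in> Obj B"
  shows "sym_trans (fibre_monoidal Q A) (fibre_monoidal Q A)
    (id_monoidal_fun (fibre_monoidal Q A)) (push_monoidal (Idn B A)) (unit_cell_mon A)"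
proof (rule sym_transI[OF sym_fun_id[OF smc_fibre_monoidal] sym_fun_push], goal_cases)
  case 9 show ?case
    by (simp add: unit_cell_mon_def associated_pseudofunctor_def)
next
  case (12 X Y)
  obtain x y where g: "x \<in> Arr T" "y \<in> Arr T" "Dom T x = Dom T y" "Cod T x = X" "Cod T y = Y"
    "cocartesian Q (pair A x y)"
    using generic_obj2[of A X Y] 12 by auto
  show ?case
    by (rule cocartesian_cancel[of "pair A x y"]) (use 12 g in \<open>simp_all add: unit_cell_mon_def\<close>)
next
  case 13 show ?case
    by (rule cocartesian_cancel[of "unit_arrow Q A"]) (simp_all add: unit_cell_mon_def)
qed (simp_all add: unit_cell_mon_def id_monoidal_fun_def)

end

section \<open>Opfibrations with groupoidal fibres\<close>

text \<open>A symmetric 2-group is a groupoid by definition, and the factorisation has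
  \<open>fibre_monoidal Q A\<close> as its value at \<open>A\<close>, with the fibre as underlying
  category.\<close>

lemma groupoid_of_factors_through_Sym2Gp:
  assumes "factors_through_Sym2Gp Q" "A \<in> Obj (Base Q)"
  shows "groupoid (fibre Q A)"
proof -
  obtain G where G: "pseudofunctor (Base Q) Sym2Gp G" "PObj G A = fibre_monoidal Q A"
    using assms by (auto simp: factors_through_Sym2Gp_def)
  have "symmetric_2_group (fibre_monoidal Q A)"
    using pseudofunctor.obj[OF G(1) assms(2)] G(2) by (simp add: Sym2Gp_def)
  then have "groupoid (category.truncate (fibre_monoidal Q A))"
    by (simp add: symmetric_2_group_def)
  moreover have "category.truncate (fibre_monoidal Q A) = fibre Q A"
    by (simp add: fibre_monoidal_def Let_def category.defs fibre_def)
  ultimately show ?thesis by simp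
qed

locale groupoidal_opfibration = additive_opfibration Q add zero
  for Q :: "('x, 'g, 'b, 'f) opfib" and add zero +
  assumes groupoidal: "A \<in> Obj B \<Longrightarrow> groupoid (fibre Q A)"
begin

section \<open>Terminal objects and weak inverses in groupoidal fibres\<close>

lemma vertical_iso:
  assumes "u \<in> Arr T" "parr Q u = Idn B A" "A \<in> Obj B" "pobj Q (Dom T u) = A"
  shows "isomorphism (fibre Q A) u"
  using groupoidal[OF assms(3)] assms vertical_cod[OF assms(1-3)] by (simp add: groupoid_def)

text \<open>The fibre over the terminal object is a groupoid with a terminal object,
  so all its objects are terminal.\<close>

lemma cocartesian_bang:
  assumes X: "X \<in> Obj T"
  shows "cocartesian Q (bang T X)"
proof -
  let ?b = "bang B (pobj Q X)"
  let ?W = "ObF (push Q ?b) X"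
  have W: "?W \<in> Obj T" "pobj Q ?W = One B" using X by simp_all
  have "parr Q (bang T ?W) = Idn B (One B)"
    by (rule base.into_One_eqI) (use W in simp_all)
  then have "isomorphism (fibre Q (One B)) (bang T ?W)"
    by (intro vertical_iso) (use W in simp_all)
  then have "isomorphism T (bang T ?W)"
    by (auto simp: isomorphism_def inverse_arrows_def Hom_iff)
  \<comment> \<open>The arrow \<open>X \<rightarrow> 1\<close> is the lifting of \<open>?b\<close>
    followed by an isomorphism.\<close>
  then have "cocartesian Q (bang T ?W \<bullet> Cleav Q ?b X)"
    by (intro cocartesian_comp[OF _ cocartesian_iso]) (use X W in simp_all)
  moreover have "bang T ?W \<bullet> Cleav Q ?b X = bang T X"
    by (rule total.into_One_eqI) (use X W in simp_all)
  ultimately show ?thesis by simp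
qed

text \<open>With \<open>D\<close> the domain of \<open>p\<close>, the cocartesian arrow
  \<open>D \<rightarrow> 1 \<rightarrow> E\<close> also lies over zero, so \<open>p\<close> factors
  through it by a vertical arrow. That arrow is invertible, and its inverse is the required
  isomorphism.\<close>

lemma isomorphic_unit:
  assumes A: "A \<in> Obj B" and p: "p \<in> Arr T" "parr Q p = zero A A" "pobj Q (Dom T p) = A"
  shows "isomorphic (fibre_monoidal Q A) (Cod T p) (fibre_unit Q A)"
proof -
  let ?k = "unit_arrow Q A \<bullet> bang T (Dom T p)"
  have k: "cocartesian Q ?k"
    by (rule cocartesian_comp) (use A p in \<open>simp_all add: cocartesian_bang\<close>)
  have "parr Q p = parr Q ?k"
    using A p by simp
  note u = vfactor_simps[OF k p(1) _ this]
  have "isomorphism (fibre Q A) (vfactor Q ?k p)"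
    by (rule vertical_iso) (use A p u in simp_all)
  then obtain g where g: "g \<in> Arr (fibre Q A)" "Dom T g = Cod T p" "Cod T g = fibre_unit Q A"
    "g \<bullet> vfactor Q ?k p = Idn T (fibre_unit Q A)" "vfactor Q ?k p \<bullet> g = Idn T (Cod T p)"
    using A p u by (auto elim!: isomorphismE)
  have "isomorphism (fibre_monoidal Q A) g"
    by (rule isomorphismI[where g = "vfactor Q ?k p"]) (use A p u g in simp_all)
  with g A show ?thesis
    by (auto simp: isomorphic_def Hom_iff)
qed

lemma symmetric_2_group_fibre_monoidal:
  assumes A: "A \<in> Obj B"
  shows "symmetric_2_group (fibre_monoidal Q A)"
  unfolding symmetric_2_group_def
proof (intro conjI ballI)
  show "symmetric_monoidal_category (fibre_monoidal Q A)"
    by (rule smc_fibre_monoidal[OF A])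
  show "groupoid (fibre_monoidal Q A)"
    using groupoidal[OF A] groupoid_truncate_iff[of "fibre_monoidal Q A"] A by simp
  fix X assume "X \<in> Obj (fibre_monoidal Q A)"
  with A have X: "X \<in> Obj T" "pobj Q X = A" by simp_all
  \<comment> \<open>The inversion of \<open>A\<close> is the negative of its identity; the weak
    inverse of \<open>X\<close> is its change of base along \<open>i\<close>.\<close>
  obtain i where i: "i \<in> Arr B" "Dom B i = A" "Cod B i = A" "add (Idn B A) i = zero A A"
      "add i (Idn B A) = zero A A"
    using B.neg_exists[of "Idn B A"] A by auto
  let ?c = "Cleav Q i X" and ?Y = "ObF (push Q i) X"
  show "weakly_invertible (fibre_monoidal Q A) X"
    unfolding weakly_invertible_def
  proof (intro bexI conjI)
    \<comment> \<open>The element formed from the identity of \<open>X\<close> and the lifting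
      \<open>?c\<close> has the tensor product as codomain and lies over
      \<open>1 + i = 0\<close>.\<close>
    show "isomorphic (fibre_monoidal Q A) (ten_obj (fibre_monoidal Q A) X ?Y)
        (Unt (fibre_monoidal Q A))"
      using isomorphic_unit[OF A, of "pair A (Idn T X) ?c"] A X i by simp
    show "isomorphic (fibre_monoidal Q A) (ten_obj (fibre_monoidal Q A) ?Y X)
        (Unt (fibre_monoidal Q A))"
      using isomorphic_unit[OF A, of "pair A ?c (Idn T X)"] A X i by simp
  qed (use A X i in simp)
qed

section \<open>The lifting of the pseudofunctor to symmetric 2-groups\<close>

definition lifted_pseudofunctor ::
  "('b, 'f, ('x, 'g) monoidal_cat, ('x, 'g) monoidal_fun, ('x, 'g) monoidal_trans) pseudo" where
  "lifted_pseudofunctor = \<lparr>PObj = fibre_monoidal Q, PArr = push_monoidal, PComp = comp_cell_mon,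
     PUnit = unit_cell_mon\<rparr>"

lemma lifted_simps [simp]:
  "PObj lifted_pseudofunctor = fibre_monoidal Q" "PArr lifted_pseudofunctor = push_monoidal"
  "PComp lifted_pseudofunctor = comp_cell_mon" "PUnit lifted_pseudofunctor = unit_cell_mon"
  by (simp_all add: lifted_pseudofunctor_def)

lemma cell0: "A \<in> Obj B \<Longrightarrow> fibre_monoidal Q A \<in> Cell0 Sym2Gp"
  using symmetric_2_group_fibre_monoidal[of A] by (simp add: Sym2Gp_def)

lemma cell_simps [simp]:
  "TSrc (comp_cell_mon g f) = comp_monoidal_fun (push_monoidal g) (push_monoidal f)"
  "TTgt (comp_cell_mon g f) = push_monoidal (g \<cdot>\<^bsub>B\<^esub> f)" "TNat (comp_cell_mon g f) = comp_cell_cat g f"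
  "TSrc (unit_cell_mon A) = id_monoidal_fun (fibre_monoidal Q A)"
  "TTgt (unit_cell_mon A) = push_monoidal (Idn B A)" "TNat (unit_cell_mon A) = unit_cell_cat A"
  by (simp_all add: comp_cell_mon_def unit_cell_mon_def)

lemma groupoid_fibre_monoidal: "A \<in> Obj B \<Longrightarrow> groupoid (fibre_monoidal Q A)"
  using symmetric_2_group_fibre_monoidal by (simp add: symmetric_2_group_def)

text \<open>Both sides send the composite of the three chosen liftings to the chosen lifting of the
  composite of \<open>f\<close>, \<open>g\<close> and \<open>h\<close>, and that composite of
  liftings is cocartesian.\<close>

lemma comp_cell_assoc:
  assumes f: "f \<in> Arr B" "Dom B f = A" "Cod B f = A'" and g: "g \<in> Arr B" "Dom B g = A'"
      "Cod B g = A''"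
    and h: "h \<in> Arr B" "Dom B h = A''" "Cod B h = A'''"
  shows "VComp Sym2Gp (comp_cell_mon h (g \<cdot>\<^bsub>B\<^esub> f))
      (HComp Sym2Gp (Id2 Sym2Gp (push_monoidal h)) (comp_cell_mon g f))
    = VComp Sym2Gp (comp_cell_mon (h \<cdot>\<^bsub>B\<^esub> g) f)
        (HComp Sym2Gp (comp_cell_mon h g) (Id2 Sym2Gp (push_monoidal f)))"
proof -
  note fgh = f g h
  note F = sym_fun_push[OF f] and G = sym_fun_push[OF g] and H = sym_fun_push[OF h]
  have A: "A \<in> Obj B" "A' \<in> Obj B" "A'' \<in> Obj B" "A''' \<in> Obj B" using f g h by auto
  have 1: "sym_trans (fibre_monoidal Q A) (fibre_monoidal Q A''')
      (comp_monoidal_fun (push_monoidal h) (comp_monoidal_fun (push_monoidal g) (push_monoidal f)))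
      (push_monoidal (h \<cdot>\<^bsub>B\<^esub> (g \<cdot>\<^bsub>B\<^esub> f)))
      (VComp Sym2Gp (comp_cell_mon h (g \<cdot>\<^bsub>B\<^esub> f))
          (HComp Sym2Gp (Id2 Sym2Gp (push_monoidal h)) (comp_cell_mon g f)))"
    by (rule sym_trans_vcomp[OF sym_trans_hcomp[OF sym_trans_comp_cell sym_trans_id[OF H]]
        sym_trans_comp_cell])
      (use f g h in simp_all)
  have "sym_trans (fibre_monoidal Q A) (fibre_monoidal Q A''')
      (comp_monoidal_fun (comp_monoidal_fun (push_monoidal h) (push_monoidal g)) (push_monoidal f))
      (push_monoidal ((h \<cdot>\<^bsub>B\<^esub> g) \<cdot>\<^bsub>B\<^esub> f))
      (VComp Sym2Gp (comp_cell_mon (h \<cdot>\<^bsub>B\<^esub> g) f)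
          (HComp Sym2Gp (comp_cell_mon h g) (Id2 Sym2Gp (push_monoidal f))))"
    by (rule sym_trans_vcomp[OF sym_trans_hcomp[OF sym_trans_id[OF F] sym_trans_comp_cell]
        sym_trans_comp_cell])
      (use f g h in simp_all)
  \<comment> \<open>Strict associativity of composition, for monoidal functors and in the base,
    gives both transformations the same boundary.\<close>
  then have 2: "sym_trans (fibre_monoidal Q A) (fibre_monoidal Q A''')
      (comp_monoidal_fun (push_monoidal h) (comp_monoidal_fun (push_monoidal g) (push_monoidal f)))
      (push_monoidal (h \<cdot>\<^bsub>B\<^esub> (g \<cdot>\<^bsub>B\<^esub> f)))
      (VComp Sym2Gp (comp_cell_mon (h \<cdot>\<^bsub>B\<^esub> g) f)
          (HComp Sym2Gp (comp_cell_mon h g) (Id2 Sym2Gp (push_monoidal f))))"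
    using comp_assoc_sym_fun[OF F G H] fgh by simp
  show ?thesis
  proof (rule sym_trans_eqI[OF 1 2])
    fix X assume "X \<in> Obj (fibre_monoidal Q A)"
    with A have X: "X \<in> Obj T" "pobj Q X = A" by simp_all
    let ?k = "Cleav Q h (ObF (push Q g) (ObF (push Q f) X)) \<bullet> Cleav Q g (ObF (push Q f) X)
        \<bullet> Cleav Q f X"
    have "cocartesian Q ?k"
      by (intro cocartesian_comp) (use X f g h in simp_all)
    then show "NCmp (TNat (VComp Sym2Gp (comp_cell_mon h (g \<cdot>\<^bsub>B\<^esub> f))
        (HComp Sym2Gp (Id2 Sym2Gp (push_monoidal h)) (comp_cell_mon g f)))) X
      = NCmp (TNat (VComp Sym2Gp (comp_cell_mon (h \<cdot>\<^bsub>B\<^esub> g) f)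
          (HComp Sym2Gp (comp_cell_mon h g) (Id2 Sym2Gp (push_monoidal f))))) X"
      by (rule cocartesian_cancel) (use X f g h A in simp_all)
  qed
qed

text \<open>Evaluated on the lifting of \<open>f\<close> at \<open>X\<close>, the left side passes
  through the lifting of the identity followed by one of \<open>f\<close>, and the comparison cell
  returns the lifting of \<open>f\<close>.\<close>

lemma comp_cell_unit_right:
  assumes f: "f \<in> Arr B" "Dom B f = A" "Cod B f = A'"
  shows "VComp Sym2Gp (comp_cell_mon f (Idn B A))
      (HComp Sym2Gp (Id2 Sym2Gp (push_monoidal f)) (unit_cell_mon A))
    = Id2 Sym2Gp (push_monoidal f)"
proof -
  note F = sym_fun_push[OF f]
  have A: "A \<in> Obj B" "A' \<in> Obj B" using f by auto
  have "sym_trans (fibre_monoidal Q A) (fibre_monoidal Q A')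
      (comp_monoidal_fun (push_monoidal f) (id_monoidal_fun (fibre_monoidal Q A)))
          (push_monoidal (f \<cdot>\<^bsub>B\<^esub> Idn B A))
      (VComp Sym2Gp (comp_cell_mon f (Idn B A))
          (HComp Sym2Gp (Id2 Sym2Gp (push_monoidal f)) (unit_cell_mon A)))"
    by (rule sym_trans_vcomp[OF sym_trans_hcomp[OF sym_trans_unit_cell sym_trans_id[OF F]]
        sym_trans_comp_cell])
      (use f A in simp_all)
  then have 1: "sym_trans (fibre_monoidal Q A) (fibre_monoidal Q A') (push_monoidal f)
      (push_monoidal f)
      (VComp Sym2Gp (comp_cell_mon f (Idn B A))
          (HComp Sym2Gp (Id2 Sym2Gp (push_monoidal f)) (unit_cell_mon A)))"
    using comp_id_right_sym_fun[OF F] f by simp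
  show ?thesis
  proof (rule sym_trans_eqI[OF 1 sym_trans_id[OF F]])
    fix X assume "X \<in> Obj (fibre_monoidal Q A)"
    with A have X: "X \<in> Obj T" "pobj Q X = A" by simp_all
    show "NCmp (TNat (VComp Sym2Gp (comp_cell_mon f (Idn B A))
        (HComp Sym2Gp (Id2 Sym2Gp (push_monoidal f)) (unit_cell_mon A)))) X
      = NCmp (TNat (Id2 Sym2Gp (push_monoidal f))) X"
      by (rule cocartesian_cancel[of "Cleav Q f X"]) (use X f A in \<open>simp_all add: id_functor_def\<close>)
  qed
qed

text \<open>The same evaluation, with the lifting of the identity now following that of
  \<open>f\<close>.\<close>

lemma comp_cell_unit_left:
  assumes f: "f \<in> Arr B" "Dom B f = A" "Cod B f = A'"
  shows "VComp Sym2Gp (comp_cell_mon (Idn B A') f)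
      (HComp Sym2Gp (unit_cell_mon A') (Id2 Sym2Gp (push_monoidal f)))
    = Id2 Sym2Gp (push_monoidal f)"
proof -
  note F = sym_fun_push[OF f]
  have A: "A \<in> Obj B" "A' \<in> Obj B" using f by auto
  have "sym_trans (fibre_monoidal Q A) (fibre_monoidal Q A')
      (comp_monoidal_fun (id_monoidal_fun (fibre_monoidal Q A')) (push_monoidal f))
          (push_monoidal (Idn B A' \<cdot>\<^bsub>B\<^esub> f))
      (VComp Sym2Gp (comp_cell_mon (Idn B A') f)
          (HComp Sym2Gp (unit_cell_mon A') (Id2 Sym2Gp (push_monoidal f))))"
    by (rule sym_trans_vcomp[OF sym_trans_hcomp[OF sym_trans_id[OF F] sym_trans_unit_cell]
        sym_trans_comp_cell])
      (use f A in simp_all)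
  then have 1: "sym_trans (fibre_monoidal Q A) (fibre_monoidal Q A') (push_monoidal f)
      (push_monoidal f)
      (VComp Sym2Gp (comp_cell_mon (Idn B A') f)
          (HComp Sym2Gp (unit_cell_mon A') (Id2 Sym2Gp (push_monoidal f))))"
    using comp_id_left_sym_fun[OF F] f by simp
  show ?thesis
  proof (rule sym_trans_eqI[OF 1 sym_trans_id[OF F]])
    fix X assume "X \<in> Obj (fibre_monoidal Q A)"
    with A have X: "X \<in> Obj T" "pobj Q X = A" by simp_all
    show "NCmp (TNat (VComp Sym2Gp (comp_cell_mon (Idn B A') f)
        (HComp Sym2Gp (unit_cell_mon A') (Id2 Sym2Gp (push_monoidal f))))) X
      = NCmp (TNat (Id2 Sym2Gp (push_monoidal f))) X"
      by (rule cocartesian_cancel[of "Cleav Q f X"]) (use X f A in \<open>simp_all add: id_functor_def\<close>)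
  qed
qed

lemma pseudofunctor_lifted: "pseudofunctor B Sym2Gp lifted_pseudofunctor"
proof (rule pseudofunctor.intro[OF base.category_axioms two_category_Sym2Gp
    pseudofunctor_axioms.intro],
    unfold lifted_simps Hom_iff, goal_cases)
  case (1 A) then show ?case by (simp add: cell0)
next
  case (2 f A A')
  then have "A \<in> Obj B" "A' \<in> Obj B" by auto
  with 2 show ?case by (simp add: Cell1_Sym2Gp cell0 sym_fun_push)
next
  \<comment> \<open>Comparison cells are invertible because the target fibre is a groupoid.\<close>
  case (3 f A A' g A'')
  then show ?case
    using invertible2_Sym2Gp[OF sym_trans_comp_cell[of f g A A' A'']] base.obj_simps(2)[of g]
    by (auto simp: groupoid_fibre_monoidal)
next
  case (4 A)
  then show ?case
    using invertible2_Sym2Gp[OF sym_trans_unit_cell] by (simp add: groupoid_fibre_monoidal)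
next
  case 5 then show ?case by (intro comp_cell_assoc) auto
next
  case 6 then show ?case by (intro comp_cell_unit_right) auto
next
  case 7 then show ?case by (intro comp_cell_unit_left) auto
qed

lemma factors_through: "factors_through_Sym2Gp Q"
  unfolding factors_through_Sym2Gp_def
proof (intro exI conjI ballI)
  show "pseudofunctor B Sym2Gp lifted_pseudofunctor"
    by (rule pseudofunctor_lifted)
  show "same_pseudofunctor B (comp_pseudo forget_Sym2Gp lifted_pseudofunctor)
      (associated_pseudofunctor Q)"
    \<comment> \<open>The lifting carries the data of \<open>F\<close> as its underlying functors
      and transformations, so this is a comparison of record fields.\<close>
    by (simp add: same_pseudofunctor_def comp_pseudo_def forget_Sym2Gp_def)
qed simp

end

theorem theorem5p9:
  fixes Q :: "('x, 'g, 'b, 'f) opfib"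
  assumes "additive_category (Base Q)"
    and "cartesian_monoidal_opfibration Q"
  shows "factors_through_Sym2Gp Q \<longleftrightarrow> (\<forall>A \<in> Obj (Base Q). groupoid (fibre Q A))"
proof
  assume "factors_through_Sym2Gp Q"
  then show "\<forall>A \<in> Obj (Base Q). groupoid (fibre Q A)"
    by (simp add: groupoid_of_factors_through_Sym2Gp)
next
  assume groupoidal: "\<forall>A \<in> Obj (Base Q). groupoid (fibre Q A)"
  \<comment> \<open>The descriptions \<open>group_mult\<close> and \<open>group_unit\<close> make no
    reference to an addition, so any pair witnessing additivity may be chosen.\<close>
  obtain add zero where add: "preadditive_category (Base Q) add zero"
    using assms(1) by (auto simp: additive_category_def)
  interpret cartesian_monoidal_opfibration Q by fact
  interpret preadditive_category "Base Q" add zero by fact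
  interpret groupoidal_opfibration Q add zero
    by unfold_locales (use groupoidal in simp)
  show "factors_through_Sym2Gp Q"
    by (rule factors_through)
qed

end
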